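(* Let $G\in\mathcal{C}$, let $H$ be a hole of $G$ of length greater than six, and let $w$ be a major vertex for $H$ such that either $w$ is not a hub for $H$ or every major vertex for $H$ is a hub for $H$. Let $P=p_1\text{-}\cdots\text{-}p_k$ be an $(H,w)$-significant path. Then $w$ has a neighbor in $P$.
   Context: All graphs are finite and simple; paths are induced paths; a hole is an induced cycle of length at least four. $\mathcal{C}$ is the class of graphs containing no theta, pyramid, prism or turtle as an induced subgraph, where: a theta consists of two nonadjacent vertices $a,b$ and three paths from $a$ to $b$, otherwise vertex-disjoint, any two of which induce a hole; a pyramid consists of a vertex $a$, a triangle $\{b_1,b_2,b_3\}$ and paths $P_i$ from $a$ to $b_i$, pairwise disjoint except at $a$, any two of which induce a hole; a prism consists of two disjoint triangles $\{a_1,a_2,a_3\},\{b_1,b_2,b_3\}$ and pairwise disjoint paths $P_i$ from $a_i$ to $b_i$, any two of which induce a hole; a turtle consists of disjoint paths $P_1$ (from $a_1$ to $b_1$), $P_2$ (from $a_2$ to $b_2$) with $a_1a_2,b_1b_2$ edges and $V(P_1)\cup V(P_2)$ inducing a hole, plus adjacent vertices $x,y$ where $x$ has at least three neighbors in $P_1$ and none in $P_2$, and $y$ has at least three neighbors in $P_2$ and none in $P_1$. For a hole $H$ and a vertex $u$, $N_H(u)$ is the set of neighbors of $u$ in $V(H)\setminus\{u\}$. A vertex $u\notin V(H)$ is minor for $H$ if $N_H(u)\neq\emptyset$ and $N_H(u)$ is contained in the vertex set of some three-vertex subpath of $H$; it is major for $H$ if $N_H(u)\ne\emptyset$ and $u$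 is not minor. A major vertex $u$ is a hub for $H$ if $N_H(u)=\{x,y,z,w'\}$ where $x,y,z,w'$ appear in this order along $H$, $xy,zw'\in E(G)$ and $xw',yz\notin E(G)$. A $w$-sector is a subpath $Q=x\text{-}\cdots\text{-}y$ of $H$ with $x,y$ neighbors of $w$ and no interior vertex adjacent to $w$. An extended neighborhood of $w$ in $H$ is a path of the form $Q\cup(\{x',y'\}\cap N_H(w))$, where $Q=x\text{-}\cdots\text{-}y$ is a $w$-sector and $x',y'$ are the neighbors of $x,y$ respectively in $H\setminus V(Q)$. Two vertices $a,b\in V(H)$ are distant in $H$ with respect to $w$ if no extended neighborhood of $w$ in $H$ contains both $a$ and $b$. A path $P=p_1\text{-}\cdots\text{-}p_k$ of $G$ is $(H,w)$-significant if there exist $a,b\in V(H)$ with $a\in N_H(p_1)\setminus N_H(w)$, $b\in N_H(p_k)$, and $a,b$ distant in $H$ with respect to $w$. *)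

theory Defs
  imports Main
begin

definition simple_graph :: "'a set \<Rightarrow> ('a \<Rightarrow> 'a \<Rightarrow> bool) \<Rightarrow> bool" where
  "simple_graph V E \<longleftrightarrow> finite V \<and> (\<forall>x y. E x y \<longrightarrow> x \<in> V \<and> y \<in> V)
     \<and> (\<forall>x y. E x y \<longrightarrow> E y x) \<and> (\<forall>x. \<not> E x x)"

definition ipath :: "'a set \<Rightarrow> ('a \<Rightarrow> 'a \<Rightarrow> bool) \<Rightarrow> 'a list \<Rightarrow> bool" where
  "ipath V E P \<longleftrightarrow> P \<noteq> [] \<and> distinct P \<and> set P \<subseteq> V \<and>
     (\<forall>i j. i < length P \<longrightarrow> j < length P \<longrightarrow> (E (P!i) (P!j) \<longleftrightarrow> (i = Suc j \<or> j = Suc i)))"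

definition hole :: "'a set \<Rightarrow> ('a \<Rightarrow> 'a \<Rightarrow> bool) \<Rightarrow> 'a list \<Rightarrow> bool" where
  "hole V E H \<longleftrightarrow> length H \<ge> 4 \<and> distinct H \<and> set H \<subseteq> V \<and>
     (\<forall>i j. i < length H \<longrightarrow> j < length H \<longrightarrow>
        (E (H!i) (H!j) \<longleftrightarrow> (j = Suc i mod length H \<or> i = Suc j mod length H)))"

definition induces_hole :: "'a set \<Rightarrow> ('a \<Rightarrow> 'a \<Rightarrow> bool) \<Rightarrow> 'a set \<Rightarrow> bool" where
  "induces_hole V E S \<longleftrightarrow> (\<exists>H. hole V E H \<and> set H = S)"

definition path_from_to :: "'a set \<Rightarrow> ('a \<Rightarrow> 'a \<Rightarrow> bool) \<Rightarrow> 'a list \<Rightarrow> 'a \<Rightarrow> 'a \<Rightarrow> bool" where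
  "path_from_to V E P a b \<longleftrightarrow> ipath V E P \<and> hd P = a \<and> last P = b"

definition has_theta :: "'a set \<Rightarrow> ('a \<Rightarrow> 'a \<Rightarrow> bool) \<Rightarrow> bool" where
  "has_theta V E \<longleftrightarrow> (\<exists>a b P1 P2 P3. a \<noteq> b \<and> \<not> E a b \<and>
     path_from_to V E P1 a b \<and> path_from_to V E P2 a b \<and> path_from_to V E P3 a b \<and>
     set P1 \<inter> set P2 = {a, b} \<and> set P1 \<inter> set P3 = {a, b} \<and> set P2 \<inter> set P3 = {a, b} \<and>
     induces_hole V E (set P1 \<union> set P2) \<and> induces_hole V E (set P1 \<union> set P3) \<and>
     induces_hole V E (set P2 \<union> set P3))"

definition has_pyramid :: "'a set \<Rightarrow> ('a \<Rightarrow> 'a \<Rightarrow> bool) \<Rightarrow> bool" where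
  "has_pyramid V E \<longleftrightarrow> (\<exists>a b1 b2 b3 P1 P2 P3.
     b1 \<noteq> b2 \<and> b1 \<noteq> b3 \<and> b2 \<noteq> b3 \<and> E b1 b2 \<and> E b1 b3 \<and> E b2 b3 \<and>
     path_from_to V E P1 a b1 \<and> path_from_to V E P2 a b2 \<and> path_from_to V E P3 a b3 \<and>
     set P1 \<inter> set P2 = {a} \<and> set P1 \<inter> set P3 = {a} \<and> set P2 \<inter> set P3 = {a} \<and>
     induces_hole V E (set P1 \<union> set P2) \<and> induces_hole V E (set P1 \<union> set P3) \<and>
     induces_hole V E (set P2 \<union> set P3))"

definition has_prism :: "'a set \<Rightarrow> ('a \<Rightarrow> 'a \<Rightarrow> bool) \<Rightarrow> bool" where
  "has_prism V E \<longleftrightarrow> (\<exists>a1 a2 a3 b1 b2 b3 P1 P2 P3.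
     a1 \<noteq> a2 \<and> a1 \<noteq> a3 \<and> a2 \<noteq> a3 \<and> E a1 a2 \<and> E a1 a3 \<and> E a2 a3 \<and>
     b1 \<noteq> b2 \<and> b1 \<noteq> b3 \<and> b2 \<noteq> b3 \<and> E b1 b2 \<and> E b1 b3 \<and> E b2 b3 \<and>
     {a1, a2, a3} \<inter> {b1, b2, b3} = {} \<and>
     path_from_to V E P1 a1 b1 \<and> path_from_to V E P2 a2 b2 \<and> path_from_to V E P3 a3 b3 \<and>
     set P1 \<inter> set P2 = {} \<and> set P1 \<inter> set P3 = {} \<and> set P2 \<inter> set P3 = {} \<and>
     induces_hole V E (set P1 \<union> set P2) \<and> induces_hole V E (set P1 \<union> set P3) \<and>
     induces_hole V E (set P2 \<union> set P3))"

definition has_turtle :: "'a set \<Rightarrow> ('a \<Rightarrow> 'a \<Rightarrow> bool) \<Rightarrow> bool" where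
  "has_turtle V E \<longleftrightarrow> (\<exists>a1 b1 a2 b2 P1 P2 x y.
     path_from_to V E P1 a1 b1 \<and> path_from_to V E P2 a2 b2 \<and> set P1 \<inter> set P2 = {} \<and>
     E a1 a2 \<and> E b1 b2 \<and> induces_hole V E (set P1 \<union> set P2) \<and>
     x \<in> V \<and> y \<in> V \<and> x \<notin> set P1 \<union> set P2 \<and> y \<notin> set P1 \<union> set P2 \<and> E x y \<and>
     card {v \<in> set P1. E x v} \<ge> 3 \<and> (\<forall>v \<in> set P2. \<not> E x v) \<and>
     card {v \<in> set P2. E y v} \<ge> 3 \<and> (\<forall>v \<in> set P1. \<not> E y v))"

definition in_class_C :: "'a set \<Rightarrow> ('a \<Rightarrow> 'a \<Rightarrow> bool) \<Rightarrow> bool" where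
  "in_class_C V E \<longleftrightarrow> simple_graph V E \<and> \<not> has_theta V E \<and> \<not> has_pyramid V E \<and>
     \<not> has_prism V E \<and> \<not> has_turtle V E"

definition NH :: "('a \<Rightarrow> 'a \<Rightarrow> bool) \<Rightarrow> 'a list \<Rightarrow> 'a \<Rightarrow> 'a set" where
  "NH E H u = {v \<in> set H. v \<noteq> u \<and> E u v}"

definition seg :: "'a list \<Rightarrow> nat \<Rightarrow> nat \<Rightarrow> 'a list" where
  "seg H s m = map (\<lambda>t. H ! ((s + t) mod length H)) [0..<Suc m]"

definition minor :: "'a set \<Rightarrow> ('a \<Rightarrow> 'a \<Rightarrow> bool) \<Rightarrow> 'a list \<Rightarrow> 'a \<Rightarrow> bool" where
  "minor V E H u \<longleftrightarrow> u \<in> V \<and> u \<notin> set H \<and> NH E H u \<noteq> {} \<and>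
     (\<exists>s < length H. NH E H u \<subseteq> set (seg H s 2))"

definition major :: "'a set \<Rightarrow> ('a \<Rightarrow> 'a \<Rightarrow> bool) \<Rightarrow> 'a list \<Rightarrow> 'a \<Rightarrow> bool" where
  "major V E H u \<longleftrightarrow> u \<in> V \<and> u \<notin> set H \<and> NH E H u \<noteq> {} \<and> \<not> minor V E H u"

definition in_order4 :: "'a list \<Rightarrow> 'a \<Rightarrow> 'a \<Rightarrow> 'a \<Rightarrow> 'a \<Rightarrow> bool" where
  "in_order4 H x y z w \<longleftrightarrow> (\<exists>r i1 i2 i3 i4. r < length H \<and> i1 < i2 \<and> i2 < i3 \<and> i3 < i4 \<and>
     i4 < length H \<and> H ! ((r + i1) mod length H) = x \<and> H ! ((r + i2) mod length H) = y \<and>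
     H ! ((r + i3) mod length H) = z \<and> H ! ((r + i4) mod length H) = w)"

definition hub :: "'a set \<Rightarrow> ('a \<Rightarrow> 'a \<Rightarrow> bool) \<Rightarrow> 'a list \<Rightarrow> 'a \<Rightarrow> bool" where
  "hub V E H u \<longleftrightarrow> major V E H u \<and> (\<exists>x y z w'. NH E H u = {x, y, z, w'} \<and>
     in_order4 H x y z w' \<and> E x y \<and> E z w' \<and> \<not> E x w' \<and> \<not> E y z)"

definition sector :: "('a \<Rightarrow> 'a \<Rightarrow> bool) \<Rightarrow> 'a list \<Rightarrow> 'a \<Rightarrow> nat \<Rightarrow> nat \<Rightarrow> bool" where
  "sector E H w s m \<longleftrightarrow> s < length H \<and> 1 \<le> m \<and> Suc m < length H \<and>
     H ! s \<in> NH E H w \<and> H ! ((s + m) mod length H) \<in> NH E H w \<and>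
     (\<forall>t. 0 < t \<and> t < m \<longrightarrow> H ! ((s + t) mod length H) \<notin> NH E H w)"

definition ext_nbhd :: "('a \<Rightarrow> 'a \<Rightarrow> bool) \<Rightarrow> 'a list \<Rightarrow> 'a \<Rightarrow> nat \<Rightarrow> nat \<Rightarrow> 'a set" where
  "ext_nbhd E H w s m = set (seg H s m) \<union>
     ({H ! ((s + length H - 1) mod length H), H ! ((s + m + 1) mod length H)} \<inter> NH E H w)"

definition distant :: "('a \<Rightarrow> 'a \<Rightarrow> bool) \<Rightarrow> 'a list \<Rightarrow> 'a \<Rightarrow> 'a \<Rightarrow> 'a \<Rightarrow> bool" where
  "distant E H w a b \<longleftrightarrow> a \<in> set H \<and> b \<in> set H \<and>
     \<not> (\<exists>s m. sector E H w s m \<and> a \<in> ext_nbhd E H w s m \<and> b \<in> ext_nbhd E H w s m)"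

definition significant :: "'a set \<Rightarrow> ('a \<Rightarrow> 'a \<Rightarrow> bool) \<Rightarrow> 'a list \<Rightarrow> 'a \<Rightarrow> 'a list \<Rightarrow> bool" where
  "significant V E H w P \<longleftrightarrow> ipath V E P \<and> (\<exists>a b.
     a \<in> NH E H (hd P) - NH E H w \<and> b \<in> NH E H (last P) \<and> distant E H w a b)"

end

theory Submission
  imports Defs
begin

text \<open>
  Suppose that w has no neighbour in P. Let Q be the w-sector containing a, with ends x and y, and shorten P
  so that only its first vertex sees the interior of Q and only its last vertex sees the part of H outside the
  extended neighborhood of Q.

  The engine is the following rigidity statement. Let a hole be split into two subpaths and let F be a path
  outside the hole with at least two vertices, whose first vertex has its neighbours on one of the two subpaths, whose last
  vertex has its neighbours on the other one, and whose interior vertices have none. Then both ends of F have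
  a single neighbour, and these two neighbours are adjacent: otherwise the hole and F contain a theta, a
  pyramid, a prism or (if F is an edge with many neighbours on both sides) a turtle. It is mostly applied
  with F the edge xw and a hole formed by an initial part of P and a subpath of H from the contact with Q
  past y to the first later contact with P; then w and x have nearly forced neighbourhoods, and together with the
  mirror image, where x and y are exchanged, all positions of the contacts of P with x and y are excluded.
  Only a hole of length six survives, where H, w and the single vertex of P induce a cube.

  If w sees no vertex of H beyond x, y and the neighbours of x and y outside Q, then w is a hub. The hole then has two long
  sectors, and exchanging them while reversing P rules out paths with at least two vertices. A single vertex P is
  major, hence a hub, and is excluded by the rigidity statement again.
\<close>

section \<open>Paths, holes and the excluded configurations\<close>

text \<open>The edge from x to w is the natural test path because w has no neighbour in P. On a hole
  made of a piece of P and a piece of H, the neighbours of w lie on the H side, and those of x on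
  the P side, up to at most two vertices of H next to x, which are moved over. Rigidity lets w see a
  single vertex of the H piece; as that piece often contains y, any further neighbour of w on it is
  a contradiction.

  The obstacle is that shortening P does not clear all contacts. An inner vertex of P may still see
  x, y and those neighbours of x and y outside Q that w sees, since all of these belong to the
  extended neighborhood. The case distinctions remove these contacts one by one. They rely on a
  neighbour of w elsewhere on H; where there is none, w is a hub and the second argument takes over.

  That w is not minor leaves at least two vertices of H outside Q. The hypothesis on hubs is applied
  to the single vertex of P.\<close>

lemma ipath_Nil [simp]: "\<not> ipath V E []"
  by (simp add: ipath_def)

lemma ipath_subset: "ipath V E p \<Longrightarrow> set p \<subseteq> V"
  by (simp add: ipath_def)

lemma ipath_rev:
  assumes "ipath V E p"
  shows "ipath V E (rev p)"
  unfolding ipath_def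
proof (intro conjI allI impI)
  fix i j assume "i < length (rev p)" "j < length (rev p)"
  then have *: "E (rev p ! i) (rev p ! j) \<longleftrightarrow> (length p - Suc i = Suc (length p - Suc j) \<or> length p - Suc j = Suc (length p - Suc i))"
    using assms unfolding ipath_def by (simp add: rev_nth)
  show "E (rev p ! i) (rev p ! j) \<longleftrightarrow> (i = Suc j \<or> j = Suc i)"
    unfolding * using \<open>i < length (rev p)\<close> \<open>j < length (rev p)\<close> by auto
qed (use assms in \<open>auto simp: ipath_def\<close>)

lemma ipath_rev_iff [simp]: "ipath V E (rev p) \<longleftrightarrow> ipath V E p"
  using ipath_rev[of V E p] ipath_rev[of V E "rev p"] by auto

lemma Suc_mod_eq: "a < n \<Longrightarrow> Suc a mod n = (if Suc a = n then 0 else Suc a)"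
  by (auto simp: mod_Suc)

text \<open>\<open>s\<close> is rotation by \<open>a\<close> places on \<open>a + b\<close>
  positions. The cyclic successor is written with \<open>if\<close> instead of \<open>mod\<close>,
  so that only linear arithmetic remains after the case split.\<close>

lemma shift_cyclic:
  fixes a b i j :: nat
  assumes "0 < a" "0 < b" "4 \<le> a + b" "i < a + b" "j < a + b"
  defines "s \<equiv> \<lambda>i. if i < b then i + a else i - b"
  shows "(s j = (if Suc (s i) = a + b then 0 else Suc (s i)) \<or> s i = (if Suc (s j) = a + b then 0 else Suc (s j)))
    \<longleftrightarrow> (j = (if Suc i = a + b then 0 else Suc i) \<or> i = (if Suc j = a + b then 0 else Suc j))"
  using assms(1-5) unfolding s_def by (cases "i < b"; cases "j < b"; simp; linarith)

lemma hole_swap: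
  assumes "hole V E (p @ q)"
  shows "hole V E (q @ p)"
proof (cases "p = [] \<or> q = []")
  case True then show ?thesis using assms by auto
next
  case False
  let ?a = "length p" and ?b = "length q"
  have pos: "?a > 0" "?b > 0" and len4: "?a + ?b \<ge> 4" using False assms by (auto simp: hole_def)
  let ?s = "\<lambda>i. if i < ?b then i + ?a else i - ?b"
  have nth: "(q @ p) ! i = (p @ q) ! ?s i" if "i < ?a + ?b" for i
    using that by (auto simp: nth_append)
  show ?thesis
    unfolding hole_def
  proof (intro conjI allI impI)
    fix i j assume i: "i < length (q @ p)" and j: "j < length (q @ p)"
    have si: "?s i < length (p @ q)" and sj: "?s j < length (p @ q)" using i j by auto
    have "E ((q @ p) ! i) ((q @ p) ! j) \<longleftrightarrow> (?s j = Suc (?s i) mod length (p @ q) \<or> ?s i = Suc (?s j) mod length (p @ q))"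
      using assms si sj i j nth unfolding hole_def by simp
    also have "\<dots> \<longleftrightarrow> (j = Suc i mod length (q @ p) \<or> i = Suc j mod length (q @ p))"
      unfolding Suc_mod_eq[OF si] Suc_mod_eq[OF sj] Suc_mod_eq[OF i] Suc_mod_eq[OF j]
      using shift_cyclic[OF pos len4, of i j] i j by (simp add: add.commute)
    finally show "E ((q @ p) ! i) ((q @ p) ! j) \<longleftrightarrow> (j = Suc i mod length (q @ p) \<or> i = Suc j mod length (q @ p))" .
  qed (use assms in \<open>auto simp: hole_def\<close>)
qed

locale graph_C =
  fixes V :: "'a set" and E :: "'a \<Rightarrow> 'a \<Rightarrow> bool"
  assumes in_C: "in_class_C V E"
begin

lemma E_sym: "E a b \<Longrightarrow> E b a" and E_irrefl [simp]: "\<not> E a a" and E_V: "E a b \<Longrightarrow> a \<in> V" "E a b \<Longrightarrow> b \<in> V"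
  using in_C unfolding in_class_C_def simple_graph_def by auto

lemma E_commute: "E a b \<longleftrightarrow> E b a"
  using E_sym by blast

lemma ipath_single: "a \<in> V \<Longrightarrow> ipath V E [a]"
  by (simp add: ipath_def)

lemma ipath_append:
  assumes p: "ipath V E p" and q: "ipath V E q" and d: "set p \<inter> set q = {}"
    and link: "\<And>a b. a \<in> set p \<Longrightarrow> b \<in> set q \<Longrightarrow> E a b \<longleftrightarrow> a = last p \<and> b = hd q"
  shows "ipath V E (p @ q)"
  unfolding ipath_def
proof (intro conjI allI impI)
  have pn: "p \<noteq> []" and qn: "q \<noteq> []" and dp: "distinct p" and dq: "distinct q"
    using p q by (auto simp: ipath_def)
  have cross: "E (p ! i) (q ! j) \<longleftrightarrow> Suc i = length p \<and> j = 0" if "i < length p" "j < length q" for i j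
  proof -
    have "E (p ! i) (q ! j) \<longleftrightarrow> p ! i = p ! (length p - 1) \<and> q ! j = q ! 0"
      using link[of "p ! i" "q ! j"] that pn qn by (simp add: last_conv_nth hd_conv_nth)
    also have "\<dots> \<longleftrightarrow> i = length p - 1 \<and> j = 0"
      using that pn qn dp dq by (simp add: nth_eq_iff_index_eq)
    finally show ?thesis using pn by (cases p) auto
  qed
  fix i j assume "i < length (p @ q)" "j < length (p @ q)"
  then consider "i < length p" "j < length p" | i' where "i = length p + i'" "i' < length q" "j < length p"
    | j' where "i < length p" "j = length p + j'" "j' < length q"
    | i' j' where "i = length p + i'" "i' < length q" "j = length p + j'" "j' < length q"
    by (metis add_diff_inverse_nat length_append nat_add_left_cancel_less)
  then show "E ((p @ q) ! i) ((p @ q) ! j) \<longleftrightarrow> (i = Suc j \<or> j = Suc i)"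
  proof cases
    case 1 then show ?thesis using p by (simp add: ipath_def nth_append)
  next
    case 2 then show ?thesis using cross[of j i'] by (auto simp: nth_append E_commute)
  next
    case 3 then show ?thesis using cross[of i j'] by (auto simp: nth_append)
  next
    case 4 then show ?thesis using q by (simp add: ipath_def nth_append)
  qed
qed (use p q d in \<open>auto simp: ipath_def\<close>)

lemma hole_of_paths:
  assumes p: "ipath V E p" and q: "ipath V E q" and d: "set p \<inter> set q = {}"
    and len: "length p + length q \<ge> 4"
    and link: "\<And>a b. a \<in> set p \<Longrightarrow> b \<in> set q \<Longrightarrow> E a b \<longleftrightarrow> (a = last p \<and> b = hd q) \<or> (a = hd p \<and> b = last q)"
  shows "hole V E (p @ q)"
  unfolding hole_def
proof (intro conjI allI impI)
  have pn: "p \<noteq> []" and qn: "q \<noteq> []" and dp: "distinct p" and dq: "distinct q"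
    using p q by (auto simp: ipath_def)
  have cross: "E (p ! i) (q ! j) \<longleftrightarrow> (Suc i = length p \<and> j = 0) \<or> (i = 0 \<and> Suc j = length q)" if "i < length p" "j < length q" for i j
  proof -
    have "E (p ! i) (q ! j) \<longleftrightarrow> (p ! i = p ! (length p - 1) \<and> q ! j = q ! 0) \<or> (p ! i = p ! 0 \<and> q ! j = q ! (length q - 1))"
      using link[of "p ! i" "q ! j"] that pn qn by (simp add: last_conv_nth hd_conv_nth)
    also have "\<dots> \<longleftrightarrow> (i = length p - 1 \<and> j = 0) \<or> (i = 0 \<and> j = length q - 1)"
      using that pn qn dp dq by (simp add: nth_eq_iff_index_eq)
    also have "\<dots> \<longleftrightarrow> (Suc i = length p \<and> j = 0) \<or> (i = 0 \<and> Suc j = length q)"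
    proof -
      have "i = length p - 1 \<longleftrightarrow> Suc i = length p" "j = length q - 1 \<longleftrightarrow> Suc j = length q"
        using that by linarith+
      then show ?thesis by simp
    qed
    finally show ?thesis .
  qed
  fix i j assume i: "i < length (p @ q)" and j: "j < length (p @ q)"
  note m = Suc_mod_eq[OF i] Suc_mod_eq[OF j]
  consider "i < length p" "j < length p" | i' where "i = length p + i'" "i' < length q" "j < length p"
    | j' where "i < length p" "j = length p + j'" "j' < length q"
    | i' j' where "i = length p + i'" "i' < length q" "j = length p + j'" "j' < length q"
    using i j by (metis add_diff_inverse_nat length_append nat_add_left_cancel_less)
  then show "E ((p @ q) ! i) ((p @ q) ! j) \<longleftrightarrow> (j = Suc i mod length (p @ q) \<or> i = Suc j mod length (p @ q))"
  proof cases
    case 1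
    moreover have "length q > 0" using qn by simp
    ultimately have "Suc i \<noteq> length (p @ q)" "Suc j \<noteq> length (p @ q)" unfolding length_append by linarith+
    then show ?thesis unfolding m using p 1 by (auto simp add: ipath_def nth_append)
  next
    case 2 then show ?thesis unfolding m using len cross[of j i'] by (auto simp: nth_append E_commute)
  next
    case 3 then show ?thesis unfolding m using len cross[of i j'] by (auto simp: nth_append)
  next
    case 4 then show ?thesis unfolding m using q pn by (auto simp add: ipath_def nth_append)
  qed
qed (use p q d len in \<open>auto simp: ipath_def\<close>)

text \<open>The hole runs along \<open>p\<close> and back along \<open>q\<close>. The paths of a
  theta, prism or pyramid all point from one end of the configuration to the other, which calls for
  this parallel form of \<open>hole_of_paths\<close>.\<close>

lemma induces_hole_of_paths:
  assumes p: "ipath V E p" and q: "ipath V E q" and d: "set p \<inter> set q = {}"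
    and len: "length p + length q \<ge> 4"
    and link: "\<And>a b. a \<in> set p \<Longrightarrow> b \<in> set q \<Longrightarrow> E a b \<longleftrightarrow> (a = hd p \<and> b = hd q) \<or> (a = last p \<and> b = last q)"
  shows "induces_hole V E (set p \<union> set q)"
proof -
  have n: "p \<noteq> []" "q \<noteq> []" using p q by auto
  have "hole V E (p @ rev q)"
    by (rule hole_of_paths) (use p q d len link n in \<open>auto simp: hd_rev last_rev\<close>)
  then show ?thesis unfolding induces_hole_def by fastforce
qed

section \<open>The excluded configurations, given by their paths without shared ends\<close>

definition antic :: "'a list \<Rightarrow> 'a list \<Rightarrow> bool" where
  "antic p q \<longleftrightarrow> (\<forall>a\<in>set p. \<forall>b\<in>set q. a \<noteq> b \<and> \<not> E a b)"

text \<open>Meant for the legs of a pyramid without the apex, pointing towards the base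
  triangle.\<close>

definition link_last :: "'a list \<Rightarrow> 'a list \<Rightarrow> bool" where
  "link_last p q \<longleftrightarrow> (\<forall>a\<in>set p. \<forall>b\<in>set q. a \<noteq> b \<and> (E a b \<longleftrightarrow> a = last p \<and> b = last q))"

text \<open>Meant for the paths of a prism or a turtle, all pointing the same way.\<close>

definition link_both :: "'a list \<Rightarrow> 'a list \<Rightarrow> bool" where
  "link_both p q \<longleftrightarrow> (\<forall>a\<in>set p. \<forall>b\<in>set q. a \<noteq> b \<and> (E a b \<longleftrightarrow> (a = hd p \<and> b = hd q) \<or> (a = last p \<and> b = last q)))"

definition at_hd :: "'a \<Rightarrow> 'a list \<Rightarrow> bool" where
  "at_hd a p \<longleftrightarrow> a \<in> V \<and> (\<forall>b\<in>set p. a \<noteq> b \<and> (E a b \<longleftrightarrow> b = hd p))"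

definition at_last :: "'a \<Rightarrow> 'a list \<Rightarrow> bool" where
  "at_last a p \<longleftrightarrow> a \<in> V \<and> (\<forall>b\<in>set p. a \<noteq> b \<and> (E a b \<longleftrightarrow> b = last p))"

lemma ipath_Cons: "at_hd a p \<Longrightarrow> ipath V E p \<Longrightarrow> ipath V E (a # p)"
  using ipath_append[of "[a]" p] by (auto simp: at_hd_def ipath_single)

lemma ipath_Cons_snoc:
  assumes "at_hd a p" "at_last b p" "a \<noteq> b" "\<not> E a b" "ipath V E p"
  shows "ipath V E (a # p @ [b])"
proof -
  have n: "p \<noteq> []" using assms by auto
  have "ipath V E (p @ [b])"
    by (rule ipath_append) (use assms in \<open>auto simp: at_last_def ipath_single E_commute[of _ b]\<close>)
  moreover have "at_hd a (p @ [b])" using assms n by (auto simp: at_hd_def)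
  ultimately show ?thesis by (rule ipath_Cons[rotated])
qed

lemma theta_hole:
  assumes "at_hd a p" "at_last b p" "at_hd a q" "at_last b q" "a \<noteq> b" "\<not> E a b" "ipath V E p" "ipath V E q" "antic p q"
  shows "induces_hole V E (set (a # p @ [b]) \<union> set (a # q @ [b]))"
proof -
  have n: "p \<noteq> []" "q \<noteq> []" using assms by auto
  have "induces_hole V E (set (a # p @ [b]) \<union> set q)"
  proof (rule induces_hole_of_paths[OF ipath_Cons_snoc])
    have "length p \<ge> 1" "length q \<ge> 1" using n by (auto simp: Suc_le_eq)
    then show "4 \<le> length (a # p @ [b]) + length q" by simp
  qed (use assms in \<open>auto simp: at_hd_def at_last_def antic_def\<close>)
  moreover have "set (a # p @ [b]) \<union> set q = set (a # p @ [b]) \<union> set (a # q @ [b])" by auto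
  ultimately show ?thesis by simp
qed

text \<open>The three lists are the interiors of the paths. They are nonempty because
  \<open>ipath\<close> excludes the empty list, in accordance with \<open>a\<close> and
  \<open>b\<close> being nonadjacent.\<close>

lemma no_theta:
  assumes "ipath V E p" "ipath V E q" "ipath V E r" "antic p q" "antic p r" "antic q r"
    "at_hd a p" "at_hd a q" "at_hd a r" "at_last b p" "at_last b q" "at_last b r" "a \<noteq> b" "\<not> E a b"
  shows False
proof -
  have "has_theta V E" unfolding has_theta_def
  proof (rule exI[of _ a], rule exI[of _ b], rule exI[of _ "a # p @ [b]"], rule exI[of _ "a # q @ [b]"],
      rule exI[of _ "a # r @ [b]"], intro conjI)
    show "induces_hole V E (set (a # p @ [b]) \<union> set (a # q @ [b]))"
      "induces_hole V E (set (a # p @ [b]) \<union> set (a # r @ [b]))"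
      "induces_hole V E (set (a # q @ [b]) \<union> set (a # r @ [b]))"
      using assms by (blast intro: theta_hole)+
    show "path_from_to V E (a # p @ [b]) a b" "path_from_to V E (a # q @ [b]) a b"
      "path_from_to V E (a # r @ [b]) a b"
      using assms ipath_Cons_snoc by (auto simp: path_from_to_def)
  qed (use assms in \<open>auto simp: antic_def at_hd_def at_last_def\<close>)
  then show False using in_C by (simp add: in_class_C_def)
qed

lemma pyramid_hole:
  assumes "at_hd a p" "at_hd a q" "ipath V E p" "ipath V E q" "link_last p q" "length p + length q \<ge> 3"
  shows "induces_hole V E (set (a # p) \<union> set (a # q))"
proof -
  have n: "p \<noteq> []" "q \<noteq> []" using assms by auto
  have "induces_hole V E (set (a # p) \<union> set q)"
    by (rule induces_hole_of_paths[OF ipath_Cons])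
      (use assms n in \<open>auto simp: at_hd_def link_last_def\<close>)
  moreover have "set (a # p) \<union> set q = set (a # p) \<union> set (a # q)" by auto
  ultimately show ?thesis by simp
qed

text \<open>The lists are the legs without the apex \<open>a\<close>. The length bounds say that at
  most one leg is a single edge, so any two legs close to a cycle of length at least four.\<close>

lemma no_pyramid:
  assumes i: "ipath V E p" "ipath V E q" "ipath V E r" and l: "link_last p q" "link_last p r" "link_last q r"
    and "at_hd a p" "at_hd a q" "at_hd a r"
    "length p + length q \<ge> 3" "length p + length r \<ge> 3" "length q + length r \<ge> 3"
  shows False
proof -
  have n: "p \<noteq> []" "q \<noteq> []" "r \<noteq> []" using i by auto
  have e: "E (last p) (last q)" "E (last p) (last r)" "E (last q) (last r)"
    using n l by (auto simp: link_last_def)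
  have s: "set p \<inter> set q = {}" "set p \<inter> set r = {}" "set q \<inter> set r = {}"
    using l by (auto simp: link_last_def)
  have "has_pyramid V E" unfolding has_pyramid_def
  proof (rule exI[of _ a], rule exI[of _ "last p"], rule exI[of _ "last q"], rule exI[of _ "last r"],
    rule exI[of _ "a # p"], rule exI[of _ "a # q"], rule exI[of _ "a # r"], intro conjI)
    show "induces_hole V E (set (a # p) \<union> set (a # q))"
      "induces_hole V E (set (a # p) \<union> set (a # r))"
      "induces_hole V E (set (a # q) \<union> set (a # r))"
      using assms by (blast intro: pyramid_hole)+
    show "path_from_to V E (a # p) a (last p)" "path_from_to V E (a # q) a (last q)"
      "path_from_to V E (a # r) a (last r)"
      using assms n ipath_Cons by (auto simp: path_from_to_def)
    show "last p \<noteq> last q" "last p \<noteq> last r" "last q \<noteq> last r" using e by auto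
  qed (use assms s e in \<open>auto simp: at_hd_def\<close>)
  then show False using in_C by (simp add: in_class_C_def)
qed

lemma hd_ne_last: "ipath V E p \<Longrightarrow> length p \<ge> 2 \<Longrightarrow> hd p \<noteq> last p"
  by (cases p) (auto simp: ipath_def split: if_splits)

text \<open>The triangles are formed by the three heads and by the three last vertices; two vertices
  on each path keep them disjoint.\<close>

lemma no_prism:
  assumes i: "ipath V E p" "ipath V E q" "ipath V E r" and l: "link_both p q" "link_both p r" "link_both q r"
    and len: "length p \<ge> 2" "length q \<ge> 2" "length r \<ge> 2"
  shows False
proof -
  have n: "p \<noteq> []" "q \<noteq> []" "r \<noteq> []" using i by auto
  have e: "E (last p) (last q)" "E (last p) (last r)" "E (last q) (last r)" "E (hd p) (hd q)" "E (hd p) (hd r)" "E (hd q) (hd r)"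
    using n l by (auto simp: link_both_def)
  have s: "set p \<inter> set q = {}" "set p \<inter> set r = {}" "set q \<inter> set r = {}"
    using l by (auto simp: link_both_def)
  have "has_prism V E" unfolding has_prism_def
  proof (rule exI[of _ "hd p"], rule exI[of _ "hd q"], rule exI[of _ "hd r"], rule exI[of _ "last p"], rule exI[of _ "last q"], rule exI[of _ "last r"],
    rule exI[of _ p], rule exI[of _ q], rule exI[of _ r], intro conjI)
    show "induces_hole V E (set p \<union> set q)" "induces_hole V E (set p \<union> set r)" "induces_hole V E (set q \<union> set r)"
      using i l len s by (auto intro!: induces_hole_of_paths simp: link_both_def)
    show "path_from_to V E p (hd p) (last p)" "path_from_to V E q (hd q) (last q)" "path_from_to V E r (hd r) (last r)"
      using i by (auto simp: path_from_to_def)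
    have "hd p \<noteq> last p" "hd q \<noteq> last q" "hd r \<noteq> last r" using i len hd_ne_last by auto
    then show "{hd p, hd q, hd r} \<inter> {last p, last q, last r} = {}"
      using s n by (auto dest: hd_in_set last_in_set) (metis disjoint_iff hd_in_set last_in_set)+
    show "hd p \<noteq> hd q" "hd p \<noteq> hd r" "hd q \<noteq> hd r" "last p \<noteq> last q" "last p \<noteq> last r" "last q \<noteq> last r" using e by auto
  qed (use s e in auto)
  then show False using in_C by (simp add: in_class_C_def)
qed

lemma no_turtle:
  assumes i: "ipath V E p" "ipath V E q" and l: "link_both p q" and len: "length p + length q \<ge> 4"
    and "f \<notin> set p \<union> set q" "g \<notin> set p \<union> set q" "E f g" "card {v \<in> set p. E f v} \<ge> 3" "\<forall>v\<in>set q. \<not> E f v"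
    "card {v \<in> set q. E g v} \<ge> 3" "\<forall>v\<in>set p. \<not> E g v"
  shows False
proof -
  have n: "p \<noteq> []" "q \<noteq> []" using i by auto
  have e: "E (last p) (last q)" "E (hd p) (hd q)" using n l by (auto simp: link_both_def)
  have s: "set p \<inter> set q = {}" using l by (auto simp: link_both_def)
  have "has_turtle V E" unfolding has_turtle_def
  proof (rule exI[of _ "hd p"], rule exI[of _ "last p"], rule exI[of _ "hd q"], rule exI[of _ "last q"],
    rule exI[of _ p], rule exI[of _ q], rule exI[of _ f], rule exI[of _ g], intro conjI)
    show "induces_hole V E (set p \<union> set q)"
      using i l len s by (auto intro!: induces_hole_of_paths simp: link_both_def)
    show "f \<in> V" "g \<in> V" using assms E_V by auto
  qed (use assms s e in \<open>auto simp: path_from_to_def\<close>)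
  then show False using in_C by (simp add: in_class_C_def)
qed

lemma ipath_appendD:
  assumes "ipath V E (p @ q)" "p \<noteq> []" "q \<noteq> []"
  shows "ipath V E p" "ipath V E q"
    "\<And>a b. a \<in> set p \<Longrightarrow> b \<in> set q \<Longrightarrow> a \<noteq> b \<and> (E a b \<longleftrightarrow> a = last p \<and> b = hd q)"
proof -
  have d: "distinct (p @ q)" and E: "\<And>i j. i < length (p @ q) \<Longrightarrow> j < length (p @ q) \<Longrightarrow> E ((p @ q) ! i) ((p @ q) ! j) \<longleftrightarrow> (i = Suc j \<or> j = Suc i)"
    using assms by (auto simp: ipath_def)
  show "ipath V E p" unfolding ipath_def
  proof (intro conjI allI impI)
    fix i j assume "i < length p" "j < length p"
    then show "E (p ! i) (p ! j) \<longleftrightarrow> (i = Suc j \<or> j = Suc i)" using E[of i j] by (simp add: nth_append)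
  qed (use assms in \<open>auto simp: ipath_def\<close>)
  show "ipath V E q" unfolding ipath_def
  proof (intro conjI allI impI)
    fix i j assume "i < length q" "j < length q"
    then show "E (q ! i) (q ! j) \<longleftrightarrow> (i = Suc j \<or> j = Suc i)" using E[of "length p + i" "length p + j"] by simp
  qed (use assms in \<open>auto simp: ipath_def\<close>)
  fix a b assume "a \<in> set p" "b \<in> set q"
  then obtain i j where ij: "i < length p" "a = p ! i" "j < length q" "b = q ! j" by (metis in_set_conv_nth)
  have "E a b \<longleftrightarrow> Suc i = length p \<and> j = 0"
    using E[of i "length p + j"] ij by (auto simp: nth_append)
  also have "\<dots> \<longleftrightarrow> a = last p \<and> b = hd q"
  proof -
    have "last p = p ! (length p - 1)" "hd q = q ! 0" using assms by (auto simp: last_conv_nth hd_conv_nth)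
    moreover have "i = length p - 1 \<longleftrightarrow> Suc i = length p" using ij by linarith
    ultimately show ?thesis using ij d assms by (simp add: nth_eq_iff_index_eq)
  qed
  finally show "a \<noteq> b \<and> (E a b \<longleftrightarrow> a = last p \<and> b = hd q)" using \<open>a \<in> set p\<close> \<open>b \<in> set q\<close> d by auto
qed

section \<open>Rigidity of a path attached to two sides of a hole\<close>

lemma hd_map_upt: "a < b \<Longrightarrow> hd (map z [a..<b]) = z a" and last_map_upt: "a < b \<Longrightarrow> last (map z [a..<b]) = z (b - 1)"
  and hd_map_rev_upt: "a < b \<Longrightarrow> hd (map z (rev [a..<b])) = z (b - 1)"
  and last_map_rev_upt: "a < b \<Longrightarrow> last (map z (rev [a..<b])) = z a"
  by (auto simp: hd_map last_map hd_rev last_rev)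

lemmas ends = hd_map_upt last_map_upt hd_map_rev_upt last_map_rev_upt

text \<open>A hole as a function of the position: arcs become intervals of indices, and the closing
  edge is spelled out without \<open>mod\<close>, so that adjacency is decided by
  arithmetic.\<close>

definition cyc :: "(nat \<Rightarrow> 'a) \<Rightarrow> nat \<Rightarrow> bool" where
  "cyc z N \<longleftrightarrow> 4 \<le> N \<and> inj_on z {..<N} \<and> z ` {..<N} \<subseteq> V \<and>
    (\<forall>i<N. \<forall>j<N. E (z i) (z j) \<longleftrightarrow> i = Suc j \<or> j = Suc i \<or> (i = 0 \<and> Suc j = N) \<or> (j = 0 \<and> Suc i = N))"

lemma hole_cyc:
  assumes "hole V E Z" shows "cyc (nth Z) (length Z)"
proof -
  have "4 \<le> length Z" "distinct Z" "set Z \<subseteq> V" using assms by (auto simp: hole_def)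
  moreover have "E (Z ! i) (Z ! j) \<longleftrightarrow> i = Suc j \<or> j = Suc i \<or> (i = 0 \<and> Suc j = length Z) \<or> (j = 0 \<and> Suc i = length Z)"
    if i: "i < length Z" and j: "j < length Z" for i j
  proof -
    have "E (Z ! i) (Z ! j) \<longleftrightarrow> (j = Suc i mod length Z \<or> i = Suc j mod length Z)"
      using assms i j by (auto simp: hole_def)
    then show ?thesis unfolding Suc_mod_eq[OF i] Suc_mod_eq[OF j] using i j by auto
  qed
  ultimately show ?thesis by (auto simp: cyc_def inj_on_def nth_eq_iff_index_eq)
qed

lemma ipath_map:
  assumes "a < b" "\<And>i. a \<le> i \<Longrightarrow> i < b \<Longrightarrow> z i \<in> V"
    "\<And>i j. a \<le> i \<Longrightarrow> i < b \<Longrightarrow> a \<le> j \<Longrightarrow> j < b \<Longrightarrow> z i = z j \<Longrightarrow> i = j"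
    "\<And>i j. a \<le> i \<Longrightarrow> i < b \<Longrightarrow> a \<le> j \<Longrightarrow> j < b \<Longrightarrow> E (z i) (z j) \<longleftrightarrow> i = Suc j \<or> j = Suc i"
  shows "ipath V E (map z [a..<b])"
  unfolding ipath_def
proof (intro conjI allI impI)
  show "distinct (map z [a..<b])" using assms(3) by (auto simp: distinct_map inj_on_def)
  fix i j assume "i < length (map z [a..<b])" "j < length (map z [a..<b])"
  then show "E (map z [a..<b] ! i) (map z [a..<b] ! j) \<longleftrightarrow> (i = Suc j \<or> j = Suc i)"
    using assms(4)[of "a + i" "a + j"] by auto
qed (use assms in auto)

lemma cyc_hole:
  assumes "cyc z N" shows "hole V E (map z [0..<N])"
  unfolding hole_def
proof (intro conjI allI impI)
  fix i j assume "i < length (map z [0..<N])" "j < length (map z [0..<N])"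
  then have i: "i < N" and j: "j < N" by auto
  then have "E (z i) (z j) \<longleftrightarrow> i = Suc j \<or> j = Suc i \<or> (i = 0 \<and> Suc j = N) \<or> (j = 0 \<and> Suc i = N)"
    using assms by (auto simp: cyc_def)
  then show "E (map z [0..<N] ! i) (map z [0..<N] ! j) \<longleftrightarrow> j = Suc i mod length (map z [0..<N]) \<or> i = Suc j mod length (map z [0..<N])"
    using i j by (auto simp: Suc_mod_eq)
qed (use assms in \<open>auto simp: cyc_def distinct_map atLeast0LessThan\<close>)

text \<open>If \<open>c\<close> and \<open>d\<close> were the only neighbours, then \<open>f\<close>
  and the two arcs between \<open>c\<close> and \<open>d\<close> would be the interiors of a
  theta.\<close>

lemma hole_two_nbrs:
  assumes Z: "hole V E Z" and f: "f \<notin> set Z" and c: "c \<in> set Z" "E f c" and d: "d \<in> set Z" "E f d"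
    and cd: "c \<noteq> d" "\<not> E c d"
  shows "\<exists>e\<in>set Z. E f e \<and> e \<noteq> c \<and> e \<noteq> d"
proof (rule ccontr)
  assume *: "\<not> ?thesis"
  obtain Z1 Z2 where Z12: "Z = Z1 @ c # Z2" using c by (meson split_list)
  let ?Z = "c # Z2 @ Z1" and ?z = "(!) (c # Z2 @ Z1)"
  have "hole V E ?Z" using hole_swap[of V E Z1 "c # Z2"] Z Z12 by simp
  then have cy: "cyc ?z (length ?Z)" by (rule hole_cyc)
  have sZ: "set ?Z = set Z" using Z12 by auto
  then obtain v where v: "?z v = d" "v < length ?Z" using d by (metis in_set_conv_nth)
  define z N where "z = ?z" and "N = length ?Z"
  have c: "cyc z N" and z: "z 0 = c" "z v = d" "v < N" "\<And>i. i < N \<Longrightarrow> z i \<in> set Z"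
    using cy v sZ unfolding z_def N_def using nth_mem[of _ "c # Z2 @ Z1"] by auto
  have N4: "4 \<le> N" and zV: "\<And>i. i < N \<Longrightarrow> z i \<in> V" and zeq: "\<And>i j. i < N \<Longrightarrow> j < N \<Longrightarrow> z i = z j \<longleftrightarrow> i = j"
    and zE: "\<And>i j. i < N \<Longrightarrow> j < N \<Longrightarrow> E (z i) (z j) \<longleftrightarrow> i = Suc j \<or> j = Suc i \<or> (i = 0 \<and> Suc j = N) \<or> (j = 0 \<and> Suc i = N)"
    using c by (auto simp: cyc_def inj_on_def)
  have ip: "ipath V E (map z [a..<b])" if "a < b" "b \<le> N" "0 < a \<or> b < N" for a b
    by (rule ipath_map) (use that zV zeq zE in auto)
  have ipr: "ipath V E (map z (rev [a..<b]))" if "a < b" "b \<le> N" "0 < a \<or> b < N" for a b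
    using ip[OF that] ipath_rev[of V E "map z [a..<b]"] by (simp only: rev_map)
  have v0: "1 < v" "Suc v < N" using cd zE[of 0 v] z N4 by (cases v; force)+
  have fz: "f \<noteq> z i" "z i \<noteq> f" if "i < N" for i using z(4)[OF that] f by auto
  have ef: "E f (z i) \<longleftrightarrow> i = 0 \<or> i = v" if "i < N" for i
    using * z(4)[OF that] \<open>E f c\<close> d z zeq[of i 0] zeq[of i v] that by auto
  have ef': "E (z i) f \<longleftrightarrow> i = 0 \<or> i = v" if "i < N" for i
    using ef[OF that] E_commute by metis
  have fV: "f \<in> V" using d E_V by auto
  show False
    by (rule no_theta[of "[f]" "map z (rev [Suc v..<N])" "map z [1..<v]" "z 0" "z v"])
      (use v0 in \<open>auto simp del: upt_Suc simp: antic_def at_hd_def at_last_def fz ef ef' zeq zE zV ends fV intro!: ip ipr ipath_single\<close>)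
qed

text \<open>Each end of \<open>F\<close> sees one vertex, or its extreme neighbours are adjacent, or
  they are nonadjacent. The hypothesis \<open>cases\<close> keeps the pairs in which the first end
  does not have the richer of the two shapes; the others arise by reversing
  \<open>F\<close>.\<close>

lemma feet:
  assumes c: "cyc z N" and F: "ipath V E F" and lF: "length F \<ge> 2" and zF: "\<And>i. i < N \<Longrightarrow> z i \<notin> set F"
    and vr: "v < r" "r \<le> s" "s < N"
    and f0: "E (hd F) (z 0)" "E (hd F) (z v)" and f1: "\<And>i. i < N \<Longrightarrow> E (hd F) (z i) \<Longrightarrow> i \<le> v"
    and g0: "E (last F) (z r)" "E (last F) (z s)" and g1: "\<And>i. i < N \<Longrightarrow> E (last F) (z i) \<Longrightarrow> r \<le> i \<and> i \<le> s"
    and int: "\<And>t i. t \<in> set F \<Longrightarrow> t \<noteq> hd F \<Longrightarrow> t \<noteq> last F \<Longrightarrow> i < N \<Longrightarrow> \<not> E t (z i)"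
    and cases: "v = 0 \<or> (v = 1 \<and> r \<noteq> s) \<or> (1 < v \<and> Suc r < s)"
  shows "v = 0 \<and> r = s \<and> (r = 1 \<or> Suc r = N)"
proof (rule ccontr)
  assume notconc: "\<not> ?thesis"
  have N4: "4 \<le> N" and zV: "\<And>i. i < N \<Longrightarrow> z i \<in> V"
    and zeq: "\<And>i j. i < N \<Longrightarrow> j < N \<Longrightarrow> z i = z j \<longleftrightarrow> i = j"
    and zE: "\<And>i j. i < N \<Longrightarrow> j < N \<Longrightarrow> E (z i) (z j) \<longleftrightarrow> i = Suc j \<or> j = Suc i \<or> (i = 0 \<and> Suc j = N) \<or> (j = 0 \<and> Suc i = N)"
    using c by (auto simp: cyc_def inj_on_def)
  have ip: "ipath V E (map z [a..<b])" if "a < b" "b \<le> N" "0 < a \<or> b < N" for a b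
    by (rule ipath_map) (use that zV zeq zE in auto)
  have ipr: "ipath V E (map z (rev [a..<b]))" if "a < b" "b \<le> N" "0 < a \<or> b < N" for a b
    using ip[OF that] ipath_rev[of V E "map z [a..<b]"] by (simp only: rev_map)
  have hl: "hd F \<noteq> last F" using F lF hd_ne_last by blast
  have Fn: "F \<noteq> []" using F by auto
  have FV: "set F \<subseteq> V" using F ipath_subset by blast
  obtain f F' where Ff: "F = f # F'" "F' \<noteq> []" using lF by (cases F) (auto simp: Suc_le_eq)
  obtain g F'' where Fg: "F = F'' @ [g]" "F'' \<noteq> []" using lF by (cases F rule: rev_cases) (auto simp: Suc_le_eq)
  have hd: "hd F = f" "hd F'' = f" and lst: "last F = g" "last F' = g"
    using Ff Fg by (metis hd_append2 list.sel(1) last_ConsR last_snoc)+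
  have gV: "g \<in> V" and fV: "f \<in> V" using FV hd(1) lst(1) Fn by (metis hd_in_set last_in_set subsetD)+
  have F'': "ipath V E F''" "\<And>t. t \<in> set F'' \<Longrightarrow> t \<noteq> g \<and> (E g t \<longleftrightarrow> t = last F'')"
    using ipath_appendD[of F'' "[g]"] F Fg by (auto simp: E_commute[of g])
  have F': "ipath V E F'" "\<And>t. t \<in> set F' \<Longrightarrow> t \<noteq> f \<and> (E f t \<longleftrightarrow> t = hd F')"
    using ipath_appendD[of "[f]" F'] F Ff by auto
  have zF': "i < N \<Longrightarrow> z i \<notin> set F'" "i < N \<Longrightarrow> z i \<notin> set F''" "i < N \<Longrightarrow> z i \<noteq> f"  "i < N \<Longrightarrow> z i \<noteq> g" for i
    using zF[of i] unfolding Ff(1) apply auto using zF[of i] unfolding Fg(1) by auto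
  have fg: "f \<noteq> g" using hl hd lst by simp
  define fN gN where "fN i = E f (z i)" and "gN i = E g (z i)" for i
  have ef: "E f (z i) \<longleftrightarrow> fN i" "E (z i) f \<longleftrightarrow> fN i" and eg: "E g (z i) \<longleftrightarrow> gN i" "E (z i) g \<longleftrightarrow> gN i" for i
    by (auto simp: fN_def gN_def E_commute)
  have eF: "E t (z i) \<longleftrightarrow> (t = f \<and> fN i) \<or> (t = g \<and> gN i)" "E (z i) t \<longleftrightarrow> (t = f \<and> fN i) \<or> (t = g \<and> gN i)" if "t \<in> set F" "i < N" for t i
    using int[OF that(1) _ _ that(2)] hd lst ef eg E_commute[of t] by (metis, metis)
  have fN: "fN 0" "fN v" "\<And>i. v \<le> i \<Longrightarrow> i < N \<Longrightarrow> fN i \<longleftrightarrow> i = v" and gN: "gN r" "gN s" "\<And>i. i < r \<Longrightarrow> \<not> gN i"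
    "\<And>i. s \<le> i \<Longrightarrow> i < N \<Longrightarrow> gN i \<longleftrightarrow> i = s"
  proof -
    show "fN 0" "fN v" "gN r" "gN s" using f0 g0 by (simp_all add: fN_def gN_def hd lst)
    show "fN i \<longleftrightarrow> i = v" if "v \<le> i" "i < N" for i using f0 f1[of i] that by (auto simp: fN_def hd)
    show "\<not> gN i" if "i < r" for i using g1[of i] that vr by (auto simp: gN_def lst)
    show "gN i \<longleftrightarrow> i = s" if "s \<le> i" "i < N" for i using g0 g1[of i] that by (auto simp: gN_def lst)
  qed
  have gN': "gN i \<longleftrightarrow> i = r" if "i \<le> r" for i using gN that by (cases "i = r") auto
  have zz: "i < N \<Longrightarrow> f \<noteq> z i" "i < N \<Longrightarrow> g \<noteq> z i" "g \<notin> set F''" "f \<notin> set F'" for i using zF' F' F'' by metis+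
  note defs = antic_def at_hd_def at_last_def link_last_def link_both_def
  note S = zF zV zeq zE zF' ends fV gV ef eg eF fN gN gN' zz hd lst
  consider (1) "v = 0" "r = s" | (2) "v = 0" "s = Suc r" | (3) "v = 0" "Suc r < s"
    | (5) "v = 1" "s = Suc r" | (6) "v = 1" "Suc r < s" | (9) "1 < v" "Suc r < s"
    using cases vr by linarith
  then show False
  proof cases
    case 1
    \<comment> \<open>Two single feet give a theta with ends \<open>z 0\<close> and
      \<open>z r\<close>; both arcs are nonempty since the feet are nonadjacent.\<close>
    have rr: "1 < r" "Suc r < N" using 1 notconc vr by auto
    show False
      by (rule no_theta[of "map z (rev [Suc s..<N])" "map z [1..<r]" F "z 0" "z r"])
        (use rr 1 vr in \<open>auto simp del: upt_Suc simp: defs S intro!: ip ipr F\<close>)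
  next
    case 2
    \<comment> \<open>A vertex against an edge: a pyramid with apex \<open>z 0\<close> and triangle
      \<open>z r\<close>, \<open>z s\<close>, \<open>g\<close>.\<close>
    show False
      by (rule no_pyramid[of "map z (rev [s..<N])" "map z [1..<Suc r]" F "z 0"])
        (use 2 vr N4 lF in \<open>auto simp del: upt_Suc simp: defs S intro!: ip ipr F\<close>)
  next
    case 3
    \<comment> \<open>A theta with ends \<open>z 0\<close> and \<open>g\<close>; the third interior
      is \<open>F\<close> without \<open>g\<close>.\<close>
    have *: "t \<in> set F" "t \<noteq> g" if "t \<in> set F''" for t using that F'' Fg by auto
    show False
      by (rule no_theta[of "map z (rev [s..<N])" "map z [1..<Suc r]" F'' "z 0" g])
        (use 3 vr N4 lF in \<open>auto simp del: upt_Suc simp: defs S * F'' intro!: ip ipr\<close>)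
  next
    case 5
    \<comment> \<open>Two edges: a prism with triangles \<open>z 0\<close>, \<open>z 1\<close>,
      \<open>f\<close> and \<open>z s\<close>, \<open>z r\<close>, \<open>g\<close>.\<close>
    have *: "map z (rev [s..<N]) \<noteq> []" using vr by simp
    have **: "ipath V E (z 0 # map z (rev [s..<N]))"
      by (rule ipath_Cons) (use 5 vr N4 in \<open>auto simp del: upt_Suc simp: defs S intro!: ipr\<close>)
    show False
      by (rule no_prism[of "z 0 # map z (rev [s..<N])" "map z [1..<Suc r]" F])
        (use 5 vr N4 lF * ** in \<open>auto simp del: upt_Suc simp: defs S intro!: ip ipr F\<close>)
  next
    case 6
    \<comment> \<open>A pyramid with apex \<open>g\<close> and triangle \<open>z 0\<close>,
      \<open>z 1\<close>, \<open>f\<close>. All legs start at the apex, which accounts for the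
      reversals.\<close>
    have *: "t \<in> set F" "t \<noteq> g" if "t \<in> set F''" for t using that F'' Fg by auto
    have **: "ipath V E (map z [s..<N] @ [z 0])"
      by (rule ipath_append) (use 6 vr N4 in \<open>auto simp del: upt_Suc simp: defs S intro!: ip ipath_single\<close>)
    have m: "2 \<le> length (map z [s..<N] @ [z 0])" "2 \<le> length (map z (rev [1..<Suc r]))" "1 \<le> length (rev F'')"
      using vr 6 Fg by (auto simp: Suc_le_eq)
    have lens: "3 \<le> length (map z [s..<N] @ [z 0]) + length (map z (rev [1..<Suc r]))"
      "3 \<le> length (map z [s..<N] @ [z 0]) + length (rev F'')" "3 \<le> length (map z (rev [1..<Suc r])) + length (rev F'')"
      using m by linarith+
    have h: "hd (map z [s..<N] @ [z 0]) = z s" using vr by (simp add: hd_append ends)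
    show False
      by (rule no_pyramid[of "map z [s..<N] @ [z 0]" "map z (rev [1..<Suc r])" "rev F''" g, OF _ _ _ _ _ _ _ _ _ lens])
        (use 6 vr N4 Fg ** h F'' in \<open>auto simp del: upt_Suc simp: defs S * hd_rev last_rev intro!: lens ip ipr\<close>)
  next
    case 9
    \<comment> \<open>The arc from \<open>z 0\<close> backwards to \<open>z s\<close> and the arc
      from \<open>z v\<close> to \<open>z r\<close> are anticomplete here. If \<open>F\<close> has a
      nonempty interior \<open>M\<close>, the three form a theta with ends \<open>f\<close> and
      \<open>g\<close>.\<close>
    have L: "ipath V E (z 0 # map z (rev [s..<N]))"
      by (rule ipath_Cons) (use 9 vr N4 in \<open>auto simp del: upt_Suc simp: defs S intro!: ipr\<close>)
    have lL: "last (z 0 # map z (rev [s..<N])) = z s" using vr by (simp add: ends)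
    show False
    proof (cases "length F = 2")
      case False
      then obtain M where M: "F = f # M @ [g]" "M \<noteq> []"
        using Ff Fg by (cases F' rule: rev_cases) (auto simp: Suc_le_eq)
      have M1: "ipath V E ((f # M) @ [g])" "ipath V E ([f] @ (M @ [g]))" using F M by simp_all
      note D1 = ipath_appendD[OF M1(1), simplified] and D2 = ipath_appendD[OF M1(2), simplified]
      have M2: "ipath V E M" using ipath_appendD(2)[of "[f]" M] D1(1) M(2) by simp
      have M3: "t \<noteq> g" "E g t \<longleftrightarrow> t = last M" "t \<noteq> f" "E f t \<longleftrightarrow> t = hd M" "t \<in> set F" if "t \<in> set M" for t
        using that D1(3)[of t g] D2(3)[of f t] M E_commute[of g t] by auto
      have M5: "z i \<notin> set M" if "i < N" for i using M3(5) zF that by blast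
      have M4: "\<not> E f g" using M3(1)[of "hd M"] D2(3)[of f g] M(2) by auto
      show False
        by (rule no_theta[of "z 0 # map z (rev [s..<N])" "map z [v..<Suc r]" M f g])
         (use 9 vr N4 L lL fg M3 M4 M5 in \<open>auto simp del: upt_Suc simp: defs S M2 intro!: ip\<close>)
    next
      case True
      \<comment> \<open>Now \<open>F\<close> is an edge. Each of its ends has a third neighbour on
        its side by \<open>hole_two_nbrs\<close>, and cutting the hole behind \<open>z v\<close>
        gives a turtle.\<close>
      then have F2: "F = [f, g]" using Ff lst(2) by (cases F') auto
      then have "E f g" using F ipath_appendD(3)[of "[f]" "[g]" f g] by simp
      have Z: "hole V E (map z [0..<N])" by (rule cyc_hole[OF c])
      have fg': "f \<notin> set (map z [0..<N])" "g \<notin> set (map z [0..<N])" using zz(1,2) by auto blast+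
      have *: "3 \<le> card {e \<in> set p. E a e}" if "z i \<in> set p" "E a (z i)" "z j \<in> set p" "E a (z j)"
          "z k \<in> set p" "E a (z k)" "i < N" "j < N" "k < N" "i \<noteq> j" "i \<noteq> k" "k \<noteq> j" for a i j k and p
      proof -
        have "card {z i, z j, z k} \<le> card {e \<in> set p. E a e}"
          by (rule card_mono) (use that(1-6) in simp_all)
        moreover have "z i \<noteq> z j" "z i \<noteq> z k" "z k \<noteq> z j" using zeq that(7-12) by simp_all
        ultimately show ?thesis by simp
      qed
      obtain e where e: "e \<in> set (map z [0..<N])" "E f e" "e \<noteq> z 0" "e \<noteq> z v"
      proof -
        have "\<exists>e\<in>set (map z [0..<N]). E f e \<and> e \<noteq> z 0 \<and> e \<noteq> z v"
          by (rule hole_two_nbrs[OF Z fg'(1)]) (use f0 vr 9 hd in \<open>auto simp: zeq zE\<close>)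
        then show thesis using that by blast
      qed
      then obtain i where i: "e = z i" "i < N" by auto
      then have i': "i \<le> v" "i \<noteq> 0" "i \<noteq> v" using f1[of i] e hd by (auto intro: gr0I)
      obtain e' where e': "e' \<in> set (map z [0..<N])" "E g e'" "e' \<noteq> z r" "e' \<noteq> z s"
      proof -
        have "\<exists>e\<in>set (map z [0..<N]). E g e \<and> e \<noteq> z r \<and> e \<noteq> z s"
          by (rule hole_two_nbrs[OF Z fg'(2)]) (use g0 vr 9 lst in \<open>auto simp: zeq zE\<close>)
        then show thesis using that by blast
      qed
      then obtain j where j: "e' = z j" "j < N" by auto
      then have j': "r \<le> j" "j \<le> s" "j \<noteq> r" "j \<noteq> s" using g1[of j] e' lst by blast+
      have "3 \<le> card {e \<in> set (map z [0..<Suc v]). E f e}"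
        by (rule *[of 0 _ _ i v]) (use i i' e ef fN vr in \<open>auto simp del: upt_Suc\<close>)
      moreover have "3 \<le> card {e \<in> set (map z (rev [Suc v..<N])). E g e}"
        by (rule *[of r _ _ j s]) (use j j' e' eg gN vr in \<open>auto simp del: upt_Suc\<close>)
      moreover have "\<forall>e\<in>set (map z (rev [Suc v..<N])). \<not> E f e"
        using ef fN by auto
      moreover have "\<forall>e\<in>set (map z [0..<Suc v]). \<not> E g e"
        using eg gN vr by (auto simp del: upt_Suc)
      moreover have "link_both (map z [0..<Suc v]) (map z (rev [Suc v..<N]))"
        using vr 9 by (auto simp del: upt_Suc simp: link_both_def zeq zE ends)
      ultimately show False
        using vr fg' \<open>E f g\<close> N4 by (intro no_turtle[of "map z [0..<Suc v]" "map z (rev [Suc v..<N])" f g] ip ipr) (auto simp del: upt_Suc)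
    qed
  qed
qed

text \<open>The shape of the neighbourhood of f on A; by symmetry only pairs of shapes with increasing rank need be treated.\<close>

definition rank :: "'a \<Rightarrow> 'a list \<Rightarrow> nat" where
  "rank f A = (if \<exists>c. \<forall>z\<in>set A. E f z \<longrightarrow> z = c then 0
    else if \<exists>c d. E c d \<and> (\<forall>z\<in>set A. E f z \<longrightarrow> z = c \<or> z = d) then 1 else 2)"

text \<open>Rotating the hole to the first neighbour \<open>u\<close> of \<open>hd F\<close> on
  \<open>A\<close> places all neighbours of \<open>hd F\<close> first, then \<open>B\<close>, then
  the part \<open>A1\<close> of \<open>A\<close>, which neither end sees. The extreme positions of
  the neighbours then satisfy the inequalities of \<open>feet\<close>.\<close>

lemma two_feet_aux:
  assumes Z: "hole V E (A @ B)" and F: "ipath V E F" "2 \<le> length F" "set F \<inter> set (A @ B) = {}"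
    and fA: "\<exists>a\<in>set A. E (hd F) a" and fB: "\<forall>b\<in>set B. \<not> E (hd F) b"
    and gB: "\<exists>b\<in>set B. E (last F) b" and gA: "\<forall>a\<in>set A. \<not> E (last F) a"
    and int: "\<forall>t\<in>set F. t \<noteq> hd F \<longrightarrow> t \<noteq> last F \<longrightarrow> (\<forall>z\<in>set (A @ B). \<not> E t z)"
    and rank: "rank (hd F) A \<le> rank (last F) B"
  shows "\<exists>c\<in>set A. \<exists>d\<in>set B. E c d \<and> (\<forall>z\<in>set A. E (hd F) z \<longleftrightarrow> z = c) \<and> (\<forall>z\<in>set B. E (last F) z \<longleftrightarrow> z = d)"
proof -
  let ?f = "hd F" and ?g = "last F"
  obtain A1 u A2 where A: "A = A1 @ u # A2" "E ?f u" "\<forall>a\<in>set A1. \<not> E ?f a"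
    using split_list_first_prop[OF fA] by blast
  define X where "X = u # A2"
  define z where "z = (!) (X @ B @ A1)"
  define a N where "a = length X" and "N = length (X @ B @ A1)"
  have "hole V E (X @ B @ A1)" using hole_swap[of V E A1 "X @ B"] Z A X_def by simp
  then have cy: "cyc z N" unfolding z_def N_def by (rule hole_cyc)
  have sZ: "set (X @ B @ A1) = set (A @ B)" using A X_def by auto
  have zs: "\<exists>i<N. x = z i" if "x \<in> set (A @ B)" for x
    using that sZ unfolding z_def N_def by (metis in_set_conv_nth)
  have zin: "z i \<in> set (A @ B)" if "i < N" for i
    using that sZ nth_mem[of i "X @ B @ A1"] unfolding z_def N_def by metis
  have zA: "z i \<in> set X" if "i < a" for i
    using that unfolding z_def a_def by (simp add: nth_append)
  have zB: "z i \<in> set B" if "a \<le> i" "i < a + length B" for i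
  proof -
    have "z i = B ! (i - a)" using that unfolding z_def a_def by (auto simp: nth_append)
    moreover have "i - a < length B" using that by linarith
    ultimately show ?thesis by simp
  qed
  have zA1: "z i \<in> set A1" if "a + length B \<le> i" "i < N" for i
  proof -
    have "z i = A1 ! (i - a - length B)" using that unfolding z_def a_def by (auto simp: nth_append)
    moreover have "i - a - length B < length A1" using that unfolding N_def a_def length_append by linarith
    ultimately show ?thesis by simp
  qed
  have z0: "z 0 = u" by (simp add: z_def X_def)
  have N0: "0 < N" by (simp add: N_def X_def)
  have XA: "set X \<subseteq> set A" using A X_def by auto
  define I J where "I = {i. i < N \<and> E ?f (z i)}" and "J = {i. i < N \<and> E ?g (z i)}"
  have finI: "finite I" "finite J" by (auto simp: I_def J_def)
  have I0: "0 \<in> I" using N0 A z0 by (simp add: I_def)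
  have Jn: "J \<noteq> {}" using gB zs unfolding J_def by fastforce
  have Ia: "i < a" if "i \<in> I" for i
    using that zB[of i] zA1[of i] fB A(3) unfolding I_def by (metis (mono_tags) leI mem_Collect_eq)
  have Ja: "a \<le> i" "z i \<in> set B" if "i \<in> J" for i
  proof -
    show "a \<le> i" using that zA[of i] gA XA unfolding J_def by (metis (mono_tags) leI mem_Collect_eq subsetD)
    then show "z i \<in> set B" using that zB[of i] zA1[of i] gA A(1) unfolding J_def
      by (metis (mono_tags) Un_iff leI mem_Collect_eq set_append)
  qed
  define v r s where "v = Max I" and "r = Min J" and "s = Max J"
  have v: "v \<in> I" "\<And>i. i \<in> I \<Longrightarrow> i \<le> v" using finI I0 Max_in unfolding v_def by auto
  have rs: "r \<in> J" "s \<in> J" "\<And>i. i \<in> J \<Longrightarrow> r \<le> i \<and> i \<le> s" using finI Jn unfolding r_def s_def by auto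
  have vr: "v < r" "r \<le> s" "s < N" using Ia[OF v(1)] Ja[OF rs(1)] rs J_def by auto
  have zeq: "\<And>i j. i < N \<Longrightarrow> j < N \<Longrightarrow> z i = z j \<longleftrightarrow> i = j"
    and zE: "\<And>i j. i < N \<Longrightarrow> j < N \<Longrightarrow> E (z i) (z j) \<longleftrightarrow> i = Suc j \<or> j = Suc i \<or> (i = 0 \<and> Suc j = N) \<or> (j = 0 \<and> Suc i = N)"
    using cy by (auto simp: cyc_def inj_on_def)
  have vA: "z 0 \<in> set A" "z v \<in> set A" "E ?f (z 0)" "E ?f (z v)"
    using zA[OF Ia] v(1) I0 XA unfolding I_def by auto
  have rB: "z r \<in> set B" "z s \<in> set B" "E ?g (z r)" "E ?g (z s)" using Ja rs unfolding J_def by auto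
  have Aeq: "\<exists>i\<le>v. x = z i" if "x \<in> set A" "E ?f x" for x
    using zs[of x] that v(2) unfolding I_def by auto
  have Beq: "\<exists>i. r \<le> i \<and> i \<le> s \<and> x = z i" if "x \<in> set B" "E ?g x" for x
    using zs[of x] that rs(3) unfolding J_def by auto
  \<comment> \<open>The value of \<open>v\<close> bounds the rank of the first end from below, and
    the distance of \<open>r\<close> and \<open>s\<close> bounds that of the last end from
    above.\<close>
  have cs: "v = 0 \<or> (v = 1 \<and> r \<noteq> s) \<or> (1 < v \<and> Suc r < s)"
  proof -
    have 1: "rank ?f A \<noteq> 0" if "v \<noteq> 0"
      using vA zeq[of 0 v] vr that unfolding rank_def by auto
    have 2: "rank ?f A = 2" if "v > 1"
    proof -
      have "\<not> E (z 0) (z v)" using zE[of 0 v] that vr by auto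
      moreover have "z 0 \<noteq> z v" using zeq[of 0 v] that vr by auto
      ultimately have "\<not> (\<exists>c d. E c d \<and> (\<forall>z\<in>set A. E ?f z \<longrightarrow> z = c \<or> z = d))"
        using vA E_sym E_irrefl by metis
      moreover have "rank ?f A \<noteq> 0" using 1 that by simp
      ultimately show ?thesis unfolding rank_def by metis
    qed
    have 3: "rank ?g B = 0" if "r = s" using Beq that unfolding rank_def by (metis le_antisym)
    have 4: "rank ?g B \<le> 1" if "s = Suc r"
    proof -
      have "E (z r) (z s)" using zE[of r s] that vr by auto
      moreover have "\<forall>x\<in>set B. E ?g x \<longrightarrow> x = z r \<or> x = z s" using Beq that by (metis le_SucE le_antisym)
      ultimately have "\<exists>c d. E c d \<and> (\<forall>z\<in>set B. E ?g z \<longrightarrow> z = c \<or> z = d)" by blast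
      then show ?thesis unfolding rank_def by simp
    qed
    show ?thesis
    proof (cases "v = 0 \<or> v = 1")
      case True
      then show ?thesis using 1 3 rank by auto
    next
      case False
      moreover have "rank ?g B \<le> 2" by (simp add: rank_def)
      ultimately have "rank ?g B = 2" using 2 rank by simp
      then have "r \<noteq> s" "s \<noteq> Suc r" using 3 4 by auto
      then show ?thesis using False vr by linarith
    qed
  qed
  have *: "v = 0 \<and> r = s \<and> (r = 1 \<or> Suc r = N)"
  proof (rule feet[OF cy F(1,2)])
    show "z i \<notin> set F" if "i < N" for i using zin[OF that] F(3) by blast
    show "i \<le> v" if "i < N" "E ?f (z i)" for i using that v(2)[of i] unfolding I_def by simp
    show "r \<le> i \<and> i \<le> s" if "i < N" "E ?g (z i)" for i using that rs(3)[of i] unfolding J_def by simp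
    show "\<not> E t (z i)" if "t \<in> set F" "t \<noteq> ?f" "t \<noteq> ?g" "i < N" for t i using int zin that by blast
  qed (use cs vr vA rB in simp_all)
  have e: "E (z 0) (z r)" using zE[of 0 r] * vr by (elim conjE disjE) simp_all
  have fc: "E ?f x \<longleftrightarrow> x = z 0" if "x \<in> set A" for x
  proof
    assume "E ?f x" then show "x = z 0" using Aeq[OF that] * by auto
  qed (use vA in simp)
  have gd: "E ?g x \<longleftrightarrow> x = z r" if "x \<in> set B" for x
  proof
    assume "E ?g x" with Beq[OF that] obtain i where "r \<le> i" "i \<le> s" "x = z i" by auto
    then show "x = z r" using * by (metis le_antisym)
  qed (use rB in simp)
  show ?thesis
    by (intro bexI[of _ "z 0"] bexI[of _ "z r"] conjI ballI e fc gd vA(1) rB(1))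
qed

lemma two_feet:
  assumes Z: "hole V E (A @ B)" and F: "ipath V E F" "2 \<le> length F" "set F \<inter> set (A @ B) = {}"
    and fA: "\<exists>a\<in>set A. E (hd F) a" and fB: "\<forall>b\<in>set B. \<not> E (hd F) b"
    and gB: "\<exists>b\<in>set B. E (last F) b" and gA: "\<forall>a\<in>set A. \<not> E (last F) a"
    and int: "\<forall>t\<in>set F. t \<noteq> hd F \<longrightarrow> t \<noteq> last F \<longrightarrow> (\<forall>z\<in>set (A @ B). \<not> E t z)"
  shows "\<exists>c\<in>set A. \<exists>d\<in>set B. E c d \<and> (\<forall>z\<in>set A. E (hd F) z \<longleftrightarrow> z = c) \<and> (\<forall>z\<in>set B. E (last F) z \<longleftrightarrow> z = d)"
proof (cases "rank (hd F) A \<le> rank (last F) B")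
  case True
  then show ?thesis using two_feet_aux assms by blast
next
  case False
  have "\<exists>c\<in>set B. \<exists>d\<in>set A. E c d \<and> (\<forall>z\<in>set B. E (hd (rev F)) z \<longleftrightarrow> z = c) \<and> (\<forall>z\<in>set A. E (last (rev F)) z \<longleftrightarrow> z = d)"
    by (rule two_feet_aux[OF hole_swap[OF Z] ipath_rev[OF F(1)]]) (use assms False in \<open>auto simp: hd_rev last_rev\<close>)
  then show ?thesis using E_sym by (simp add: hd_rev last_rev) blast
qed

end

text \<open>May run in either direction, so that the path between a closest pair of positions can be
  formed without knowing which position comes first.\<close>

definition walk :: "(nat \<Rightarrow> 'a) \<Rightarrow> nat \<Rightarrow> nat \<Rightarrow> 'a list" where
  "walk z i j = (if i \<le> j then map z [i..<Suc j] else map z (rev [j..<Suc i]))"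

lemma hd_walk [simp]: "hd (walk z i j) = z i" and last_walk [simp]: "last (walk z i j) = z j"
  and set_walk [simp]: "set (walk z i j) = z ` {min i j..max i j}"
  and walk_ne [simp]: "walk z i j \<noteq> []"
  and length_walk [simp]: "length (walk z i j) = Suc (i - j + (j - i))"
  by (auto simp: walk_def hd_map last_map hd_rev last_rev atLeastLessThanSuc_atLeastAtMost simp del: upt_Suc)

lemma walk_cases:
  assumes "x \<in> set (walk z i j)"
  obtains a where "x = z a" "min i j \<le> a" "a \<le> max i j"
proof -
  from assms have "x \<in> z ` {min i j..max i j}" by (simp only: set_walk)
  then obtain a where "x = z a" "a \<in> {min i j..max i j}" by (rule imageE)
  then show thesis using that by simp
qed

section \<open>A hole with a sector and a path avoiding the centre\<close>

text \<open>
  The hole is h 0, ..., h (n - 1), the sector of w is h 0, ..., h l, and h (l + 1), h (n - 1) are the neighbours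
  of its ends outside the sector. The condition on b in the last two hypotheses says that h b is outside the
  extended neighborhood of the sector.
\<close>

locale sector_path = graph_C V E for V :: "'a set" and E :: "'a \<Rightarrow> 'a \<Rightarrow> bool" +
  fixes h :: "nat \<Rightarrow> 'a" and n l :: nat and w :: 'a and p :: "nat \<Rightarrow> 'a" and k :: nat
  assumes cy: "cyc h n" and l2: "2 \<le> l" and ln: "l + 3 \<le> n"
    and wV: "w \<in> V" and wh: "\<And>i. i < n \<Longrightarrow> h i \<noteq> w"
    and w0: "E w (h 0)" and wl: "E w (h l)" and wQ: "\<And>i. 0 < i \<Longrightarrow> i < l \<Longrightarrow> \<not> E w (h i)"
    and k0: "0 < k" and pV: "\<And>i. i < k \<Longrightarrow> p i \<in> V" and pw: "\<And>i. i < k \<Longrightarrow> p i \<noteq> w"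
    and ph: "\<And>i j. i < k \<Longrightarrow> j < n \<Longrightarrow> p i \<noteq> h j" and peq: "\<And>i j. i < k \<Longrightarrow> j < k \<Longrightarrow> p i = p j \<longleftrightarrow> i = j"
    and pE: "\<And>i j. i < k \<Longrightarrow> j < k \<Longrightarrow> E (p i) (p j) \<longleftrightarrow> i = Suc j \<or> j = Suc i"
    and wp: "\<And>i. i < k \<Longrightarrow> \<not> E w (p i)"
    and p0: "\<exists>a. 0 < a \<and> a < l \<and> E (p 0) (h a)"
    and pQ: "\<And>i a. 0 < i \<Longrightarrow> i < k \<Longrightarrow> 0 < a \<Longrightarrow> a < l \<Longrightarrow> \<not> E (p i) (h a)"
    and pk: "\<exists>b. l < b \<and> b < n \<and> (b = Suc l \<or> Suc b = n \<longrightarrow> \<not> E w (h b)) \<and> E (p (k - 1)) (h b)"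
    and pR: "\<And>i b. Suc i < k \<Longrightarrow> l < b \<Longrightarrow> b < n \<Longrightarrow> (b = Suc l \<or> Suc b = n \<Longrightarrow> \<not> E w (h b)) \<Longrightarrow> \<not> E (p i) (h b)"
begin

section \<open>Contacts, and holes formed by a piece of P and a piece of H\<close>

definition A :: "nat \<Rightarrow> nat \<Rightarrow> bool" where "A i j \<longleftrightarrow> E (p i) (h j)"
definition W :: "nat \<Rightarrow> bool" where "W j \<longleftrightarrow> E w (h j)"

text \<open>The positions at which only the last vertex of the path may have a neighbour.\<close>

definition Rok :: "nat \<Rightarrow> bool" where
  "Rok b \<longleftrightarrow> l < b \<and> b < n \<and> (b = Suc l \<or> Suc b = n \<longrightarrow> \<not> W b)"

lemma n4: "4 \<le> n" and hV: "\<And>i. i < n \<Longrightarrow> h i \<in> V"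
  and heq: "\<And>i j. i < n \<Longrightarrow> j < n \<Longrightarrow> h i = h j \<longleftrightarrow> i = j"
  and hE: "\<And>i j. i < n \<Longrightarrow> j < n \<Longrightarrow> E (h i) (h j) \<longleftrightarrow> i = Suc j \<or> j = Suc i \<or> (i = 0 \<and> Suc j = n) \<or> (j = 0 \<and> Suc i = n)"
  using cy by (auto simp: cyc_def inj_on_def)

lemma EA: "E (p i) (h j) \<longleftrightarrow> A i j" "E (h j) (p i) \<longleftrightarrow> A i j" and EW: "E w (h j) \<longleftrightarrow> W j" "E (h j) w \<longleftrightarrow> W j"
  by (auto simp: A_def W_def E_commute)

lemma wp': "i < k \<Longrightarrow> \<not> E (p i) w" using wp E_commute by blast

lemma whp: "i < n \<Longrightarrow> w \<noteq> h i" "i < k \<Longrightarrow> w \<noteq> p i" "i < k \<Longrightarrow> j < n \<Longrightarrow> h j \<noteq> p i" using wh pw ph by metis+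

lemma W0: "W 0" and Wl: "W l" and WQ: "0 < i \<Longrightarrow> i < l \<Longrightarrow> \<not> W i"
  using w0 wl wQ by (auto simp: W_def)

lemma A_sector: "\<exists>a. 0 < a \<and> a < l \<and> A 0 a" and not_A_sector: "0 < i \<Longrightarrow> i < k \<Longrightarrow> 0 < a \<Longrightarrow> a < l \<Longrightarrow> \<not> A i a"
  and A_far: "\<exists>b. Rok b \<and> A (k - 1) b" and not_A_far: "Suc i < k \<Longrightarrow> Rok b \<Longrightarrow> \<not> A i b"
  using p0 pQ pk pR by (auto simp: A_def Rok_def W_def)

lemmas base = hV heq hE EA EW wp wp' whp wh ph pw peq pE pV wV

lemma ipath_h:
  assumes "i < n" "j < n" "(0 < i \<and> 0 < j) \<or> (Suc i < n \<and> Suc j < n)"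
  shows "ipath V E (walk h i j)"
proof -
  have *: "ipath V E (map h [a..<Suc b])" if "a \<le> b" "b < n" "0 < a \<or> Suc b < n" for a b
    by (rule ipath_map) (use that hV heq hE in auto)
  then show ?thesis unfolding walk_def using *[of i j] ipath_rev[OF *[of j i]] assms
    by (auto simp add: rev_map simp del: upt_Suc)
qed

lemma ipath_p:
  assumes "i < k" "j < k"
  shows "ipath V E (walk p i j)"
proof -
  have *: "ipath V E (map p [a..<Suc b])" if "a \<le> b" "b < k" for a b
    by (rule ipath_map) (use that pV peq pE in auto)
  then show ?thesis unfolding walk_def using *[of i j] ipath_rev[OF *[of j i]] assms
    by (auto simp add: rev_map simp del: upt_Suc)
qed

text \<open>This is \<open>l - i\<close> modulo \<open>n\<close>: it reverses the sector and
  exchanges the two vertices next to it.\<close>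

definition mirror :: "nat \<Rightarrow> nat" where "mirror i = (if i \<le> l then l - i else n + l - i)"

text \<open>The path is left as it is, so every result of the locale also holds with the two ends of
  the sector exchanged.\<close>

lemma reflect: "sector_path V E (\<lambda>i. h (mirror i)) n l w p k"
proof -
  let ?r = "\<lambda>i. if i \<le> l then l - i else n + l - i"
  have r: "?r i < n" if "i < n" for i using that ln by auto
  have "sector_path V E (\<lambda>i. h (?r i)) n l w p k"
  proof
    have "E (h (?r i)) (h (?r j)) \<longleftrightarrow> i = Suc j \<or> j = Suc i \<or> (i = 0 \<and> Suc j = n) \<or> (j = 0 \<and> Suc i = n)" if "i < n" "j < n" for i j
      unfolding hE[OF r[OF that(1)] r[OF that(2)]] using that ln l2 by auto
    moreover have "h (?r i) = h (?r j) \<longleftrightarrow> i = j" if "i < n" "j < n" for i j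
      unfolding heq[OF r[OF that(1)] r[OF that(2)]] using that ln l2 by auto
    ultimately show "cyc (\<lambda>i. h (?r i)) n" using n4 hV r by (auto simp: cyc_def inj_on_def simp del: if_split_asm)
    obtain a where "0 < a" "a < l" "E (p 0) (h a)" using p0 by blast
    then show "\<exists>a. 0 < a \<and> a < l \<and> E (p 0) (h (?r a))" by (intro exI[of _ "l - a"]) auto
    obtain b where b: "l < b" "b < n" "b = Suc l \<or> Suc b = n \<longrightarrow> \<not> E w (h b)" "E (p (k - 1)) (h b)" using pk by blast
    show "\<exists>b. l < b \<and> b < n \<and> (b = Suc l \<or> Suc b = n \<longrightarrow> \<not> E w (h (?r b))) \<and> E (p (k - 1)) (h (?r b))"
    proof (intro exI[of _ "n + l - b"] conjI)
      have "n + l - b = Suc l \<longleftrightarrow> Suc b = n" "Suc (n + l - b) = n \<longleftrightarrow> b = Suc l" "n + l - (n + l - b) = b" "\<not> n + l - b \<le> l"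
        using b by linarith+
      then show "n + l - b = Suc l \<or> Suc (n + l - b) = n \<longrightarrow> \<not> E w (h (?r (n + l - b)))"
        "E (p (k - 1)) (h (?r (n + l - b)))" using b by auto
    qed (use b in auto)
    show "\<not> E (p i) (h (?r b))" if "Suc i < k" "l < b" "b < n" "b = Suc l \<or> Suc b = n \<Longrightarrow> \<not> E w (h (?r b))" for i b
    proof (rule pR[OF that(1)])
      have b: "n + l - b = Suc l \<longleftrightarrow> Suc b = n" "Suc (n + l - b) = n \<longleftrightarrow> b = Suc l" "?r b = n + l - b"
        using that by auto
      show "l < ?r b" "?r b < n" using that by auto
      show "\<not> E w (h (?r b))" if "?r b = Suc l \<or> Suc (?r b) = n"
        using that \<open>b = Suc l \<or> Suc b = n \<Longrightarrow> \<not> E w (h (?r b))\<close> b by metis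
    qed
  qed (use l2 ln wV wh w0 wl wQ k0 pV pw ph peq pE wp pQ r in auto)
  then show ?thesis by (simp add: mirror_def[abs_def])
qed

lemma hole_ph:
  assumes b: "i < k" "j < k" "e < n" "s < n" and sg: "(0 < e \<and> 0 < s) \<or> (Suc e < n \<and> Suc s < n)"
    and len: "2 \<le> (i - j + (j - i)) + (e - s + (s - e))"
    and link: "\<And>a t. min i j \<le> a \<Longrightarrow> a \<le> max i j \<Longrightarrow> min e s \<le> t \<Longrightarrow> t \<le> max e s \<Longrightarrow> A a t \<longleftrightarrow> (a = j \<and> t = e) \<or> (a = i \<and> t = s)"
  shows "hole V E (walk p i j @ walk h e s)"
proof (rule hole_of_paths[OF ipath_p[OF b(1,2)] ipath_h[OF b(3,4) sg]])
  have *: "x < k" if "x \<le> max i j" for x using that b by (simp add: le_max_iff_disj) linarith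
  have **: "t < n" if "t \<le> max e s" for t using that b by (simp add: le_max_iff_disj) linarith
  show "set (walk p i j) \<inter> set (walk h e s) = {}"
  proof (intro equals0I, elim IntE walk_cases)
    fix x a t assume "x = p a" "a \<le> max i j" "x = h t" "t \<le> max e s"
    then show False using ph[OF * **] by metis
  qed
  show "4 \<le> length (walk p i j) + length (walk h e s)" using len by simp
  fix a b assume "a \<in> set (walk p i j)" "b \<in> set (walk h e s)"
  then obtain x t where xt: "a = p x" "min i j \<le> x" "x \<le> max i j" "b = h t" "min e s \<le> t" "t \<le> max e s"
    by (elim walk_cases)
  then have bb: "x < k" "t < n" using * ** by auto
  have "a = p j \<longleftrightarrow> x = j" "a = p i \<longleftrightarrow> x = i" "b = h e \<longleftrightarrow> t = e" "b = h s \<longleftrightarrow> t = s"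
    using bb b unfolding xt(1,4) by (simp_all only: peq heq)
  then show "E a b \<longleftrightarrow> (a = last (walk p i j) \<and> b = hd (walk h e s)) \<or> (a = hd (walk p i j) \<and> b = last (walk h e s))"
    using link[OF xt(2,3,5,6)] xt(1,4) by (simp add: EA)
qed

text \<open>The sides of the hole have to separate the neighbours of \<open>h 0\<close> from those
  of \<open>w\<close>. If \<open>h 1\<close> or \<open>h (n - 1)\<close> lies on the hole,
  \<open>h 0\<close> sees it, so it joins the vertices of the path. This is harmless for
  \<open>w\<close>, which does not see \<open>h 1\<close>, an inner vertex of the sector, nor
  \<open>h (n - 1)\<close> if \<open>s = n - 1\<close>.\<close>

lemma hole_contacts:
  assumes e: "0 < e" "e < s" "s < n" and j: "m \<le> j" "j < k" and len: "e + 2 \<le> j - m + s"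
    and link: "\<And>i t. m \<le> i \<Longrightarrow> i \<le> j \<Longrightarrow> e \<le> t \<Longrightarrow> t \<le> s \<Longrightarrow> A i t \<longleftrightarrow> (i = m \<and> t = e) \<or> (i = j \<and> t = s)"
    and s: "Suc s = n \<Longrightarrow> \<not> W s" and W: "\<exists>t. e \<le> t \<and> t \<le> s \<and> W t"
    and X: "(\<exists>i. m \<le> i \<and> i \<le> j \<and> A i 0) \<or> e = 1 \<or> Suc s = n"
  obtains c d where "e \<le> d" "d \<le> s" "W d" "\<And>t. e \<le> t \<Longrightarrow> t \<le> s \<Longrightarrow> W t \<Longrightarrow> t = d" "E c (h d)"
    "\<And>i. m \<le> i \<Longrightarrow> i \<le> j \<Longrightarrow> A i 0 \<Longrightarrow> c = p i" "e = 1 \<Longrightarrow> c = h 1" "Suc s = n \<Longrightarrow> c = h s"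
proof -
  have 0: "hole V E (walk p j m @ map h [e..<Suc s])"
  proof -
    have "hole V E (walk p j m @ walk h e s)"
    proof (rule hole_ph)
      fix a t assume "min j m \<le> a" "a \<le> max j m" "min e s \<le> t" "t \<le> max e s"
      then show "A a t \<longleftrightarrow> (a = m \<and> t = e) \<or> (a = j \<and> t = s)" using link[of a t] e j by simp
    qed (use e j len k0 in simp_all)
    then show ?thesis using e by (simp add: walk_def[of h] del: upt_Suc)
  qed
  define e' where "e' = (if e = 1 then 2 else e)"
  define s' where "s' = (if Suc s = n then s else Suc s)"
  define P where "P = (if Suc s = n then [h s] else []) @ walk p j m @ (if e = 1 then [h 1] else [])"
  define Q where "Q = map h [e'..<s']"
  have W1: "\<not> W 1" using WQ[of 1] l2 by simp
  obtain t0 where t: "e \<le> t0" "t0 \<le> s" "W t0" using W by blast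
  then have "t0 \<noteq> 1" "Suc s = n \<Longrightarrow> t0 \<noteq> s" using W1 s by auto
  then have t0: "e' \<le> t0" "t0 < s'" "W t0" using t unfolding e'_def s'_def
    by (cases "e = 1"; cases "Suc s = n"; simp)+
  have 1: "map h [e..<Suc s] = (if e = 1 then [h 1] else []) @ Q @ (if Suc s = n then [h s] else [])"
  proof -
    have "[e..<Suc s] = (if e = 1 then [1] else []) @ [e'..<Suc s]"
      using e t0 unfolding e'_def by (simp add: upt_conv_Cons numeral_2_eq_2)
    moreover have "[e'..<Suc s] = [e'..<s'] @ (if Suc s = n then [s] else [])"
      using e t0 unfolding s'_def by (simp split: if_splits)
    ultimately show ?thesis unfolding Q_def by simp
  qed
  have hole: "hole V E (P @ Q)"
    using hole_swap[of V E "walk p j m @ (if e = 1 then [h 1] else []) @ Q" "if Suc s = n then [h s] else []"] 0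
    unfolding 1 P_def by simp
  have sP: "x \<in> set P \<longleftrightarrow> (\<exists>i. m \<le> i \<and> i \<le> j \<and> x = p i) \<or> (e = 1 \<and> x = h 1) \<or> (Suc s = n \<and> x = h s)" for x
    unfolding P_def by (cases "Suc s = n"; cases "e = 1"; use j in \<open>auto simp: image_iff\<close>)
  have Pin: "m \<le> i \<Longrightarrow> i \<le> j \<Longrightarrow> p i \<in> set P" "e = 1 \<Longrightarrow> h 1 \<in> set P" "Suc s = n \<Longrightarrow> h s \<in> set P" for i
    using sP by blast+
  have sQ: "x \<in> set Q \<longleftrightarrow> (\<exists>t. e' \<le> t \<and> t < s' \<and> x = h t)" for x
    unfolding Q_def by auto
  have "\<exists>c\<in>set P. \<exists>d\<in>set Q. E c d \<and> (\<forall>z\<in>set P. E (hd [h 0, w]) z \<longleftrightarrow> z = c) \<and> (\<forall>z\<in>set Q. E (last [h 0, w]) z \<longleftrightarrow> z = d)"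
  proof (rule two_feet[OF hole])
    show "ipath V E [h 0, w]"
      using ipath_append[of "[h 0]" "[w]"] ln W0 by (simp add: ipath_single base)
    show "set [h 0, w] \<inter> set (P @ Q) = {}" using e j n4
      by (auto simp: sP sQ base e'_def s'_def split: if_splits)
    show "\<exists>a\<in>set P. E (hd [h 0, w]) a"
      using X
    proof (elim disjE exE conjE)
      fix i assume "m \<le> i" "i \<le> j" "A i 0" then show ?thesis by (intro bexI[OF _ Pin(1)]) (simp_all add: base)
    next
      assume "e = 1" then show ?thesis using n4 by (intro bexI[OF _ Pin(2)]) (simp_all add: base)
    next
      assume "Suc s = n" then show ?thesis using n4 e by (intro bexI[OF _ Pin(3)]) (simp_all add: base)
    qed
    show "\<forall>b\<in>set Q. \<not> E (hd [h 0, w]) b" using e n4 by (auto simp: sQ base e'_def s'_def split: if_splits)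
    show "\<exists>b\<in>set Q. E (last [h 0, w]) b" by (rule bexI[of _ "h t0"]) (use sQ t0 in \<open>auto simp: base\<close>)
    show "\<forall>a\<in>set P. \<not> E (last [h 0, w]) a" using s j WQ[of 1] l2 by (auto simp: sP base)
  qed auto
  then obtain c d where cd: "c \<in> set P" "d \<in> set Q" "E c d" "\<And>z. z \<in> set P \<Longrightarrow> E (h 0) z \<longleftrightarrow> z = c"
    "\<And>z. z \<in> set Q \<Longrightarrow> E w z \<longleftrightarrow> z = d" by auto
  then obtain t where t: "d = h t" "e' \<le> t" "t < s'" unfolding sQ by auto
  show ?thesis
  proof (rule that[of t c])
    show et: "e \<le> t" "t \<le> s" using t unfolding e'_def s'_def by (auto split: if_splits)
    show "W t" using cd(5)[OF cd(2)] t(1) by (simp add: W_def)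
    show "u = t" if "e \<le> u" "u \<le> s" "W u" for u
    proof -
      have "u \<noteq> 1" "Suc s = n \<Longrightarrow> u \<noteq> s" using that W1 s by auto
      then have "e' \<le> u" "u < s'" using that unfolding e'_def s'_def
        by (cases "e = 1"; cases "Suc s = n"; simp)+
      then have "h u \<in> set Q" using sQ by blast
      then have "h u = h t" using cd(5)[of "h u"] t(1) that by (simp add: W_def)
      then show ?thesis using heq[of u t] that \<open>t \<le> s\<close> e by simp
    qed
    show "E c (h t)" using cd t by simp
    show "c = p i" if "m \<le> i" "i \<le> j" "A i 0" for i using cd(4)[OF Pin(1)] that by (simp add: base)
    show "c = h 1" if "e = 1" using cd(4)[OF Pin(2)] that n4 by (simp add: base)
    show "c = h s" if "Suc s = n" using cd(4)[OF Pin(3)] that n4 e by (simp add: base)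
  qed
qed

end

text \<open>With truncated subtraction, \<open>i - j + (j - i)\<close> is the distance of
  \<open>i\<close> and \<open>j\<close>. Minimality will make the two ends of a stretch its only
  contacts.\<close>

lemma closest_pair:
  fixes a b :: nat
  assumes "Q a b"
  obtains i j where "Q i j" "\<And>i' j'. i' - j' + (j' - i') < i - j + (j - i) \<Longrightarrow> \<not> Q i' j'"
proof -
  define m where "m = (\<lambda>(i, j). i - j + (j - i) :: nat)"
  obtain x where x: "case_prod Q x" "\<And>y. case_prod Q y \<Longrightarrow> m x \<le> m y"
    using ex_has_least_nat[of "case_prod Q" "(a, b)" m] assms by auto
  obtain i j where "x = (i, j)" by (cases x)
  then show thesis using that[of i j] x by (force simp: m_def)
qed

context sector_path
begin

section \<open>Holes through w\<close>

lemma sector_hole: "hole V E (map h [1..<l] @ [h l, w, h 0])"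
proof -
  have "ipath V E (walk h 0 l)" by (rule ipath_h) (use ln in auto)
  then have "hole V E ([w] @ walk h 0 l)"
  proof (rule hole_of_paths[OF ipath_single[OF wV]])
    show "set [w] \<inter> set (walk h 0 l) = {}" using ln by (auto simp: whp)
    show "4 \<le> length [w] + length (walk h 0 l)" using l2 by simp
    fix a b assume a: "a \<in> set [w]" and "b \<in> set (walk h 0 l)"
    then obtain t where t: "b = h t" "t \<le> l" by (elim walk_cases) auto
    have "W t \<longleftrightarrow> t = 0 \<or> t = l" using W0 Wl WQ[of t] t by (cases "t = 0"; cases "t = l") auto
    then show "E a b \<longleftrightarrow> (a = last [w] \<and> b = hd (walk h 0 l)) \<or> (a = hd [w] \<and> b = last (walk h 0 l))"
      using a t ln by (auto simp: base)
  qed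
  moreover have "walk h 0 l = h 0 # map h [1..<l] @ [h l]"
    using l2 by (simp add: walk_def upt_conv_Cons)
  ultimately show ?thesis using hole_swap[of V E "[w, h 0]" "map h [1..<l] @ [h l]"]
      hole_swap[of V E "[w, h 0]" "map h [1..<l] @ [h l]"] by simp
qed

text \<open>Rigidity on the hole formed by the sector and \<open>w\<close>, with the interior of the
  sector as one side. The foot of the last vertex is \<open>w\<close>, so the foot of the first one
  would be an inner vertex of the sector adjacent to \<open>w\<close>.\<close>

lemma no_sector_to_w:
  assumes F: "ipath V E F" "2 \<le> length F" and d: "\<And>t. t \<in> set F \<Longrightarrow> t \<noteq> w" "\<And>t a. t \<in> set F \<Longrightarrow> a \<le> l \<Longrightarrow> t \<noteq> h a"
    and f: "\<exists>a. 0 < a \<and> a < l \<and> E (hd F) (h a)" "\<not> E (hd F) (h 0)" "\<not> E (hd F) (h l)" "\<not> E (hd F) w"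
    and g: "E (last F) w" "\<And>a. 0 < a \<Longrightarrow> a < l \<Longrightarrow> \<not> E (last F) (h a)"
    and int: "\<And>t. t \<in> set F \<Longrightarrow> t \<noteq> hd F \<Longrightarrow> t \<noteq> last F \<Longrightarrow> \<not> E t w"
      "\<And>t a. t \<in> set F \<Longrightarrow> t \<noteq> hd F \<Longrightarrow> t \<noteq> last F \<Longrightarrow> a \<le> l \<Longrightarrow> \<not> E t (h a)"
  shows False
proof -
  have "\<exists>c\<in>set (map h [1..<l]). \<exists>d\<in>set [h l, w, h 0]. E c d \<and> (\<forall>z\<in>set (map h [1..<l]). E (hd F) z \<longleftrightarrow> z = c)
    \<and> (\<forall>z\<in>set [h l, w, h 0]. E (last F) z \<longleftrightarrow> z = d)"
  proof (rule two_feet[OF sector_hole F])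
    show "set F \<inter> set (map h [1..<l] @ [h l, w, h 0]) = {}"
    proof (intro equals0I, elim IntE)
      fix x assume x: "x \<in> set F" "x \<in> set (map h [1..<l] @ [h l, w, h 0])"
      from x(2) have "x = w \<or> (\<exists>a\<le>l. x = h a)" by auto (metis less_imp_le)
      then show False using d x(1) by blast
    qed
  qed (use f g int in auto)
  then obtain c d where c: "c \<in> set (map h [1..<l])" "E c d" and d: "\<forall>z\<in>set [h l, w, h 0]. E (last F) z \<longleftrightarrow> z = d" by blast
  have "d = w" using d g(1) by simp
  moreover obtain a where "0 < a" "a < l" "c = h a" using c(1) by (auto simp: Suc_le_eq)
  ultimately have "0 < a" "a < l" "E (h a) w" using c by auto
  then show False using WQ EW by auto
qed

text \<open>\<open>p 0\<close>, \<open>h 0\<close>, \<open>w\<close>, \<open>h l\<close> form a hole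
  of length four. An \<open>F\<close> with at least two vertices would have the nonadjacent feet
  \<open>p 0\<close> and \<open>w\<close>; a single vertex would see exactly these two vertices of
  the hole.\<close>

lemma no_p0_to_w:
  assumes A: "A 0 0" "A 0 l" and F: "ipath V E F" and d: "\<And>t. t \<in> set F \<Longrightarrow> t \<noteq> w \<and> t \<noteq> h 0 \<and> t \<noteq> h l \<and> t \<noteq> p 0"
    and f: "\<And>t. t \<in> set F \<Longrightarrow> E (p 0) t \<longleftrightarrow> t = hd F" and g: "\<And>t. t \<in> set F \<Longrightarrow> E w t \<longleftrightarrow> t = last F"
    and xy: "\<And>t. t \<in> set F \<Longrightarrow> \<not> E (h 0) t \<and> \<not> E (h l) t"
  shows False
proof -
  have n: "F \<noteq> []" using F by auto
  have 1: "ipath V E [p 0, h 0, w]"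
  proof -
    have "ipath V E ([p 0] @ [h 0])"
      by (rule ipath_append) (use A k0 n4 in \<open>auto simp: ipath_single base\<close>)
    then have "ipath V E ([p 0, h 0] @ [w])"
      by (intro ipath_append) (use A k0 n4 W0 in \<open>auto simp: ipath_single base\<close>)
    then show ?thesis by simp
  qed
  have Z: "hole V E ([p 0, h 0, w] @ [h l])"
    by (rule hole_of_paths[OF 1]) (use A k0 ln l2 Wl in \<open>auto simp: ipath_single base\<close>)
  show False
  proof (cases "length F \<ge> 2")
    case True
    have "\<exists>c\<in>set [p 0]. \<exists>d\<in>set [h 0, w, h l]. E c d \<and> (\<forall>z\<in>set [p 0]. E (hd F) z \<longleftrightarrow> z = c)
      \<and> (\<forall>z\<in>set [h 0, w, h l]. E (last F) z \<longleftrightarrow> z = d)"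
    proof (rule two_feet[OF _ F True])
      show "hole V E ([p 0] @ [h 0, w, h l])" using Z by simp
      have hl: "hd F \<noteq> last F" using hd_ne_last F True by auto
      have m: "hd F \<in> set F" "last F \<in> set F" using n by auto
      show "set F \<inter> set ([p 0] @ [h 0, w, h l]) = {}" using d by auto
      show "\<exists>a\<in>set [p 0]. E (hd F) a" using f[OF m(1)] E_sym by auto
      show "\<forall>b\<in>set [h 0, w, h l]. \<not> E (hd F) b" using g[OF m(1)] hl xy[OF m(1)] E_sym by auto
      show "\<exists>b\<in>set [h 0, w, h l]. E (last F) b" using g[OF m(2)] E_sym by auto
      show "\<forall>a\<in>set [p 0]. \<not> E (last F) a" using f[OF m(2)] hl E_sym by auto
      show "\<forall>t\<in>set F. t \<noteq> hd F \<longrightarrow> t \<noteq> last F \<longrightarrow> (\<forall>z\<in>set ([p 0] @ [h 0, w, h l]). \<not> E t z)"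
        using f g xy E_commute by fastforce
    qed
    then have "E (p 0) w" using g[of "last F"] n E_sym by auto
    then show False using wp' k0 by auto
  next
    case False
    then obtain t where t: "F = [t]" using n by (cases F) (auto simp: Suc_le_eq)
    have "\<exists>e\<in>set ([p 0, h 0, w] @ [h l]). E t e \<and> e \<noteq> p 0 \<and> e \<noteq> w"
      by (rule hole_two_nbrs[OF Z]) (use t d f g k0 E_sym in \<open>auto simp: base\<close>)
    then show False using xy[of t] t E_sym by auto
  qed
qed

text \<open>Take a closest pair of such contacts. If \<open>i = j\<close>, then \<open>p i\<close>
  sees just the nonadjacent vertices \<open>h 0\<close> and \<open>h l\<close> of the sector hole.
  Otherwise the piece of P between them has these two as its feet.\<close>

lemma not_both_sides:
  assumes "0 < i" "i < k" "0 < j" "j < k" "A i 0" "A j l"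
  shows False
proof -
  define Q where "Q i j \<longleftrightarrow> 0 < i \<and> i < k \<and> 0 < j \<and> j < k \<and> A i 0 \<and> A j l" for i j
  obtain i j where Q: "Q i j" "\<And>i' j'. i' - j' + (j' - i') < i - j + (j - i) \<Longrightarrow> \<not> Q i' j'"
    using closest_pair[of Q i j] assms unfolding Q_def by blast
  have b: "0 < i" "i < k" "0 < j" "j < k" "A i 0" "A j l" using Q(1) by (auto simp: Q_def)
  have mn: "\<not> (A i' 0 \<and> A j' l)" if "0 < i'" "i' < k" "0 < j'" "j' < k" "i' - j' + (j' - i') < i - j + (j - i)" for i' j'
    using Q(2)[OF that(5)] that by (auto simp: Q_def)
  have x: "A t 0 \<longleftrightarrow> t = i" "A t l \<longleftrightarrow> t = j" "t < k" if "min i j \<le> t" "t \<le> max i j" for t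
  proof -
    have t: "0 < t" "t < k" using that b by (auto simp: min_def max_def split: if_splits)
    show "A t 0 \<longleftrightarrow> t = i" using mn[of t j] t that b by (cases "t = i") (auto simp: min_def max_def split: if_splits)
    show "A t l \<longleftrightarrow> t = j" using mn[of i t] t that b by (cases "t = j") (auto simp: min_def max_def split: if_splits)
    show "t < k" by (rule t)
  qed
  show False
  proof (cases "i = j")
    case True
    have "\<exists>e\<in>set (map h [1..<l] @ [h l, w, h 0]). E (p i) e \<and> e \<noteq> h 0 \<and> e \<noteq> h l"
      by (rule hole_two_nbrs[OF sector_hole]) (use True b ln l2 n4 in \<open>auto simp: base\<close>)
    then show False using b not_A_sector[of i] by (auto simp: base)
  next
    case False
    have Z: "hole V E ([h 0] @ (map h [1..<l] @ [h l, w]))"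
      using hole_swap[of V E "map h [1..<l] @ [h l, w]" "[h 0]"] sector_hole by simp
    have "\<exists>c\<in>set [h 0]. \<exists>d\<in>set (map h [1..<l] @ [h l, w]). E c d \<and> (\<forall>z\<in>set [h 0]. E (hd (walk p i j)) z \<longleftrightarrow> z = c)
      \<and> (\<forall>z\<in>set (map h [1..<l] @ [h l, w]). E (last (walk p i j)) z \<longleftrightarrow> z = d)"
    proof (rule two_feet[OF Z ipath_p])
      show "set (walk p i j) \<inter> set ([h 0] @ map h [1..<l] @ [h l, w]) = {}"
      proof (intro equals0I, elim IntE walk_cases)
        fix y t assume "y \<in> set ([h 0] @ map h [1..<l] @ [h l, w])" "y = p t" "min i j \<le> t" "t \<le> max i j"
        then show False using x[of t] ln by (auto simp: base)
      qed
      show "\<forall>t\<in>set (walk p i j). t \<noteq> hd (walk p i j) \<longrightarrow> t \<noteq> last (walk p i j) \<longrightarrow> (\<forall>z\<in>set ([h 0] @ map h [1..<l] @ [h l, w]). \<not> E t z)"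
      proof (intro ballI impI, elim walk_cases)
        fix y z t assume "z \<in> set ([h 0] @ map h [1..<l] @ [h l, w])" and t: "y = p t" "min i j \<le> t" "t \<le> max i j"
          and "y \<noteq> hd (walk p i j)" "y \<noteq> last (walk p i j)"
        moreover have "0 < t" using t b by (auto simp: min_def split: if_splits)
        ultimately show "\<not> E y z" using x[of t] not_A_sector[of t] by (auto simp: base)
      qed
    qed (use False b ln x[of i] x[of j] not_A_sector[of i] not_A_sector[of j] in \<open>auto simp: base\<close>)
    then have "E (h 0) (h l)" using b by (auto simp: base)
    then show False using l2 ln by (simp add: base)
  qed
qed

text \<open>A shortest stretch of H from a contact of the last vertex of P to a neighbour of
  \<open>w\<close>. Staying off \<open>h (Suc l)\<close> and \<open>h (n - 1)\<close> keeps it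
  anticomplete to the sector.\<close>

lemma connect:
  assumes "A (k - 1) r" "Suc l < r" "Suc r < n" "W c" "Suc l < c" "Suc c < n"
  shows "\<exists>G. ipath V E G \<and> (\<forall>t\<in>set G. (\<exists>a. Suc l < a \<and> Suc a < n \<and> t = h a) \<and>
    (E (p (k - 1)) t \<longleftrightarrow> t = hd G) \<and> (E w t \<longleftrightarrow> t = last G))"
proof -
  define Q where "Q r c \<longleftrightarrow> A (k - 1) r \<and> Suc l < r \<and> Suc r < n \<and> W c \<and> Suc l < c \<and> Suc c < n" for r c
  obtain r c where Q: "Q r c" "\<And>i' j'. i' - j' + (j' - i') < r - c + (c - r) \<Longrightarrow> \<not> Q i' j'"
    using closest_pair[of Q r c] assms unfolding Q_def by blast
  have b: "A (k - 1) r" "Suc l < r" "Suc r < n" "W c" "Suc l < c" "Suc c < n" using Q(1) by (auto simp: Q_def)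
  have mn: "\<not> (A (k - 1) r' \<and> W c')" if "Suc l < r'" "Suc r' < n" "Suc l < c'" "Suc c' < n" "r' - c' + (c' - r') < r - c + (c - r)" for r' c'
    using Q(2)[OF that(5)] that by (auto simp: Q_def)
  have x: "A (k - 1) t \<longleftrightarrow> t = r" "W t \<longleftrightarrow> t = c" "Suc l < t" "Suc t < n" if "min r c \<le> t" "t \<le> max r c" for t
  proof -
    have t: "Suc l < t" "Suc t < n" using that b by (auto simp: min_def max_def split: if_splits)
    show "A (k - 1) t \<longleftrightarrow> t = r" using mn[of t c] t that b by (cases "t = r") (auto simp: min_def max_def split: if_splits)
    show "W t \<longleftrightarrow> t = c" using mn[of r t] t that b by (cases "t = c") (auto simp: min_def max_def split: if_splits)
    show "Suc l < t" "Suc t < n" by (rule t)+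
  qed
  show ?thesis
  proof (intro exI[of _ "walk h r c"] conjI ballI)
    show "ipath V E (walk h r c)" by (rule ipath_h) (use b in auto)
    fix y assume "y \<in> set (walk h r c)"
    then obtain t where t: "y = h t" "min r c \<le> t" "t \<le> max r c" by (elim walk_cases)
    show "\<exists>a>Suc l. Suc a < n \<and> y = h a" using t x by blast
    show "E (p (k - 1)) y \<longleftrightarrow> y = hd (walk h r c)" "E w y \<longleftrightarrow> y = last (walk h r c)"
      using t x[OF t(2,3)] b k0 by (auto simp: base)
  qed
qed

text \<open>Rigidity for the whole of P against H, which is cut behind \<open>h e\<close> and behind
  \<open>h (n - 1)\<close>.\<close>

lemma p_to_ring:
  assumes k: "2 \<le> k" and e: "l \<le> e" "e < n - 1"
    and a: "\<And>b. b < n \<Longrightarrow> A 0 b \<Longrightarrow> b \<le> e" and b: "\<And>b. b < n \<Longrightarrow> A (k - 1) b \<Longrightarrow> e < b"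
    and int: "\<And>i b. 0 < i \<Longrightarrow> Suc i < k \<Longrightarrow> b < n \<Longrightarrow> \<not> A i b"
  obtains c d where "c \<le> e" "e < d" "d < n" "E (h c) (h d)" "\<And>b. b < n \<Longrightarrow> A 0 b \<longleftrightarrow> b = c" "\<And>b. b < n \<Longrightarrow> A (k - 1) b \<longleftrightarrow> b = d"
proof -
  have "[0..<n] = [0..<Suc e] @ [Suc e..<n]" using upt_add_eq_append[of 0 "Suc e" "n - Suc e"] e by simp
  then have "map h [0..<n] = map h [0..<Suc e] @ map h [Suc e..<n]" by (simp del: upt_Suc)
  then have Z: "hole V E (map h [0..<Suc e] @ map h [Suc e..<n])" using cyc_hole[OF cy] by simp
  obtain a0 where a0: "0 < a0" "a0 < l" "A 0 a0" using A_sector by blast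
  obtain b0 where b0: "Rok b0" "A (k - 1) b0" using A_far by blast
  have "\<exists>c\<in>set (map h [0..<Suc e]). \<exists>d\<in>set (map h [Suc e..<n]). E c d \<and> (\<forall>z\<in>set (map h [0..<Suc e]). E (hd (walk p 0 (k - 1))) z \<longleftrightarrow> z = c)
      \<and> (\<forall>z\<in>set (map h [Suc e..<n]). E (last (walk p 0 (k - 1))) z \<longleftrightarrow> z = d)"
  proof (rule two_feet[OF Z ipath_p])
    show "set (walk p 0 (k - 1)) \<inter> set (map h [0..<Suc e] @ map h [Suc e..<n]) = {}"
    proof (intro equals0I, elim IntE walk_cases)
      fix x t assume "x \<in> set (map h [0..<Suc e] @ map h [Suc e..<n])" "x = p t" "t \<le> max 0 (k - 1)"
      moreover have "t < k" using \<open>t \<le> max 0 (k - 1)\<close> k by simp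
      ultimately show False using e by (auto simp: base)
    qed
    show "\<forall>t\<in>set (walk p 0 (k - 1)). t \<noteq> hd (walk p 0 (k - 1)) \<longrightarrow> t \<noteq> last (walk p 0 (k - 1)) \<longrightarrow> (\<forall>z\<in>set (map h [0..<Suc e] @ map h [Suc e..<n]). \<not> E t z)"
    proof (intro ballI impI, elim walk_cases)
      fix y z t assume z: "z \<in> set (map h [0..<Suc e] @ map h [Suc e..<n])" and t: "y = p t" "t \<le> max 0 (k - 1)"
        and "y \<noteq> hd (walk p 0 (k - 1))" "y \<noteq> last (walk p 0 (k - 1))"
      then have "t \<noteq> 0" "t \<noteq> k - 1" by (metis hd_walk, metis last_walk)
      then have t': "0 < t" "Suc t < k" using t by auto
      obtain b where "z = h b" "b < n" using z e by auto
      then show "\<not> E y z" using int[OF t'] t by (simp add: base)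
    qed
    show "\<exists>a\<in>set (map h [0..<Suc e]). E (hd (walk p 0 (k - 1))) a"
      by (rule bexI[of _ "h a0"]) (use a0 e in \<open>auto simp: base\<close>)
    show "\<forall>b\<in>set (map h [Suc e..<n]). \<not> E (hd (walk p 0 (k - 1))) b"
    proof
      fix b assume "b \<in> set (map h [Suc e..<n])"
      then obtain t where "b = h t" "e < t" "t < n" by auto
      then show "\<not> E (hd (walk p 0 (k - 1))) b" using a[of t] e by (auto simp: base)
    qed
    show "\<exists>b\<in>set (map h [Suc e..<n]). E (last (walk p 0 (k - 1))) b"
      by (rule bexI[of _ "h b0"]) (use b0 b[of b0] in \<open>auto simp: base Rok_def\<close>)
    show "\<forall>a\<in>set (map h [0..<Suc e]). \<not> E (last (walk p 0 (k - 1))) a"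
    proof
      fix a assume "a \<in> set (map h [0..<Suc e])"
      then obtain t where "a = h t" "t \<le> e" by (auto simp del: upt_Suc)
      moreover then have "t < n" using e by linarith
      ultimately show "\<not> E (last (walk p 0 (k - 1))) a" using b[of t] e by (auto simp: base)
    qed
  qed (use k in auto)
  then obtain c d where cd: "c \<in> {0..<Suc e}" "d \<in> {Suc e..<n}" "E (h c) (h d)"
      "\<forall>x\<in>{0..<Suc e}. E (p 0) (h x) \<longleftrightarrow> h x = h c" "\<forall>x\<in>{Suc e..<n}. E (p (k - 1)) (h x) \<longleftrightarrow> h x = h d"
    unfolding set_map bex_simps ball_simps set_upt hd_walk last_walk by blast
  show thesis
  proof (rule that[of c d])
    fix x assume x: "x < n"
    show "A 0 x \<longleftrightarrow> x = c"
    proof (cases "x \<le> e")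
      case True
      then show ?thesis using cd(1,4) e x heq[of x c] by (auto simp: A_def)
    next
      case False
      then show ?thesis using cd(1) a[OF x] by auto
    qed
    show "A (k - 1) x \<longleftrightarrow> x = d"
    proof (cases "x \<le> e")
      case True
      then show ?thesis using cd(2) b[OF x] by auto
    next
      case False
      then show ?thesis using cd(2,5) e x heq[of x d] by (auto simp: A_def)
    qed
  qed (use cd in auto)
qed

text \<open>The rigidity statement for the hole p m, ..., p j, h s, ..., h e and the edge from h 0 to w.\<close>

lemma contact_pair:
  assumes n: "0 < e \<and> e < s \<and> s < n \<and> m \<le> j \<and> j < k \<and> e + 2 \<le> j - m + s"
    and link: "\<forall>i t. m \<le> i \<longrightarrow> i \<le> j \<longrightarrow> e \<le> t \<longrightarrow> t \<le> s \<longrightarrow> (A i t \<longleftrightarrow> (i = m \<and> t = e) \<or> (i = j \<and> t = s))"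
    and s: "Suc s = n \<longrightarrow> \<not> W s" and W: "\<exists>t. e \<le> t \<and> t \<le> s \<and> W t"
    and X: "(\<exists>i. m \<le> i \<and> i \<le> j \<and> A i 0) \<or> e = 1 \<or> Suc s = n"
  shows "\<exists>c d. e \<le> d \<and> d \<le> s \<and> W d \<and> E c (h d) \<and> (\<forall>t. e \<le> t \<longrightarrow> t \<le> s \<longrightarrow> W t \<longrightarrow> t = d) \<and>
    (\<forall>i. m \<le> i \<longrightarrow> i \<le> j \<longrightarrow> A i 0 \<longrightarrow> c = p i) \<and> (e = 1 \<longrightarrow> c = h 1) \<and> (Suc s = n \<longrightarrow> c = h s)"
proof (rule hole_contacts[of e s m j])
  show "A i t \<longleftrightarrow> (i = m \<and> t = e) \<or> (i = j \<and> t = s)" if "m \<le> i" "i \<le> j" "e \<le> t" "t \<le> s" for i t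
    using link that by blast
  fix d c
  assume "e \<le> d" "d \<le> s" "W d" "\<And>t. e \<le> t \<Longrightarrow> t \<le> s \<Longrightarrow> W t \<Longrightarrow> t = d" "E c (h d)"
    "\<And>i. m \<le> i \<Longrightarrow> i \<le> j \<Longrightarrow> A i 0 \<Longrightarrow> c = p i" "e = 1 \<Longrightarrow> c = h 1" "Suc s = n \<Longrightarrow> c = h s"
  then show ?thesis by blast
qed (use assms in blast)+

lemma reflect_A: "sector_path.A E (\<lambda>i. h (mirror i)) p i j \<longleftrightarrow> A i (mirror j)" and reflect_W: "sector_path.W E (\<lambda>i. h (mirror i)) w j \<longleftrightarrow> W (mirror j)"
  by (simp_all add: sector_path.A_def[OF reflect] sector_path.W_def[OF reflect] A_def W_def)

lemma mirror_simps: "mirror 0 = l" "mirror l = 0" "mirror (Suc l) = n - 1" "mirror (n - 1) = Suc l" "mirror (n - Suc 0) = Suc l" "0 < n" "l < n" "Suc l < n"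
  "j < n \<Longrightarrow> mirror j < n" "j < n \<Longrightarrow> mirror (mirror j) = j" "0 < j \<Longrightarrow> j < l \<Longrightarrow> mirror j = l - j" "l < j \<Longrightarrow> mirror j = n + l - j"
  using ln l2 by (auto simp: mirror_def)

lemmas reflect_simps = reflect_A reflect_W mirror_simps

lemma Rok_mid: "Suc l < b \<Longrightarrow> Suc b < n \<Longrightarrow> Rok b"
  by (auto simp: Rok_def)

lemma not_Rok: "l < b \<Longrightarrow> b < n \<Longrightarrow> \<not> Rok b \<Longrightarrow> (b = Suc l \<or> Suc b = n) \<and> W b"
  by (auto simp: Rok_def)

text \<open>Yields the far end of a hole through P: the first position \<open>s\<close> beyond
  \<open>e\<close> seen from P, and the first vertex of P that sees it. Either \<open>s\<close> is
  outside the extended neighborhood, and then this is the last vertex of P, or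
  \<open>s = Suc l\<close> and \<open>w\<close> sees \<open>h s\<close>.\<close>

lemma first_contact:
  assumes b: "e < b" "Rok b" "A (k - 1) b" "l \<le> e"
  obtains s j where "e < s" "s < n" "j < k" "A j s" "\<And>i t. i < k \<Longrightarrow> e < t \<Longrightarrow> t < s \<Longrightarrow> \<not> A i t" "\<And>i. i < j \<Longrightarrow> \<not> A i s"
    "Suc s = n \<Longrightarrow> \<not> W s" "Rok s \<Longrightarrow> j = k - 1" "Rok s \<or> (s = Suc l \<and> W s)"
proof -
  define Q where "Q s \<longleftrightarrow> e < s \<and> s < n \<and> (\<exists>j<k. A j s)" for s
  have "k - 1 < k" using k0 by simp
  then have "Q b" using b unfolding Q_def Rok_def by blast
  define s where "s = (LEAST s. Q s)"
  have s: "Q s" "s \<le> b" using LeastI[of Q, OF \<open>Q b\<close>] Least_le[of Q, OF \<open>Q b\<close>] by (auto simp: s_def)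
  have s': "\<not> Q t" if "t < s" for t using that not_less_Least unfolding s_def by blast
  define j where "j = (LEAST j. A j s)"
  obtain j0 where "j0 < k" "A j0 s" using s by (auto simp: Q_def)
  then have j: "j < k" "A j s" using LeastI[of "\<lambda>j. A j s" j0] Least_le[of "\<lambda>j. A j s" j0] by (auto simp: j_def)
  \<comment> \<open>As \<open>s\<close> is at most \<open>b\<close>, it can be \<open>n - 1\<close>
    only by being \<open>b\<close> itself, and \<open>Rok b\<close> applies.\<close>
  have w: "Suc s = n \<Longrightarrow> \<not> W s" using s b by (cases "s = b") (auto simp: Rok_def)
  have ls: "l < s" "s < n" using s(1) b(4) by (auto simp: Q_def)
  show thesis
  proof (rule that[of s j])
    show "\<not> A i t" if "i < k" "e < t" "t < s" for i t using s'[OF that(3)] that s(1) by (auto simp: Q_def)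
    show "\<not> A i s" if "i < j" for i using that not_less_Least unfolding j_def by blast
    show "j = k - 1" if "Rok s"
    proof (rule ccontr)
      assume "j \<noteq> k - 1" then have "Suc j < k" using j by simp
      then show False using not_A_far[OF _ that] j by blast
    qed
    show "Rok s \<or> (s = Suc l \<and> W s)" using not_Rok[of s] ls w by blast
  qed (use s j w in \<open>auto simp: Q_def\<close>)
qed

lemma last_contact:
  obtains v where "0 < v" "v < l" "A 0 v" "\<And>a. v < a \<Longrightarrow> a < l \<Longrightarrow> \<not> A 0 a"
proof -
  define S where "S = {a. 0 < a \<and> a < l \<and> A 0 a}"
  have S: "finite S" "S \<noteq> {}" using A_sector by (auto simp: S_def)
  show thesis
  proof (rule that[of "Max S"])
    show "\<not> A 0 a" if "Max S < a" "a < l" for a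
      using Max_ge[OF S(1), of a] that unfolding S_def by fastforce
  qed (use Max_in[OF S] in \<open>auto simp: S_def\<close>)
qed

section \<open>Paths with no contact to one end of the sector\<close>

text \<open>The hole through P from the last contact \<open>h v\<close> inside the sector to the
  first contact \<open>h s\<close> beyond it contains the neighbour \<open>h l\<close> of
  \<open>w\<close>. A vertex of P on it that sees \<open>h 0\<close> would be adjacent to
  \<open>h l\<close>; and \<open>s = n - 1\<close> would put the second neighbour \<open>h d\<close>
  of \<open>w\<close> on it.\<close>

lemma no_right_contact:
  assumes y: "\<And>i. i < k \<Longrightarrow> \<not> A i l" and d: "l < d" "Suc d < n" "W d"
  shows "(\<forall>i<k. \<not> A i 0) \<and> (W (Suc l) \<longrightarrow> (\<forall>i<k. \<not> A i (Suc l)))"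
proof -
  obtain v where v: "0 < v" "v < l" "A 0 v" "\<And>a. v < a \<Longrightarrow> a < l \<Longrightarrow> \<not> A 0 a" using last_contact by blast
  obtain b where b: "Rok b" "A (k - 1) b" using A_far by blast
  then have "l < b" by (simp add: Rok_def)
  then obtain s j where s: "l < s" "s < n" "j < k" "A j s" "\<And>i t. i < k \<Longrightarrow> l < t \<Longrightarrow> t < s \<Longrightarrow> \<not> A i t" "\<And>i. i < j \<Longrightarrow> \<not> A i s"
    "Suc s = n \<Longrightarrow> \<not> W s" "Rok s \<Longrightarrow> j = k - 1" "Rok s \<or> (s = Suc l \<and> W s)"
    using first_contact[of l b] b by auto
  have link: "\<forall>i t. 0 \<le> i \<longrightarrow> i \<le> j \<longrightarrow> v \<le> t \<longrightarrow> t \<le> s \<longrightarrow> (A i t \<longleftrightarrow> (i = 0 \<and> t = v) \<or> (i = j \<and> t = s))"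
  proof (intro allI impI)
    fix i t assume b: "0 \<le> i" "i \<le> j" "v \<le> t" "t \<le> s"
    have "t < l \<or> t = l \<or> (l < t \<and> t < s) \<or> t = s" using b by linarith
    then consider "t < l" | "t = l" | "l < t" "t < s" | "t = s" by blast
    then show "A i t \<longleftrightarrow> (i = 0 \<and> t = v) \<or> (i = j \<and> t = s)"
    proof cases
      case 1
      then have ts: "t \<noteq> s" "0 < t" using s(1) v(1) b by linarith+
      have "A i t \<longleftrightarrow> i = 0 \<and> t = v"
      proof (cases "i = 0")
        case True
        then show ?thesis using v(3) v(4)[of t] 1 b(3) by (cases "t = v") simp_all
      next
        case False
        then show ?thesis using not_A_sector[of i t] 1 ts b(2) s(3) by simp
      qed
      then show ?thesis using ts by simp
    next
      case 2 then show ?thesis using y[of i] b(2) v(2) s(1,3) by simp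
    next
      case 3 then show ?thesis using s(5)[of i t] b(2) v(2) s(1,3) by simp
    next
      case 4 then show ?thesis using s(1,4) s(6)[of i] b(2) v(2) by (cases "i = j") simp_all
    qed
  qed
  have no: False if bad: "(\<exists>i. 0 \<le> i \<and> i \<le> j \<and> A i 0) \<or> Suc s = n"
  proof -
    have "0 < v \<and> v < s \<and> s < n \<and> 0 \<le> j \<and> j < k \<and> v + 2 \<le> j - 0 + s" using v(1,2) s(1-3) by linarith
    moreover have "\<exists>t\<ge>v. t \<le> s \<and> W t" using Wl v(2) s(1) by (intro exI[of _ l]) simp
    moreover have "Suc s = n \<longrightarrow> \<not> W s" using s(7) by blast
    moreover have "(\<exists>i. 0 \<le> i \<and> i \<le> j \<and> A i 0) \<or> v = 1 \<or> Suc s = n" using bad by blast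
    ultimately obtain c d' where cd: "E c (h d')" "\<forall>t. v \<le> t \<longrightarrow> t \<le> s \<longrightarrow> W t \<longrightarrow> t = d'" "\<forall>i. 0 \<le> i \<longrightarrow> i \<le> j \<longrightarrow> A i 0 \<longrightarrow> c = p i"
      using contact_pair[OF _ link] by blast
    have d': "d' = l" using cd(2)[rule_format, of l] Wl v(2) s(1) by simp
    show False using bad
    proof (elim disjE exE conjE)
      fix i assume "i \<le> j" "A i 0"
      then show False using cd(1) cd(3)[rule_format, of i] d' y[of i] s(3) by (simp add: EA)
    next
      assume "Suc s = n" then show False using cd(2)[rule_format, of d] d d' v(2) by simp
    qed
  qed
  \<comment> \<open>Otherwise P up to \<open>p j\<close>, followed by \<open>h (Suc l)\<close>,
    leads from the inside of the sector to a neighbour of \<open>w\<close> without touching the ends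
    of the sector.\<close>
  have "Rok s"
  proof (rule ccontr)
    assume "\<not> Rok s"
    then have s1: "s = Suc l" "W (Suc l)" using s(9) by auto
    have F: "ipath V E (walk p 0 j @ [h (Suc l)])"
    proof (rule ipath_append[OF ipath_p])
      fix a b assume "a \<in> set (walk p 0 j)" "b \<in> set [h (Suc l)]"
      moreover then obtain i where i: "a = p i" "i \<le> j" by (elim walk_cases) auto
      moreover have "A i (Suc l) \<longleftrightarrow> i = j" using link[rule_format, of i "Suc l"] i(2) s1(1) v(2) by simp
      ultimately show "E a b \<longleftrightarrow> a = last (walk p 0 j) \<and> b = hd [h (Suc l)]"
        using s by (simp add: base)
    qed (use s(2,3) s1 k0 in \<open>auto simp: base ipath_single elim!: walk_cases\<close>)
    have el: "\<exists>i\<le>j. t = p i" if "t \<in> set (walk p 0 j @ [h (Suc l)])" "t \<noteq> h (Suc l)" for t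
      using that by (auto elim!: walk_cases)
    show False
    proof (rule no_sector_to_w[OF F])
      fix t a assume t: "t \<in> set (walk p 0 j @ [h (Suc l)])"
      show "t \<noteq> w" using el[OF t] s(2,3) s1(1) by (cases "t = h (Suc l)") (auto simp: base)
      show "t \<noteq> h a" if "a \<le> l" using el[OF t] s(2,3) s1(1) that ln by (cases "t = h (Suc l)") (auto simp: base)
      assume t': "t \<noteq> hd (walk p 0 j @ [h (Suc l)])" "t \<noteq> last (walk p 0 j @ [h (Suc l)])"
      then obtain i where i: "t = p i" "i \<le> j" using el[OF t] by auto
      then show "\<not> E t w" using s(3) by (auto simp: base)
      assume a: "a \<le> l"
      have "i \<noteq> 0" using i t' by (cases "i = 0") auto
      then show "\<not> E t (h a)" using i not_A_sector[of i a] y[of i] no s(3) a by (cases "a = 0"; cases "a = l") (auto simp: EA)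
    next
      show "\<exists>a>0. a < l \<and> E (hd (walk p 0 j @ [h (Suc l)])) (h a)" using v by (auto simp: base)
      show "\<not> E (hd (walk p 0 j @ [h (Suc l)])) (h 0)" using no by (auto simp: base)
    qed (use y[of 0] k0 s1 ln in \<open>auto simp: base\<close>)
  qed
  then have j: "j = k - 1" using s by simp
  have "\<not> A i (Suc l)" if "W (Suc l)" "i < k" for i
  proof -
    have "Suc l \<noteq> s" using \<open>Rok s\<close> that by (auto simp: Rok_def)
    then show ?thesis using s(1) s(5)[of i "Suc l"] that by simp
  qed
  moreover have "\<not> A i 0" if "i < k" for i
  proof
    assume "A i 0"
    moreover have "i \<le> j" using that j by simp
    ultimately show False using no by blast
  qed
  ultimately show ?thesis by blast
qed

text \<open>A mirror symmetric condition that provides the neighbour \<open>h d\<close> of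
  \<open>w\<close> for \<open>no_right_contact\<close> and for its mirror image.\<close>

definition spread :: bool where
  "spread \<longleftrightarrow> (\<exists>c. Suc l < c \<and> Suc c < n \<and> W c) \<or> (W (Suc l) \<and> W (n - 1))"

lemma spread_reflect: "spread \<Longrightarrow> sector_path.spread E (\<lambda>i. h (mirror i)) n l w"
proof -
  assume *: spread
  interpret R: sector_path V E "\<lambda>i. h (mirror i)" n l w p k by (rule reflect)
  from * show "R.spread" unfolding spread_def R.spread_def reflect_simps
  proof (elim disjE exE conjE)
    fix c assume "Suc l < c" "Suc c < n" "W c"
    then show "(\<exists>c>Suc l. Suc c < n \<and> W (mirror c)) \<or> W (n - 1) \<and> W (Suc l)"
      by (intro disjI1 exI[of _ "n + l - c"]) (auto simp: mirror_simps)
  qed auto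
qed

text \<open>Once \<open>no_right_contact\<close> has removed the contacts with \<open>h 0\<close>,
  the hypothesis of its mirror image holds, which then removes those with
  \<open>h (n - 1)\<close>.\<close>

lemma no_contact_aux:
  assumes sp: spread and y: "\<And>i. i < k \<Longrightarrow> \<not> A i l" and i: "i < k"
  shows "\<not> A i 0" "\<not> A i l" "W (Suc l) \<Longrightarrow> \<not> A i (Suc l)" "W (n - 1) \<Longrightarrow> \<not> A i (n - 1)"
proof -
  obtain d where d: "l < d" "Suc d < n" "W d" using sp ln unfolding spread_def
    by (elim disjE exE conjE) (metis Suc_lessD, metis Suc_le_eq lessI numeral_3_eq_3 add_Suc_right add_0_right)
  have x: "(\<forall>i<k. \<not> A i 0) \<and> (W (Suc l) \<longrightarrow> (\<forall>i<k. \<not> A i (Suc l)))"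
    by (rule no_right_contact[OF y d])
  interpret R: sector_path V E "\<lambda>i. h (mirror i)" n l w p k by (rule reflect)
  obtain c where c: "l < c" "Suc c < n" "R.W c" using sp unfolding spread_def reflect_simps
  proof (elim disjE exE conjE)
    fix c assume "Suc l < c" "Suc c < n" "W c"
    then show thesis by (intro that[of "n + l - c"]) (auto simp: reflect_simps)
  next
    assume "W (n - 1)" then show thesis by (intro that[of "Suc l"]) (use ln in \<open>auto simp: reflect_simps\<close>)
  qed
  have "(\<forall>i<k. \<not> R.A i 0) \<and> (R.W (Suc l) \<longrightarrow> (\<forall>i<k. \<not> R.A i (Suc l)))"
    by (rule R.no_right_contact[OF _ c]) (use x in \<open>simp add: reflect_simps\<close>)
  then show "W (n - 1) \<Longrightarrow> \<not> A i (n - 1)" using i by (simp add: reflect_simps)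
  show "\<not> A i 0" "\<not> A i l" "W (Suc l) \<Longrightarrow> \<not> A i (Suc l)" using x i y by auto
qed

lemma no_contact:
  assumes sp: spread and xy: "(\<forall>i<k. \<not> A i l) \<or> (\<forall>i<k. \<not> A i 0)" and i: "i < k"
  shows "\<not> A i 0" "\<not> A i l" "W (Suc l) \<Longrightarrow> \<not> A i (Suc l)" "W (n - 1) \<Longrightarrow> \<not> A i (n - 1)"
proof -
  interpret R: sector_path V E "\<lambda>i. h (mirror i)" n l w p k by (rule reflect)
  have *: "\<not> A i 0 \<and> \<not> A i l \<and> (W (Suc l) \<longrightarrow> \<not> A i (Suc l)) \<and> (W (n - 1) \<longrightarrow> \<not> A i (n - 1))"
    using xy
  proof
    assume "\<forall>i<k. \<not> A i l"
    then show ?thesis using no_contact_aux[OF sp _ i] by blast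
  next
    assume "\<forall>i<k. \<not> A i 0"
    then have "\<And>i. i < k \<Longrightarrow> \<not> R.A i l" by (simp add: reflect_simps)
    from R.no_contact_aux[OF spread_reflect[OF sp] this i] show ?thesis by (simp add: reflect_simps)
  qed
  then show "\<not> A i 0" "\<not> A i l" "W (Suc l) \<Longrightarrow> \<not> A i (Suc l)" "W (n - 1) \<Longrightarrow> \<not> A i (n - 1)" by auto
qed

text \<open>Now \<open>p 0\<close> sees only inner vertices of the sector, \<open>p (k - 1)\<close>
  only vertices outside the extended neighborhood, and the rest of P nothing on H. The feet would be
  adjacent, but an inner vertex of the sector has no neighbour beyond \<open>h l\<close>.\<close>

lemma no_contact_long:
  assumes sp: spread and xy: "(\<forall>i<k. \<not> A i l) \<or> (\<forall>i<k. \<not> A i 0)" and k: "2 \<le> k"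
  shows False
proof -
  have A: "Rok b" "i = k - 1" if "A i b" "i < k" "b < n" "l \<le> b" for i b
  proof -
    have "b \<noteq> l" using no_contact(2)[OF sp xy] that by auto
    then have "l < b" using that by simp
    show "Rok b"
    proof (rule ccontr)
      assume "\<not> Rok b"
      with not_Rok[OF \<open>l < b\<close> \<open>b < n\<close>] have "(b = Suc l \<or> b = n - 1) \<and> W b" by auto
      then show False using no_contact[OF sp xy \<open>i < k\<close>] that by auto
    qed
    then show "i = k - 1" using not_A_far[of i b] that by (cases "Suc i < k") auto
  qed
  have B: "i = 0" "0 < b" if "A i b" "i < k" "b < n" "b \<le> l" for i b
  proof -
    have b: "b \<noteq> 0" "b \<noteq> l" using no_contact(1,2)[OF sp xy that(2)] that by metis+
    then show "0 < b" by simp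
    then show "i = 0" using not_A_sector[of i b] that b by (cases "i = 0") auto
  qed
  obtain a where a: "0 < a" "a < l" "A 0 a" using A_sector by blast
  obtain c d where "c \<le> l" "l < d" "d < n" "E (h c) (h d)" and c: "\<And>b. b < n \<Longrightarrow> A 0 b \<longleftrightarrow> b = c"
  proof (rule p_to_ring[OF k, of l])
    show "b \<le> l" if "b < n" "A 0 b" for b using A(2)[OF that(2) _ that(1)] k k0 by (cases "l \<le> b") auto
    show "l < b" if "b < n" "A (k - 1) b" for b using B(1)[OF that(2) _ that(1)] k k0 by (cases "l < b") auto
    show "\<not> A i b" if "0 < i" "Suc i < k" "b < n" for i b
      using A(2)[of i b] B(1)[of i b] that by (cases "b \<le> l") auto
  qed (use ln in auto)
  moreover have "c = a" using c[of a] a ln by auto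
  ultimately show False using a ln by (auto simp: hE)
qed

text \<open>A contact strictly between \<open>h (Suc l)\<close> and \<open>h (n - 1)\<close> could
  be continued along H to a neighbour of \<open>w\<close>, against \<open>no_sector_to_w\<close>. If
  \<open>h (Suc l)\<close> is missed as well, only \<open>h (n - 1)\<close> remains, and the hole
  from \<open>h v\<close> to \<open>h (n - 1)\<close> contains two neighbours of \<open>w\<close>,
  namely \<open>h l\<close> and \<open>h c\<close>.\<close>

lemma no_contact_short_ends:
  assumes xy: "\<not> A 0 0" "\<not> A 0 l" and k: "k = 1" and c: "Suc l < c" "Suc c < n" "W c"
  shows "Suc l < r \<Longrightarrow> Suc r < n \<Longrightarrow> \<not> A 0 r" "A 0 (Suc l)"
proof -
  show no: "\<not> A 0 r" if r: "Suc l < r" "Suc r < n" for r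
  proof
    assume "A 0 r"
    have k1: "k - 1 = 0" using k by simp
    have "A (k - 1) r" using \<open>A 0 r\<close> k1 by simp
    from connect[OF this r c(3,1,2), unfolded k1]
    obtain G where G0: "ipath V E G" "\<forall>t\<in>set G. (\<exists>a>Suc l. Suc a < n \<and> t = h a) \<and> (E (p 0) t \<longleftrightarrow> t = hd G) \<and> (E w t \<longleftrightarrow> t = last G)"
      by blast
    then have G: "ipath V E G" "\<And>t. t \<in> set G \<Longrightarrow> \<exists>a. Suc l < a \<and> Suc a < n \<and> t = h a"
      "\<And>t. t \<in> set G \<Longrightarrow> E (p 0) t \<longleftrightarrow> t = hd G" "\<And>t. t \<in> set G \<Longrightarrow> E w t \<longleftrightarrow> t = last G" by blast+
    have n: "G \<noteq> []" using G by auto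
    have hq: "\<not> E t (h a)" "t \<noteq> h a" if t: "t \<in> set G" and a: "a \<le> l" for t a
    proof -
      obtain x where "Suc l < x" "Suc x < n" "t = h x" using G(2)[OF t] by blast
      then show "\<not> E t (h a)" "t \<noteq> h a" using a hE[of x a] heq[of x a] by auto
    qed
    have Gp: "t \<noteq> p 0" "t \<noteq> w" if t: "t \<in> set G" for t
    proof -
      obtain x where "Suc x < n" "t = h x" using G(2)[OF t] by blast
      then show "t \<noteq> p 0" "t \<noteq> w" using ph[OF k0, of x] wh[of x] by auto
    qed
    have F: "ipath V E ([p 0] @ G)"
      by (rule ipath_append[OF _ G(1)]) (use G(3) Gp(1) in \<open>auto simp: ipath_single pV k0\<close>)
    obtain a where a: "0 < a" "a < l" "A 0 a" using A_sector by blast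
    show False
    proof (rule no_sector_to_w[OF F])
      show "2 \<le> length ([p 0] @ G)" using n by (cases G) auto
      show "E (last ([p 0] @ G)) w" using G(4)[of "last G"] n E_sym by auto
      show "\<not> E (last ([p 0] @ G)) (h a)" if "0 < a" "a < l" for a using hq[of "last G" a] n that by auto
      show "\<exists>a>0. a < l \<and> E (hd ([p 0] @ G)) (h a)" using a by (auto simp: base)
      show "\<not> E t w" if "t \<in> set ([p 0] @ G)" "t \<noteq> hd ([p 0] @ G)" "t \<noteq> last ([p 0] @ G)" for t
        using G(4)[of t] that n E_sym by auto
      show "t \<noteq> h a" if "t \<in> set ([p 0] @ G)" "a \<le> l" for t a using that hq(2)[of t a] ph[OF k0, of a] ln by auto
      show "t \<noteq> w" if "t \<in> set ([p 0] @ G)" for t using that Gp(2)[of t] pw[OF k0] by auto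
      show "\<not> E t (h a)" if "t \<in> set ([p 0] @ G)" "t \<noteq> hd ([p 0] @ G)" "t \<noteq> last ([p 0] @ G)" "a \<le> l" for t a
        using that hq(1)[of t a] by auto
    qed (use xy k0 in \<open>auto simp: EA wp'\<close>)
  qed
  show "A 0 (Suc l)"
  proof (rule ccontr)
    assume n: "\<not> A 0 (Suc l)"
    obtain b where b: "Rok b" "A (k - 1) b" using A_far by blast
    then have "l < b" "b < n" by (auto simp: Rok_def)
    have Ab: "A 0 b" using b(2) k by simp
    have "b \<noteq> Suc l" using Ab n by blast
    then have "\<not> Suc b < n" using no[of b] Ab \<open>l < b\<close> by (metis Suc_lessI)
    then have "b = n - 1" using \<open>b < n\<close> by simp
    then have b1: "b = n - 1" "A 0 (n - 1)" using Ab by auto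
    have b2: "\<not> W (n - 1)" using b(1) b1(1) ln unfolding Rok_def by simp
    obtain v where v: "0 < v" "v < l" "A 0 v" "\<And>a. v < a \<Longrightarrow> a < l \<Longrightarrow> \<not> A 0 a" using last_contact by blast
    have link: "\<forall>i t. 0 \<le> i \<longrightarrow> i \<le> 0 \<longrightarrow> v \<le> t \<longrightarrow> t \<le> n - 1 \<longrightarrow> (A i t \<longleftrightarrow> (i = 0 \<and> t = v) \<or> (i = 0 \<and> t = n - 1))"
    proof (intro allI impI)
      fix i t :: nat assume b: "0 \<le> i" "i \<le> 0" "v \<le> t" "t \<le> n - 1"
      have "t < l \<or> t = l \<or> t = Suc l \<or> (Suc l < t \<and> t < n - 1) \<or> t = n - 1" using b by linarith
      then consider "t < l" | "t = l" | "t = Suc l" | "Suc l < t" "t < n - 1" | "t = n - 1" by blast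
      then show "A i t \<longleftrightarrow> (i = 0 \<and> t = v) \<or> (i = 0 \<and> t = n - 1)"
      proof cases
        case 1
        then have "A 0 t \<longleftrightarrow> t = v" using v(3) v(4)[of t] b(3) by (cases "t = v") simp_all
        moreover have "t \<noteq> n - 1" using 1 ln by linarith
        ultimately show ?thesis using b(2) by simp
      next
        case 2 then show ?thesis using xy(2) b(2) v(2) ln by simp
      next
        case 3 then show ?thesis using n b(2) v(2) ln by simp
      next
        case 4 then show ?thesis using no[of t] b(2) v(2) by simp
      next
        case 5 then show ?thesis using b1(2) b(2) by simp
      qed
    qed
    have 1: "0 < v \<and> v < n - 1 \<and> n - 1 < n \<and> 0 \<le> (0::nat) \<and> 0 < k \<and> v + 2 \<le> 0 - 0 + (n - 1)" using v(1,2) ln k0 by linarith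
    have 2: "\<exists>t\<ge>v. t \<le> n - 1 \<and> W t" using c v(2) by (intro exI[of _ c]) simp
    have 3: "Suc (n - 1) = n \<longrightarrow> \<not> W (n - 1)" using b2 by simp
    have 4: "(\<exists>i. 0 \<le> i \<and> i \<le> 0 \<and> A i 0) \<or> v = 1 \<or> Suc (n - 1) = n" using ln by simp
    obtain d where d: "\<forall>t. v \<le> t \<longrightarrow> t \<le> n - 1 \<longrightarrow> W t \<longrightarrow> t = d"
      using contact_pair[OF 1 link 3 2 4] by (elim exE conjE) (rule that)
    have "l \<le> n - 1" "c \<le> n - 1" "v \<le> l" "v \<le> c" using ln c v(2) by linarith+
    then have "l = d" "c = d" using d[rule_format, of l] d[rule_format, of c] c(3) Wl by blast+
    then show False using c(1) by simp
  qed
qed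

text \<open>On the hole \<open>p 0\<close>, \<open>h (Suc l)\<close>, ..., \<open>h (n - 1)\<close>
  the foot of \<open>h 0\<close> is \<open>h (n - 1)\<close> and the foot of \<open>w\<close> is
  \<open>h c\<close>.\<close>

lemma no_contact_short_right:
  assumes xy: "A 0 (Suc l)" "A 0 (n - 1)" and nW: "\<not> W (n - 1)"
    and no: "\<And>r. Suc l < r \<Longrightarrow> Suc r < n \<Longrightarrow> \<not> A 0 r" and c: "Suc l < c" "Suc c < n" "W c"
  shows "Suc c = n - 1"
proof -
  have link: "\<forall>i t. 0 \<le> i \<longrightarrow> i \<le> 0 \<longrightarrow> Suc l \<le> t \<longrightarrow> t \<le> n - 1 \<longrightarrow> (A i t \<longleftrightarrow> (i = 0 \<and> t = Suc l) \<or> (i = 0 \<and> t = n - 1))"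
  proof (intro allI impI)
    fix i t :: nat assume b: "0 \<le> i" "i \<le> 0" "Suc l \<le> t" "t \<le> n - 1"
    show "A i t \<longleftrightarrow> (i = 0 \<and> t = Suc l) \<or> (i = 0 \<and> t = n - 1)"
      using b xy no[of t] by (cases "t = Suc l"; cases "t = n - 1") auto
  qed
  have 1: "0 < Suc l \<and> Suc l < n - 1 \<and> n - 1 < n \<and> 0 \<le> (0::nat) \<and> 0 < k \<and> Suc l + 2 \<le> 0 - 0 + (n - 1)" using c k0 by linarith
  have 2: "\<exists>t\<ge>Suc l. t \<le> n - 1 \<and> W t" using c by (intro exI[of _ c]) simp
  have 3: "Suc (n - 1) = n" using ln by simp
  have 4: "Suc (n - 1) = n \<longrightarrow> \<not> W (n - 1)" using nW by simp
  have 5: "(\<exists>i. 0 \<le> i \<and> i \<le> 0 \<and> A i 0) \<or> Suc l = 1 \<or> Suc (n - 1) = n" using 3 by simp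
  obtain e d where d: "d \<le> n - 1" "Suc l \<le> d" "\<forall>t. Suc l \<le> t \<longrightarrow> t \<le> n - 1 \<longrightarrow> W t \<longrightarrow> t = d" "E e (h d)" "Suc (n - 1) = n \<longrightarrow> e = h (n - 1)"
    using contact_pair[OF 1 link 4 2 5] by (elim exE conjE) (rule that)
  have "c = d" using d(3)[rule_format, of c] c by simp
  moreover have "E (h (n - 1)) (h d)" using d(4,5) 3 by simp
  ultimately show ?thesis using hE[of "n - 1" d] c by auto
qed

text \<open>Rigidity for the hole \<open>p 0\<close>, \<open>h v\<close>, ..., \<open>h s\<close>
  and the path \<open>w\<close>, \<open>h 0\<close>, ..., \<open>h u'\<close>. The path stops at the
  first neighbour of \<open>p 0\<close>, or just before \<open>h v\<close> if there is none earlier,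
  so its last vertex sees nothing of the hole but \<open>p 0\<close> or \<open>h v\<close>.\<close>

lemma stem_contacts:
  assumes v: "0 < v" "v < l" and s: "l < s" "Suc s < n" and u': "u' < v" and A: "A 0 v" "A 0 s"
    and no: "\<And>t. v < t \<Longrightarrow> t < s \<Longrightarrow> \<not> A 0 t" and u0: "\<And>t. t < u' \<Longrightarrow> \<not> A 0 t" and u1: "A 0 u' \<or> Suc u' = v"
    and Wt: "\<exists>t. v < t \<and> t \<le> s \<and> W t"
  obtains c d where "v < c" "c \<le> s" "\<forall>t. v < t \<longrightarrow> t \<le> s \<longrightarrow> W t \<longrightarrow> t = c" "W c" "E (h c) d"
    "E (h u') (p 0) \<longrightarrow> d = p 0" "E (h u') (h v) \<longrightarrow> d = h v"
proof -
  have "hole V E (walk p 0 0 @ walk h v s)"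
  proof (rule hole_ph[OF k0 k0])
    fix i t assume "min 0 0 \<le> i" "i \<le> max 0 (0::nat)" "min v s \<le> t" "t \<le> max v s"
    then have b: "i = 0" "v \<le> t" "t \<le> s" using v s by auto
    then have "t = v \<or> (v < t \<and> t < s) \<or> t = s" by linarith
    then show "A i t \<longleftrightarrow> (i = 0 \<and> t = v) \<or> (i = 0 \<and> t = s)"
      using A no[of t] b(1) by auto
  qed (use v s in auto)
  moreover have "walk p 0 0 @ walk h v s = [p 0, h v] @ map h [Suc v..<Suc s]"
    using v(2) s by (simp add: walk_def upt_conv_Cons del: upt_Suc)
  ultimately have Z: "hole V E (map h [Suc v..<Suc s] @ [p 0, h v])" using hole_swap by metis
  have sB: "x = p 0 \<or> (\<exists>t. v \<le> t \<and> t \<le> s \<and> x = h t)" if x: "x \<in> set (map h [Suc v..<Suc s] @ [p 0, h v])" for x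
  proof -
    have "x \<in> h ` {Suc v..<Suc s} \<or> x = p 0 \<or> x = h v" using x by (auto simp del: upt_Suc)
    then show ?thesis
    proof (elim disjE imageE)
      fix t assume "x = h t" "t \<in> {Suc v..<Suc s}"
      then show ?thesis by (intro disjI2 exI[of _ t]) auto
    next
      assume "x = h v" then show ?thesis using v(2) s by (intro disjI2 exI[of _ v]) auto
    qed auto
  qed
  have wt: "W t \<longleftrightarrow> t = 0" if "t < l" for t using WQ[of t] W0 that by (cases "t = 0") auto
  have F: "ipath V E ([w] @ walk h 0 u')"
  proof (rule ipath_append[OF ipath_single[OF wV] ipath_h])
    show "set [w] \<inter> set (walk h 0 u') = {}" using u' v(2) s ln by (auto simp: whp)
    show "E a b \<longleftrightarrow> a = last [w] \<and> b = hd (walk h 0 u')" if ab: "a \<in> set [w]" "b \<in> set (walk h 0 u')" for a b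
    proof -
      obtain t where "b = h t" "t \<le> u'" using ab(2) by (auto elim!: walk_cases)
      then show ?thesis using ab(1) wt[of t] heq[of t 0] u' v(2) s ln by (auto simp: EW)
    qed
  qed (use u' v(2) s ln in auto)
  have R: "\<exists>c\<in>set (map h [Suc v..<Suc s]). \<exists>d\<in>set [p 0, h v]. E c d \<and> (\<forall>z\<in>set (map h [Suc v..<Suc s]). E (hd ([w] @ walk h 0 u')) z \<longleftrightarrow> z = c)
    \<and> (\<forall>z\<in>set [p 0, h v]. E (last ([w] @ walk h 0 u')) z \<longleftrightarrow> z = d)"
  proof (rule two_feet[OF Z F])
    show "2 \<le> length ([w] @ walk h 0 u')" by simp
    show "set ([w] @ walk h 0 u') \<inter> set (map h [Suc v..<Suc s] @ [p 0, h v]) = {}"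
    proof (intro equals0I, elim IntE)
      fix x assume x: "x \<in> set ([w] @ walk h 0 u')" "x \<in> set (map h [Suc v..<Suc s] @ [p 0, h v])"
      have "x = w \<or> (\<exists>t\<le>u'. x = h t)" using x(1) by (auto elim!: walk_cases)
      then show False using sB[OF x(2)]
      proof (elim disjE exE conjE)
        fix t r assume "t \<le> u'" "x = h t" "v \<le> r" "r \<le> s" "x = h r"
        then show False using u' heq[of t r] v(2) s by simp
      next
        fix t assume "t \<le> u'" "x = h t" "x = p 0"
        then show False using ph[OF k0, of t] u' v(2) ln by simp
      next
        fix r assume "x = w" "r \<le> s" "x = h r"
        then show False using wh[of r] s by simp
      qed (use pw[OF k0] in simp)
    qed
    show "\<exists>a\<in>set (map h [Suc v..<Suc s]). E (hd ([w] @ walk h 0 u')) a"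
    proof -
      obtain t where "v < t" "t \<le> s" "W t" using Wt by blast
      then show ?thesis by (intro bexI[of _ "h t"]) (auto simp: EW simp del: upt_Suc)
    qed
    show "\<forall>b\<in>set [p 0, h v]. \<not> E (hd ([w] @ walk h 0 u')) b" using wp[OF k0] wQ[OF v(1,2)] by simp
    show "\<exists>b\<in>set [p 0, h v]. E (last ([w] @ walk h 0 u')) b"
      using u1 hE[of u' v] u' v(2) ln by (auto simp: EA)
    show "\<forall>a\<in>set (map h [Suc v..<Suc s]). \<not> E (last ([w] @ walk h 0 u')) a"
    proof
      fix x assume "x \<in> set (map h [Suc v..<Suc s])"
      then obtain t where "x = h t" "v < t" "t \<le> s" by (auto simp del: upt_Suc)
      then show "\<not> E (last ([w] @ walk h 0 u')) x" using u' v(2) s ln hE[of u' t] by auto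
    qed
    show "\<forall>t\<in>set ([w] @ walk h 0 u'). t \<noteq> hd ([w] @ walk h 0 u') \<longrightarrow> t \<noteq> last ([w] @ walk h 0 u') \<longrightarrow>
      (\<forall>z\<in>set (map h [Suc v..<Suc s] @ [p 0, h v]). \<not> E t z)"
    proof (intro ballI impI)
      fix x z assume x: "x \<in> set ([w] @ walk h 0 u')" "x \<noteq> hd ([w] @ walk h 0 u')" "x \<noteq> last ([w] @ walk h 0 u')"
        and z: "z \<in> set (map h [Suc v..<Suc s] @ [p 0, h v])"
      obtain t where t: "x = h t" "t \<le> u'" using x by (auto elim!: walk_cases)
      then have t': "t < u'" using x(3) by (cases "t = u'") auto
      show "\<not> E x z" using sB[OF z]
      proof (elim disjE exE conjE)
        assume "z = p 0" then show ?thesis using u0[OF t'] t by (simp add: EA)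
      next
        fix r assume "v \<le> r" "r \<le> s" "z = h r"
        then show ?thesis using t t' u' v(2) s ln hE[of t r] by auto
      qed
    qed
  qed
  then obtain c d where c: "c \<in> set (map h [Suc v..<Suc s])" "E c d"
    and cB: "\<forall>z\<in>set (map h [Suc v..<Suc s]). E w z \<longleftrightarrow> z = c" and d: "\<forall>z\<in>{p 0, h v}. E (h u') z \<longleftrightarrow> z = d"
    by (auto simp del: upt_Suc set_map)
  obtain c' where c': "c = h c'" "v < c'" "c' \<le> s" using c(1) by (auto simp del: upt_Suc)
  show thesis
  proof (rule that[of c' d])
    have W: "W t \<longleftrightarrow> t = c'" if "v < t" "t \<le> s" for t
    proof -
      have "h t \<in> set (map h [Suc v..<Suc s])" using that by (auto simp del: upt_Suc)
      then show ?thesis using cB[rule_format, of "h t"] c' heq[of t c'] that s by (simp add: EW)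
    qed
    then show "\<forall>t. v < t \<longrightarrow> t \<le> s \<longrightarrow> W t \<longrightarrow> t = c'" "W c'" using c'(2,3) by blast+
    show "E (h u') (p 0) \<longrightarrow> d = p 0" "E (h u') (h v) \<longrightarrow> d = h v" using d by auto
  qed (use c c' in auto)
qed

text \<open>With \<open>s = Suc l\<close> the foot of \<open>w\<close> is \<open>h l\<close>. Two
  contacts inside the sector would make \<open>p 0\<close> the other foot, although it misses
  \<open>h l\<close>. So the contact is unique; it is then the other foot and hence next to
  \<open>h l\<close>.\<close>

lemma no_contact_short_left:
  assumes xy: "A 0 (Suc l)" "\<not> A 0 0" "\<not> A 0 l" and nW: "\<not> W (Suc l)" and a: "0 < a" "a < l" "A 0 a"
  shows "Suc a = l"
proof -
  obtain v where v: "0 < v" "v < l" "A 0 v" "\<And>a. v < a \<Longrightarrow> a < l \<Longrightarrow> \<not> A 0 a" using last_contact by blast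
  define u where "u = (LEAST a. 0 < a \<and> A 0 a)"
  have u: "0 < u" "A 0 u" "u \<le> a" "u \<le> v"
    using LeastI[of "\<lambda>a. 0 < a \<and> A 0 a" a] Least_le[of "\<lambda>a. 0 < a \<and> A 0 a" a] Least_le[of "\<lambda>a. 0 < a \<and> A 0 a" v] a v(1,3)
    unfolding u_def by simp_all
  have u2: "\<not> A 0 t" if "t < u" for t using not_less_Least[of t "\<lambda>a. 0 < a \<and> A 0 a"] that xy(2) unfolding u_def
    by (cases "t = 0") auto
  have av: "a \<le> v" using v(4)[of a] a by (cases "a \<le> v") auto
  define u' where "u' = (if u = v then u - 1 else u)"
  have u': "u' < v" using u unfolding u'_def by auto
  have uu: "\<not> A 0 t" if "t < u'" for t using u2[of t] that unfolding u'_def by (auto split: if_splits)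
  have nt: "\<not> A 0 t" if "v < t" "t < Suc l" for t using v(4)[of t] xy(3) that by (cases "t = l") auto
  have u1: "A 0 u' \<or> Suc u' = v" using u v(1) unfolding u'_def by auto
  have s: "l < Suc l" "Suc (Suc l) < n" using ln by auto
  have Wt: "\<exists>t>v. t \<le> Suc l \<and> W t" using v(2) Wl by (intro exI[of _ l]) simp
  obtain c d where c: "v < c" "c \<le> Suc l" "\<forall>t. v < t \<longrightarrow> t \<le> Suc l \<longrightarrow> W t \<longrightarrow> t = c" "E (h c) d"
    and d: "E (h u') (p 0) \<longrightarrow> d = p 0" "E (h u') (h v) \<longrightarrow> d = h v"
    by (rule stem_contacts[OF v(1,2) s u' v(3) xy(1) nt uu u1 Wt]) (assumption | rule that)+
  have "l = c" using c(3)[rule_format, of l] v(2) Wl by simp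
  have uv: "u = v"
  proof (rule ccontr)
    assume "u \<noteq> v"
    then have "d = p 0" using u d(1) unfolding u'_def by (simp add: EA)
    then show False using c(4) \<open>l = c\<close> xy by (simp add: EA)
  qed
  then have "E (h u') (h v)" using v(1,2) ln hE[of "v - 1" v] unfolding u'_def by simp
  then have "E (h l) (h v)" using d(2) c(4) \<open>l = c\<close> by simp
  then have "Suc v = l" using hE[of l v] v(1,2) ln by auto
  then show ?thesis using uv u av by simp
qed

text \<open>The only use of the length bound: for n = 6 the hole, w and p 0 may induce a cube.\<close>

lemma no_contact_short:
  assumes n: "n > 6" and xy: "\<not> A 0 0" "\<not> A 0 l" and k: "k = 1" and c: "Suc l < c" "Suc c < n" "W c"
    and W: "W (Suc l) \<Longrightarrow> \<not> A 0 (Suc l)" "W (n - 1) \<Longrightarrow> \<not> A 0 (n - 1)"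
  shows False
proof -
  interpret R: sector_path V E "\<lambda>i. h (mirror i)" n l w p k by (rule reflect)
  note 1 = no_contact_short_ends[OF xy k c]
  let ?c = "n + l - c"
  have c': "Suc l < ?c" "Suc ?c < n" using c by auto
  have cW: "R.W ?c" using c by (auto simp: reflect_simps)
  have xy': "\<not> R.A 0 0" "\<not> R.A 0 l" using xy by (simp_all add: reflect_simps)
  note 2 = R.no_contact_short_ends[OF xy' k c' cW]
  have A: "A 0 (Suc l)" "A 0 (n - 1)" using 1(2) 2(2) by (simp_all add: reflect_simps)
  then have nW: "\<not> W (Suc l)" "\<not> W (n - 1)" using W by auto
  have A': "R.A 0 (Suc l)" "R.A 0 (n - 1)" "\<not> R.W (n - 1)" "\<not> R.W (Suc l)"
    using A nW by (simp_all add: reflect_simps)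
  \<comment> \<open>\<open>h c\<close> is next to \<open>h (n - 1)\<close> and, by the mirror image,
    next to \<open>h (Suc l)\<close>.\<close>
  have "Suc c = n - 1" using no_contact_short_right[OF A nW(2) 1(1) c] by blast
  moreover have "Suc ?c = n - 1" using R.no_contact_short_right[OF A'(1,2,3) 2(1) c' cW] by blast
  ultimately have nl: "n = l + 4" using c by linarith
  obtain a where a: "0 < a" "a < l" "A 0 a" using A_sector by blast
  \<comment> \<open>The contact inside the sector is next to both ends, so \<open>l = 2\<close> and
    \<open>n = 6\<close>.\<close>
  have 3: "Suc a = l" by (rule no_contact_short_left[OF A(1) xy nW(1) a])
  have "R.A 0 (l - a)" using a by (simp add: reflect_simps)
  then have "Suc (l - a) = l" by (intro R.no_contact_short_left[OF A'(1) xy' A'(4)]) (use a in auto)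
  then show False using 3 nl n a by linarith
qed

section \<open>Paths with contacts to both ends of the sector\<close>

text \<open>Let \<open>p m\<close> be the first vertex that sees \<open>h l\<close>. On the hole
  formed by \<open>p 0\<close>, ..., \<open>p m\<close> and the stretch from \<open>h v\<close> to
  \<open>h l\<close>, the foot of \<open>w\<close> is \<open>h l\<close> and the foot of
  \<open>h 0\<close> is \<open>p 0\<close>, so \<open>p 0\<close> would see
  \<open>h l\<close>.\<close>

lemma no_lone_contact:
  assumes "A 0 0" "\<not> A 0 l" "j < k" "A j l"
  shows False
proof -
  obtain v where v: "0 < v" "v < l" "A 0 v" "\<And>a. v < a \<Longrightarrow> a < l \<Longrightarrow> \<not> A 0 a" using last_contact by blast
  define m where "m = (LEAST j. A j l)"
  have m: "A m l" "m \<le> j" unfolding m_def using LeastI[of "\<lambda>j. A j l" j, OF assms(4)] Least_le[of "\<lambda>j. A j l" j, OF assms(4)] .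
  have m3: "\<not> A i l" if "i < m" for i using not_less_Least[of i "\<lambda>j. A j l"] that unfolding m_def .
  have m0: "0 < m" using m(1) assms(2) by (cases m) auto
  have link: "\<forall>i t. 0 \<le> i \<longrightarrow> i \<le> m \<longrightarrow> v \<le> t \<longrightarrow> t \<le> l \<longrightarrow> (A i t \<longleftrightarrow> (i = 0 \<and> t = v) \<or> (i = m \<and> t = l))"
  proof (intro allI impI)
    fix i t assume b: "0 \<le> i" "i \<le> m" "v \<le> t" "t \<le> l"
    show "A i t \<longleftrightarrow> (i = 0 \<and> t = v) \<or> (i = m \<and> t = l)"
    proof (cases "t = l")
      case True
      then show ?thesis using m(1) m3[of i] b(2) v(2) by (cases "i = m") simp_all
    next
      case tl: False
      show ?thesis
      proof (cases "i = 0")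
        case True
        then show ?thesis using v(3) v(4)[of t] tl b(3,4) by (cases "t = v") simp_all
      next
        case False
        then show ?thesis using not_A_sector[of i t] tl b v(1) m(2) assms(3) by simp
      qed
    qed
  qed
  have 1: "0 < v \<and> v < l \<and> l < n \<and> 0 \<le> m \<and> m < k \<and> v + 2 \<le> m - 0 + l" using v(1,2) m(2) m0 assms(3) ln by linarith
  have 2: "\<exists>t\<ge>v. t \<le> l \<and> W t" using Wl v(2) by (intro exI[of _ l]) simp
  have 3: "(\<exists>i. 0 \<le> i \<and> i \<le> m \<and> A i 0) \<or> v = 1 \<or> Suc l = n" using assms(1) by blast
  have 4: "Suc l = n \<longrightarrow> \<not> W l" using ln by simp
  obtain c d where d: "\<forall>t. v \<le> t \<longrightarrow> t \<le> l \<longrightarrow> W t \<longrightarrow> t = d" "E c (h d)" "\<forall>i. 0 \<le> i \<longrightarrow> i \<le> m \<longrightarrow> A i 0 \<longrightarrow> c = p i"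
    using contact_pair[OF 1 link 4 2 3] by (elim exE conjE) (rule that)
  have "d = l" using d(1)[rule_format, of l] Wl v(2) by simp
  moreover have "c = p 0" using d(3) assms(1) by simp
  ultimately show False using d(2) assms(2) by (simp add: EA)
qed

text \<open>By \<open>not_both_sides\<close> one of the two contacts belongs to \<open>p 0\<close>;
  \<open>no_lone_contact\<close> or its mirror image then adds the other end.\<close>

lemma both_p0:
  assumes "i < k" "A i 0" "j < k" "A j l"
  shows "A 0 0" "A 0 l" "(\<forall>i. 0 < i \<longrightarrow> i < k \<longrightarrow> \<not> A i l) \<or> (\<forall>i. 0 < i \<longrightarrow> i < k \<longrightarrow> \<not> A i 0)"
proof -
  interpret R: sector_path V E "\<lambda>i. h (mirror i)" n l w p k by (rule reflect)
  have b: "A 0 l" if "A 0 0" using no_lone_contact[OF that _ assms(3,4)] by blast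
  have b': "A 0 0" if "A 0 l" using R.no_lone_contact[of i] that assms(1,2) by (auto simp: reflect_simps)
  have "A 0 0 \<or> A 0 l" using not_both_sides[of i j] assms by (cases "i = 0"; cases "j = 0") auto
  then show "A 0 0" "A 0 l" using b b' by auto
  show "(\<forall>i. 0 < i \<longrightarrow> i < k \<longrightarrow> \<not> A i l) \<or> (\<forall>i. 0 < i \<longrightarrow> i < k \<longrightarrow> \<not> A i 0)" using not_both_sides by blast
qed

text \<open>Otherwise the rest of P and a stretch of H given by \<open>connect\<close> lead from
  \<open>p 0\<close> to \<open>w\<close> while avoiding the neighbourhoods of \<open>h 0\<close> and
  \<open>h l\<close>, against \<open>no_p0_to_w\<close>.\<close>

lemma both_no_mid:
  assumes A: "A 0 0" "A 0 l" and no: "\<And>i. 0 < i \<Longrightarrow> i < k \<Longrightarrow> \<not> A i 0 \<and> \<not> A i l"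
    and c: "Suc l < c" "Suc c < n" "W c" and r: "Suc l < r" "Suc r < n"
  shows "\<not> A (k - 1) r"
proof
  assume "A (k - 1) r"
  from connect[OF this r c(3,1,2)]
  obtain G where G0: "ipath V E G" "\<forall>t\<in>set G. (\<exists>a>Suc l. Suc a < n \<and> t = h a) \<and> (E (p (k - 1)) t \<longleftrightarrow> t = hd G) \<and> (E w t \<longleftrightarrow> t = last G)"
    by blast
  then have G: "ipath V E G" "\<And>t. t \<in> set G \<Longrightarrow> \<exists>a. Suc l < a \<and> Suc a < n \<and> t = h a"
    "\<And>t. t \<in> set G \<Longrightarrow> E (p (k - 1)) t \<longleftrightarrow> t = hd G" "\<And>t. t \<in> set G \<Longrightarrow> E w t \<longleftrightarrow> t = last G" by blast+
  have n: "G \<noteq> []" using G(1) by auto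
  have Gx: "\<not> E (h 0) t" "\<not> E (h l) t" "t \<noteq> w" "t \<noteq> h 0" "t \<noteq> h l" "\<And>i. i < k \<Longrightarrow> t \<noteq> p i" "\<And>i. Suc i < k \<Longrightarrow> \<not> E (p i) t"
    if t: "t \<in> set G" for t
  proof -
    obtain a where a: "Suc l < a" "Suc a < n" "t = h a" using G(2)[OF t] by blast
    then show "\<not> E (h 0) t" "\<not> E (h l) t" "t \<noteq> h 0" "t \<noteq> h l"
      using hE[of 0 a] hE[of l a] heq[of a 0] heq[of a l] ln by auto
    show "t \<noteq> w" using wh[of a] a by simp
    show "t \<noteq> p i" if "i < k" for i using ph[OF that, of a] a by simp
    show "\<not> E (p i) t" if "Suc i < k" for i using not_A_far[OF that Rok_mid[OF a(1,2)]] a(3) by (simp add: A_def)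
  qed
  show False
  proof (cases "k = 1")
    case True
    then have k1: "k - 1 = 0" by simp
    show False
      by (rule no_p0_to_w[OF A G(1)]) (use Gx(1-5) Gx(6)[of _ 0] k0 G(3)[unfolded k1] G(4) in blast)+
  next
    case False
    then have k2: "1 < k" using k0 by simp
    have wk: "\<exists>i. 0 < i \<and> i < k \<and> t = p i" if t: "t \<in> set (walk p 1 (k - 1))" for t
    proof -
      obtain i where "t = p i" "min 1 (k - 1) \<le> i" "i \<le> max 1 (k - 1)" using t by (rule walk_cases)
      then show ?thesis using k2 by (intro exI[of _ i]) auto
    qed
    have k1: "k - 1 < k" "1 < k" using k2 by auto
    have pk: "E (p i) t \<longleftrightarrow> p i = p (k - 1) \<and> t = hd G" if "i < k" "t \<in> set G" for i t
    proof (cases "i = k - 1")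
      case True
      then show ?thesis using G(3)[OF that(2)] by simp
    next
      case False
      then have "Suc i < k" "p i \<noteq> p (k - 1)" using that(1) peq[OF that(1) k1(1)] by auto
      then show ?thesis using Gx(7)[OF that(2)] by simp
    qed
    have F: "ipath V E (walk p 1 (k - 1) @ G)"
    proof (rule ipath_append[OF ipath_p G(1)])
      show "set (walk p 1 (k - 1)) \<inter> set G = {}"
      proof (intro equals0I, elim IntE)
        fix t assume "t \<in> set (walk p 1 (k - 1))" "t \<in> set G"
        then show False using wk[of t] Gx(6)[of t] by blast
      qed
      show "E a b \<longleftrightarrow> a = last (walk p 1 (k - 1)) \<and> b = hd G" if ab: "a \<in> set (walk p 1 (k - 1))" "b \<in> set G" for a b
      proof -
        obtain i where "i < k" "a = p i" using wk[OF ab(1)] by blast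
        then show ?thesis using pk[of i b] ab(2) by simp
      qed
    qed (use k1 in auto)
    have Fx: "t \<in> set G \<or> (\<exists>i. 0 < i \<and> i < k \<and> t = p i)" if t: "t \<in> set (walk p 1 (k - 1) @ G)" for t
      using t wk[of t] by (auto simp del: set_walk)
    have lF: "last (walk p 1 (k - 1) @ G) = last G" "hd (walk p 1 (k - 1) @ G) = p 1" using n by simp_all
    have lG: "last G \<in> set G" using n by simp
    show False
    proof (rule no_p0_to_w[OF A F])
      fix t assume "t \<in> set (walk p 1 (k - 1) @ G)"
      then consider "t \<in> set G" | i where "0 < i" "i < k" "t = p i" using Fx by blast
      note cs = this
      show "t \<noteq> w \<and> t \<noteq> h 0 \<and> t \<noteq> h l \<and> t \<noteq> p 0" using cs
      proof cases
        case 1 then show ?thesis using Gx(3-5)[OF 1] Gx(6)[OF 1 k0] by simp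
      next
        case 2 then show ?thesis using pw[of i] ph[of i 0] ph[of i l] peq[of i 0] k0 ln by simp
      qed
      show "E (p 0) t \<longleftrightarrow> t = hd (walk p 1 (k - 1) @ G)" using cs
      proof cases
        case 1 then show ?thesis unfolding lF using Gx(7)[OF 1, of 0] Gx(6)[OF 1 k1(2)] k2 by simp
      next
        case 2 then show ?thesis unfolding lF using pE[of 0 i] peq[of i 1] k0 k2 by auto
      qed
      show "E w t \<longleftrightarrow> t = last (walk p 1 (k - 1) @ G)" using cs
      proof cases
        case 1 then show ?thesis unfolding lF using G(4)[OF 1] by simp
      next
        case 2 then show ?thesis unfolding lF using wp[of i] Gx(6)[OF lG, of i] by simp
      qed
      show "\<not> E (h 0) t \<and> \<not> E (h l) t" using cs
      proof cases
        case 1 then show ?thesis using Gx(1,2)[OF 1] by simp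
      next
        case 2 then show ?thesis using no[of i] by (simp add: EA)
      qed
    qed
  qed
qed

text \<open>Let \<open>e\<close> be the last contact among \<open>h l\<close> and
  \<open>h (Suc l)\<close>. On the hole \<open>p 0\<close>, \<open>h e\<close>, ...,
  \<open>h (n - 1)\<close> the vertex \<open>h 0\<close> has two neighbours, \<open>p 0\<close> and
  \<open>h (n - 1)\<close>.\<close>

lemma short_both_aux:
  assumes A: "A 0 0" "A 0 (n - 1)" "A 0 l" and nW: "\<not> W (n - 1)" and c: "Suc l < c" "Suc c < n" "W c"
    and mid: "\<And>r. Suc l < r \<Longrightarrow> Suc r < n \<Longrightarrow> \<not> A 0 r"
  shows False
proof -
  define e where "e = (if A 0 (Suc l) then Suc l else l)"
  have e: "A 0 e" "l \<le> e" "e \<le> Suc l" using A unfolding e_def by auto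
  have no: "\<not> A 0 t" if "e < t" "t < n - 1" for t
    using mid[of t] that unfolding e_def by (cases "t = Suc l") (auto split: if_splits)
  have link: "\<forall>i t. 0 \<le> i \<longrightarrow> i \<le> 0 \<longrightarrow> e \<le> t \<longrightarrow> t \<le> n - 1 \<longrightarrow> (A i t \<longleftrightarrow> (i = 0 \<and> t = e) \<or> (i = 0 \<and> t = n - 1))"
  proof (intro allI impI)
    fix i t :: nat assume b: "0 \<le> i" "i \<le> 0" "e \<le> t" "t \<le> n - 1"
    then show "A i t \<longleftrightarrow> (i = 0 \<and> t = e) \<or> (i = 0 \<and> t = n - 1)"
      using no[of t] e(1) A(2) by (cases "t = e"; cases "t = n - 1") simp_all
  qed
  have 1: "0 < e \<and> e < n - 1 \<and> n - 1 < n \<and> 0 \<le> (0::nat) \<and> 0 < k \<and> e + 2 \<le> 0 - 0 + (n - 1)" using e(2,3) c l2 k0 by linarith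
  have 2: "\<exists>t\<ge>e. t \<le> n - 1 \<and> W t" using c e(3) by (intro exI[of _ c]) simp
  have 3: "Suc (n - 1) = n \<longrightarrow> \<not> W (n - 1)" using nW by simp
  have 4: "(\<exists>i. 0 \<le> i \<and> i \<le> 0 \<and> A i 0) \<or> e = 1 \<or> Suc (n - 1) = n" using ln by simp
  obtain x where x: "\<forall>i. 0 \<le> i \<longrightarrow> i \<le> 0 \<longrightarrow> A i 0 \<longrightarrow> x = p i" "Suc (n - 1) = n \<longrightarrow> x = h (n - 1)"
    using contact_pair[OF 1 link 3 2 4] by (elim exE conjE) (rule that)
  have "p 0 = h (n - 1)" using x A(1) ln by simp
  then show False using ph[OF k0, of "n - 1"] ln by simp
qed

lemma short_both:
  assumes A: "A 0 0" "A 0 l" and k: "k = 1" and c: "Suc l < c" "Suc c < n" "W c"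
  shows False
proof -
  interpret R: sector_path V E "\<lambda>i. h (mirror i)" n l w p k by (rule reflect)
  have mid: "\<not> A 0 r" if "Suc l < r" "Suc r < n" for r
    using both_no_mid[OF A _ c that] k by simp
  obtain b where b: "Rok b" "A 0 b" using A_far k by auto
  then have b': "l < b" "b < n" by (auto simp: Rok_def)
  have "b = Suc l \<or> b = n - 1" using mid[of b] b(2) b' by (metis Suc_lessI diff_Suc_1)
  then show False
  proof
    assume 1: "b = n - 1"
    then have "\<not> W (n - 1)" using b(1) b' unfolding Rok_def by simp
    then show False using short_both_aux[OF A(1) _ A(2) _ c mid] b(2) 1 by blast
  next
    assume 1: "b = Suc l"
    then have nW: "\<not> W (Suc l)" using b(1) unfolding Rok_def by simp
    have c': "Suc l < n + l - c" "Suc (n + l - c) < n" using c by auto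
    show False
    proof (rule R.short_both_aux[OF _ _ _ _ c'])
      show "\<not> R.A 0 r" if "Suc l < r" "Suc r < n" for r
        using mid[of "n + l - r"] that by (auto simp: reflect_simps)
    qed (use A b(2) 1 nW c in \<open>simp_all add: reflect_simps\<close>)
  qed
qed

text \<open>A piece of P between contacts with \<open>h (Suc l)\<close> and \<open>h 0\<close>
  closes to a hole through \<open>w\<close>. The path \<open>h l\<close>, ..., \<open>h 1\<close> is
  attached to it, but its first vertex sees both \<open>w\<close> and \<open>h (Suc l)\<close> on
  one side, where it should have a single foot.\<close>

lemma no_extra_contact:
  assumes k: "2 \<le> k" and Wl1: "W (Suc l)" and x: "0 < i" "i < k" "A i 0" and y: "\<And>i. 0 < i \<Longrightarrow> i < k \<Longrightarrow> \<not> A i l"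
    and j: "0 < j" "j < k"
  shows "\<not> A j (Suc l)"
proof
  assume "A j (Suc l)"
  define Q where "Q i j \<longleftrightarrow> 0 < i \<and> i < k \<and> 0 < j \<and> j < k \<and> A i (Suc l) \<and> A j 0" for i j
  have "Q j i" using \<open>A j (Suc l)\<close> x j by (simp add: Q_def)
  then obtain i j where Q: "Q i j" "\<And>i' j'. i' - j' + (j' - i') < i - j + (j - i) \<Longrightarrow> \<not> Q i' j'"
    using closest_pair[of Q j i] by metis
  have b: "0 < i" "i < k" "0 < j" "j < k" "A i (Suc l)" "A j 0" using Q(1) by (auto simp: Q_def)
  have mn: "\<not> (A i' (Suc l) \<and> A j' 0)" if "0 < i'" "i' < k" "0 < j'" "j' < k" "i' - j' + (j' - i') < i - j + (j - i)" for i' j'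
    using Q(2)[OF that(5)] that(1-4) by (auto simp: Q_def)
  have t: "0 < t" "t < k" "A t (Suc l) \<longleftrightarrow> t = i" "A t 0 \<longleftrightarrow> t = j" if t: "min i j \<le> t" "t \<le> max i j" for t
  proof -
    show t': "0 < t" "t < k" using t b(1-4) by (auto simp: min_def max_def split: if_splits)
    show "A t (Suc l) \<longleftrightarrow> t = i" using mn[of t j] t t' b by (cases "t = i") (auto simp: min_def max_def split: if_splits)
    show "A t 0 \<longleftrightarrow> t = j" using mn[of i t] t t' b by (cases "t = j") (auto simp: min_def max_def split: if_splits)
  qed
  have wk: "\<exists>t. min i j \<le> t \<and> t \<le> max i j \<and> a = p t" if a: "a \<in> set (walk p i j)" for a
    using a by (rule walk_cases) blast
  have nn: "0 < n" "l < n" "Suc l < n" "Suc l \<noteq> n - 1" using ln by auto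
  have P: "ipath V E (walk p i j @ [h 0])"
  proof (rule ipath_append[OF ipath_p ipath_single])
    show "set (walk p i j) \<inter> set [h 0] = {}"
    proof (intro equals0I, elim IntE)
      fix a assume "a \<in> set (walk p i j)" "a \<in> set [h 0]"
      then show False using wk[of a] t(2) ph nn by fastforce
    qed
    show "E a b \<longleftrightarrow> a = last (walk p i j) \<and> b = hd [h 0]" if ab: "a \<in> set (walk p i j)" "b \<in> set [h 0]" for a b
    proof -
      obtain s where s: "min i j \<le> s" "s \<le> max i j" "a = p s" using wk[OF ab(1)] by blast
      then show ?thesis using t[OF s(1,2)] ab(2) peq[of s j] b(4) by (simp add: EA)
    qed
  qed (use b hV nn in auto)
  have Wp: "ipath V E ([w] @ [h (Suc l)])"
    by (rule ipath_append) (use Wl1 nn in \<open>auto simp: ipath_single base\<close>)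
  have Z: "hole V E (([w] @ [h (Suc l)]) @ (walk p i j @ [h 0]))"
  proof (rule hole_of_paths[OF Wp P])
    show "set ([w] @ [h (Suc l)]) \<inter> set (walk p i j @ [h 0]) = {}"
    proof (intro equals0I, elim IntE)
      fix a assume a: "a \<in> set ([w] @ [h (Suc l)])" "a \<in> set (walk p i j @ [h 0])"
      then have "(\<exists>s<k. a = p s) \<or> a = h 0" using wk[of a] t(2) by fastforce
      then show False using a(1) pw ph wh[of 0] nn heq[of 0 "Suc l"] by auto
    qed
    fix a b' assume ab: "a \<in> set ([w] @ [h (Suc l)])" "b' \<in> set (walk p i j @ [h 0])"
    then consider s where "min i j \<le> s" "s \<le> max i j" "b' = p s" | "b' = h 0" using wk[of b'] by fastforce
    then show "E a b' \<longleftrightarrow> (a = last ([w] @ [h (Suc l)]) \<and> b' = hd (walk p i j @ [h 0])) \<or> (a = hd ([w] @ [h (Suc l)]) \<and> b' = last (walk p i j @ [h 0]))"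
    proof cases
      case 1
      then show ?thesis using t[OF 1(1,2)] ab(1) peq[of s i] b(2) wh[of "Suc l"] ph[of s 0] wp[of s] nn by (auto simp: EA)
    next
      case 2
      then show ?thesis using ab(1) W0 wh[of "Suc l"] wh[of 0] ph[of i 0] b(2) nn l2 hE[of "Suc l" 0] by (auto simp: EW)
    qed
  qed (use b in simp)
  have "\<exists>c\<in>set ([w] @ [h (Suc l)]). \<exists>d\<in>set (walk p i j @ [h 0]). E c d \<and> (\<forall>z\<in>set ([w] @ [h (Suc l)]). E (hd (walk h l 1)) z \<longleftrightarrow> z = c)
    \<and> (\<forall>z\<in>set (walk p i j @ [h 0]). E (last (walk h l 1)) z \<longleftrightarrow> z = d)"
  proof (rule two_feet[OF Z ipath_h])
    have el: "\<exists>s. 0 < s \<and> s \<le> l \<and> a = h s" if a: "a \<in> set (walk h l 1)" for a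
    proof -
      obtain s where s: "a = h s" "min l 1 \<le> s" "s \<le> max l 1" using a by (rule walk_cases)
      have "min l 1 = 1" "max l 1 = l" using l2 by auto
      then show ?thesis using s by (intro exI[of _ s]) auto
    qed
    have el2: "a = w \<or> a = h (Suc l) \<or> a = h 0 \<or> (\<exists>s. 0 < s \<and> s < k \<and> a = p s)" if a: "a \<in> set (([w] @ [h (Suc l)]) @ (walk p i j @ [h 0]))" for a
      using a wk[of a] t(1,2) by fastforce
    show "set (walk h l 1) \<inter> set (([w] @ [h (Suc l)]) @ (walk p i j @ [h 0])) = {}"
    proof (intro equals0I, elim IntE)
      fix a assume a: "a \<in> set (walk h l 1)" "a \<in> set (([w] @ [h (Suc l)]) @ (walk p i j @ [h 0]))"
      obtain s where s: "0 < s" "s \<le> l" "a = h s" using el[OF a(1)] by blast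
      then have "s < n" using nn by simp
      then show False using el2[OF a(2)] s wh[of s] heq[of s 0] heq[of s "Suc l"] ph[of _ s] nn by force
    qed
    show "\<forall>b\<in>set (walk p i j @ [h 0]). \<not> E (hd (walk h l 1)) b"
    proof
      fix a assume "a \<in> set (walk p i j @ [h 0])"
      then consider s where "min i j \<le> s" "s \<le> max i j" "a = p s" | "a = h 0" using wk[of a] by fastforce
      then show "\<not> E (hd (walk h l 1)) a"
      proof cases
        case 1 then show ?thesis using t(1,2)[OF 1(1,2)] y[of s] by (simp add: EA)
      next
        case 2 then show ?thesis using hE[of l 0] nn l2 by auto
      qed
    qed
    show "\<forall>t\<in>set (walk h l 1). t \<noteq> hd (walk h l 1) \<longrightarrow> t \<noteq> last (walk h l 1) \<longrightarrow> (\<forall>z\<in>set (([w] @ [h (Suc l)]) @ walk p i j @ [h 0]). \<not> E t z)"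
    proof (intro ballI impI)
      fix a z assume a: "a \<in> set (walk h l 1)" "a \<noteq> hd (walk h l 1)" "a \<noteq> last (walk h l 1)" and z: "z \<in> set (([w] @ [h (Suc l)]) @ walk p i j @ [h 0])"
      obtain s where s: "0 < s" "s \<le> l" "a = h s" using el[OF a(1)] by blast
      have "s \<noteq> l" "s \<noteq> 1" using a(2,3) s(3) by auto
      then have s': "1 < s" "s < l" "s < n" using s(1,2) nn by auto
      show "\<not> E a z" using el2[OF z]
      proof (elim disjE exE conjE)
        assume "z = w" then show ?thesis using WQ[of s] s' s(3) by (simp add: EW)
      next
        assume "z = h (Suc l)" then show ?thesis using hE[of s "Suc l"] s' s(3) nn by auto
      next
        assume "z = h 0" then show ?thesis using hE[of s 0] s' s(3) nn by auto
      next
        fix r assume "0 < r" "r < k" "z = p r" then show ?thesis using not_A_sector[of r s] s' s(3) by (simp add: EA)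
      qed
    qed
    show "\<exists>a\<in>set ([w] @ [h (Suc l)]). E (hd (walk h l 1)) a" using Wl by (simp add: EW)
    show "\<exists>b\<in>set (walk p i j @ [h 0]). E (last (walk h l 1)) b"
      by (rule bexI[of _ "h 0"]) (use hE[of 1 0] l2 nn in auto)
    show "\<forall>a\<in>set ([w] @ [h (Suc l)]). \<not> E (last (walk h l 1)) a"
      using WQ[of 1] l2 nn hE[of 1 "Suc l"] by (auto simp: EW)
  qed (use l2 nn in auto)
  then have "w = h (Suc l)" using Wl hE[of l "Suc l"] nn by (auto simp: EW)
  then show False using wh[of "Suc l"] nn by simp
qed

text \<open>Consider the hole from the contact \<open>h e\<close> of \<open>p 0\<close> to the first
  contact \<open>h s\<close> beyond it. As \<open>w\<close> sees \<open>h e\<close>, it sees no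
  other vertex up to \<open>h s\<close>. So \<open>h s\<close> is outside the extended neighborhood,
  the whole of P lies on the hole, and the foot of \<open>h 0\<close> is \<open>p 0\<close>.\<close>

lemma contact_step:
  assumes A00: "A 0 0" and k: "2 \<le> k" and e: "A 0 e" "W e" "l \<le> e" "e \<le> Suc l" and on: "\<And>i. 0 < i \<Longrightarrow> i < k \<Longrightarrow> \<not> A i e"
    and b: "e < b" "Rok b" "A (k - 1) b" and g: "e = l \<Longrightarrow> \<not> A 0 (Suc l)"
  shows "(\<forall>i<k. A i 0 \<longrightarrow> i = 0) \<and> \<not> W (Suc e)"
proof -
  obtain s j where s: "e < s" "s < n" "j < k" "A j s" "\<And>i t. i < k \<Longrightarrow> e < t \<Longrightarrow> t < s \<Longrightarrow> \<not> A i t" "\<And>i. i < j \<Longrightarrow> \<not> A i s"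
    "Suc s = n \<Longrightarrow> \<not> W s" "Rok s \<Longrightarrow> j = k - 1" "Rok s \<or> (s = Suc l \<and> W s)"
    using first_contact[OF b e(3)] by blast
  have link: "\<forall>i t. 0 \<le> i \<longrightarrow> i \<le> j \<longrightarrow> e \<le> t \<longrightarrow> t \<le> s \<longrightarrow> (A i t \<longleftrightarrow> (i = 0 \<and> t = e) \<or> (i = j \<and> t = s))"
  proof (intro allI impI)
    fix i t assume b: "0 \<le> i" "i \<le> j" "e \<le> t" "t \<le> s"
    have "t = e \<or> (e < t \<and> t < s) \<or> t = s" using b by linarith
    then consider "t = e" | "e < t" "t < s" | "t = s" by blast
    then show "A i t \<longleftrightarrow> (i = 0 \<and> t = e) \<or> (i = j \<and> t = s)"
    proof cases
      case 1 then show ?thesis using e(1) on[of i] b(2) s(1,3) by (cases "i = 0") simp_all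
    next
      case 2 then show ?thesis using s(5)[of i t] b(2) s(3) by simp
    next
      case 3 then show ?thesis using s(1,4) s(6)[of i] b(2) by (cases "i = j") simp_all
    qed
  qed
  \<comment> \<open>With \<open>j = 0\<close> and \<open>s = Suc e\<close> the intended hole would
    be a triangle.\<close>
  have j: "0 < j" if "s = Suc e"
  proof (cases "e = l")
    case True
    then show ?thesis using g s(4) that by (cases j) auto
  next
    case False
    then have "s \<noteq> Suc l" using that e(3,4) by simp
    then have "j = k - 1" using s(8,9) by blast
    then show ?thesis using k by simp
  qed
  have "e + 2 \<le> j + s" using s(1) j by (cases "s = Suc e") auto
  then have 1: "0 < e \<and> e < s \<and> s < n \<and> 0 \<le> j \<and> j < k \<and> e + 2 \<le> j - 0 + s" using s(1-3) e(3) l2 by linarith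
  have 2: "\<exists>t\<ge>e. t \<le> s \<and> W t" using e(2) s(1) by (intro exI[of _ e]) simp
  have 3: "(\<exists>i. 0 \<le> i \<and> i \<le> j \<and> A i 0) \<or> e = 1 \<or> Suc s = n" using A00 by blast
  have 4: "Suc s = n \<longrightarrow> \<not> W s" using s(7) by blast
  obtain c d where d: "\<forall>t. e \<le> t \<longrightarrow> t \<le> s \<longrightarrow> W t \<longrightarrow> t = d" "\<forall>i. 0 \<le> i \<longrightarrow> i \<le> j \<longrightarrow> A i 0 \<longrightarrow> c = p i"
    using contact_pair[OF 1 link 4 2 3] by (elim exE conjE) (rule that)
  have de: "d = e" using d(1)[rule_format, of e] e(2) s(1) by simp
  have W: "\<not> W t" if "e < t" "t \<le> s" for t using d(1)[rule_format, of t] that de by auto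
  then have "\<not> W s" using s(1) by blast
  then have "j = k - 1" using s(8,9) by blast
  moreover have "c = p 0" using d(2)[rule_format, of 0] A00 by simp
  ultimately have "i = 0" if "i < k" "A i 0" for i
    using d(2)[rule_format, of i] that peq[of 0 i] k0 by simp
  then show ?thesis using W[of "Suc e"] s(1) by auto
qed

text \<open>\<open>contact_step\<close> starts at the last of \<open>h l\<close>,
  \<open>h (Suc l)\<close> that \<open>p 0\<close> sees. If this is \<open>h (Suc l)\<close>, then
  \<open>w\<close> sees it too, since \<open>p 0\<close> is not the last vertex of P, and
  \<open>no_extra_contact\<close> frees it from later contacts.\<close>

lemma both_far_contact:
  assumes A: "A 0 0" "A 0 l" and k: "2 \<le> k" and y: "\<And>i. 0 < i \<Longrightarrow> i < k \<Longrightarrow> \<not> A i l" and x: "0 < i" "i < k" "A i 0"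
  shows False
proof -
  obtain b where b: "Rok b" "A (k - 1) b" using A_far by blast
  then have lb: "l < b" by (simp add: Rok_def)
  show False
  proof (cases "A 0 (Suc l)")
    case False
    then have "\<forall>i<k. A i 0 \<longrightarrow> i = 0"
      using contact_step[OF A(1) k A(2) Wl order_refl _ y lb b] by simp
    then show False using x by blast
  next
    case True
    have "\<not> Rok (Suc l)" using not_A_far[of 0 "Suc l"] k True by auto
    then have W1: "W (Suc l)" using not_Rok[of "Suc l"] ln by simp
    then have "b \<noteq> Suc l" using b(1) by (auto simp: Rok_def)
    then have "Suc l < b" using lb by simp
    then have "\<forall>i<k. A i 0 \<longrightarrow> i = 0"
      using contact_step[OF A(1) k True W1 _ order_refl no_extra_contact[OF k W1 x y] _ b] by simp
    then show False using x by blast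
  qed
qed

text \<open>\<open>p (k - 1)\<close> can see only \<open>h (Suc l)\<close> and
  \<open>h (n - 1)\<close>. If no vertex after \<open>p 0\<close> sees \<open>h (Suc l)\<close>,
  rigidity of P against H leaves \<open>p 0\<close> one neighbour, but it sees \<open>h 0\<close>
  and \<open>h l\<close>. Otherwise let \<open>p m\<close> be the last one that does. Either it is
  \<open>p (k - 1)\<close>, which then has just two nonadjacent neighbours on H, or \<open>w\<close>
  sees both \<open>h (Suc l)\<close> and \<open>h c\<close> on the hole closed by
  \<open>p m\<close>, ..., \<open>p (k - 1)\<close>.\<close>

lemma long_both_aux:
  assumes A: "A 0 0" "A 0 l" and k: "2 \<le> k" and no: "\<And>i. 0 < i \<Longrightarrow> i < k \<Longrightarrow> \<not> A i 0 \<and> \<not> A i l"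
    and c: "Suc l < c" "Suc c < n" "W c" and x: "A (k - 1) (n - 1)" "\<not> W (n - 1)"
  shows False
proof -
  have k1: "0 < k - 1" "k - 1 < k" using k by auto
  have mid: "\<not> A (k - 1) r" if "Suc l < r" "Suc r < n" for r by (rule both_no_mid[OF A no c that])
  have lo: "\<not> A i t" if "0 < i" "i < k" "t \<le> l" for i t
    using no[OF that(1,2)] not_A_sector[OF that(1,2), of t] that(3) by (cases "t = 0"; cases "t = l") auto
  have Rx: "Rok (n - 1)" using x(2) ln by (simp add: Rok_def)
  have hi: "\<not> A i t" if "Suc i < k" "Suc l < t" "t < n" for i t
  proof (cases "t = n - 1")
    case True then show ?thesis using not_A_far[OF that(1) Rx] by simp
  next
    case False then show ?thesis using not_A_far[OF that(1) Rok_mid[of t]] that by simp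
  qed
  have top: "t = Suc l \<or> t = n - 1" if "A (k - 1) t" "t < n" for t
  proof -
    have "\<not> t \<le> l" "\<not> (Suc l < t \<and> Suc t < n)" using lo[OF k1, of t] mid[of t] that(1) by blast+
    then show ?thesis using that(2) by linarith
  qed
  show False
  proof (cases "\<exists>i. 0 < i \<and> i < k \<and> A i (Suc l)")
    case True
    define S where "S = {i. 0 < i \<and> i < k \<and> A i (Suc l)}"
    have S: "finite S" "S \<noteq> {}" using True by (auto simp: S_def)
    define m where "m = Max S"
    have m: "0 < m" "m < k" "A m (Suc l)" using Max_in[OF S] unfolding m_def S_def by auto
    have m2: "\<not> A i (Suc l)" if "m < i" "i < k" for i
    proof
      assume "A i (Suc l)"
      then have "i \<in> S" using that by (simp add: S_def)
      then show False using Max_ge[OF S(1)] that(1) unfolding m_def by (simp add: leD)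
    qed
    show False
    proof (cases "m = k - 1")
      case True
      have "\<exists>e\<in>set (map h [0..<n]). E (p (k - 1)) e \<and> e \<noteq> h (Suc l) \<and> e \<noteq> h (n - 1)"
      proof (rule hole_two_nbrs[OF cyc_hole[OF cy]])
        show "p (k - 1) \<notin> set (map h [0..<n])"
        proof
          assume "p (k - 1) \<in> set (map h [0..<n])"
          then obtain x where "p (k - 1) = h x" "x < n" by auto
          then show False using ph[OF k1(2), of x] by simp
        qed
        show "\<not> E (h (Suc l)) (h (n - 1))" using hE[of "Suc l" "n - 1"] c by auto
        show "h (Suc l) \<noteq> h (n - 1)" using heq[of "Suc l" "n - 1"] c by auto
        show "E (p (k - 1)) (h (Suc l))" "E (p (k - 1)) (h (n - 1))" using m(3) True x by (simp_all add: EA)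
      qed (use ln in auto)
      then obtain e where e: "e \<in> set (map h [0..<n])" "E (p (k - 1)) e" "e \<noteq> h (Suc l)" "e \<noteq> h (n - 1)" by blast
      obtain t where t: "e = h t" "t < n" using e(1) by auto
      then have "A (k - 1) t" "t \<noteq> Suc l" "t \<noteq> n - 1" using e(2-4) by (auto simp: EA)
      then show False using top t(2) by blast
    next
      case False
      then have mk: "Suc m < k" "m < k - 1" using m(2) by auto
      have "\<not> Rok (Suc l)" using not_A_far[OF mk(1)] m(3) by blast
      then have W1: "W (Suc l)" using not_Rok[of "Suc l"] ln by simp
      have link: "\<forall>i t. m \<le> i \<longrightarrow> i \<le> k - 1 \<longrightarrow> Suc l \<le> t \<longrightarrow> t \<le> n - 1 \<longrightarrow> (A i t \<longleftrightarrow> (i = m \<and> t = Suc l) \<or> (i = k - 1 \<and> t = n - 1))"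
      proof (intro allI impI)
        fix i t assume b: "m \<le> i" "i \<le> k - 1" "Suc l \<le> t" "t \<le> n - 1"
        have n1: "Suc l \<noteq> n - 1" using c by simp
        show "A i t \<longleftrightarrow> (i = m \<and> t = Suc l) \<or> (i = k - 1 \<and> t = n - 1)"
        proof (cases "t = Suc l")
          case True
          then show ?thesis using m(3) m2[of i] b k1 n1 by (cases "i = m") simp_all
        next
          case tl: False
          show ?thesis
          proof (cases "i = k - 1")
            case True
            then show ?thesis using x(1) mid[of t] tl b by (cases "t = n - 1") simp_all
          next
            case False
            then have "Suc i < k" using b(2) by simp
            then show ?thesis using hi[of i t] tl b ln False by simp
          qed
        qed
      qed
      have 1: "0 < Suc l \<and> Suc l < n - 1 \<and> n - 1 < n \<and> m \<le> k - 1 \<and> k - 1 < k \<and> Suc l + 2 \<le> k - 1 - m + (n - 1)"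
        using c mk k1 by linarith
      have 2: "\<exists>t\<ge>Suc l. t \<le> n - 1 \<and> W t" using c by (intro exI[of _ c]) simp
      have 3: "Suc (n - 1) = n \<longrightarrow> \<not> W (n - 1)" using x(2) by simp
      have 4: "(\<exists>i. m \<le> i \<and> i \<le> k - 1 \<and> A i 0) \<or> Suc l = 1 \<or> Suc (n - 1) = n" using ln by simp
      obtain d where d: "\<forall>t. Suc l \<le> t \<longrightarrow> t \<le> n - 1 \<longrightarrow> W t \<longrightarrow> t = d"
        using contact_pair[OF 1 link 3 2 4] by (elim exE conjE) (rule that)
      have "Suc l \<le> n - 1" "c \<le> n - 1" "Suc l \<le> c" using c by linarith+
      then have "Suc l = d" "c = d" using d[rule_format, of "Suc l"] d[rule_format, of c] W1 c(3) by blast+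
      then show False using c(1) by simp
    qed
  next
    case False
    obtain c' where c': "\<And>b. b < n \<Longrightarrow> A 0 b \<longleftrightarrow> b = c'"
    proof (rule p_to_ring[OF k, of "Suc l"])
      show "Suc l < n - 1" using c by simp
      show "b \<le> Suc l" if "b < n" "A 0 b" for b using hi[of 0 b] k that by (cases "Suc l < b") auto
      show "Suc l < b" if "b < n" "A (k - 1) b" for b
      proof -
        have "b \<noteq> Suc l" using False k1 that(2) by blast
        then have "b = n - 1" using top[OF that(2,1)] by blast
        then show ?thesis using c by simp
      qed
      show "\<not> A i b" if i: "0 < i" "Suc i < k" "b < n" for i b
      proof -
        have "i < k" using i by simp
        have "b \<le> l \<or> b = Suc l \<or> Suc l < b" by linarith
        then show ?thesis using lo[OF i(1) \<open>i < k\<close>, of b] hi[OF i(2) _ i(3)] False i(1) \<open>i < k\<close> by blast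
      qed
    qed auto
    show False using c'[of 0] c'[of l] A ln l2 by simp
  qed
qed

lemma long_both:
  assumes A: "A 0 0" "A 0 l" and k: "2 \<le> k" and no: "\<And>i. 0 < i \<Longrightarrow> i < k \<Longrightarrow> \<not> A i 0 \<and> \<not> A i l"
    and c: "Suc l < c" "Suc c < n" "W c"
  shows False
proof -
  interpret R: sector_path V E "\<lambda>i. h (mirror i)" n l w p k by (rule reflect)
  have mid: "\<not> A (k - 1) r" if "Suc l < r" "Suc r < n" for r by (rule both_no_mid[OF A no c that])
  obtain b where b: "Rok b" "A (k - 1) b" using A_far by blast
  then have b': "l < b" "b < n" by (auto simp: Rok_def)
  have "b = Suc l \<or> b = n - 1" using mid[of b] b(2) b' by (metis Suc_lessI diff_Suc_1)
  then show False
  proof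
    assume 1: "b = n - 1"
    then have "\<not> W (n - 1)" using b(1) b' unfolding Rok_def by simp
    then show False using long_both_aux[OF A k no c] b(2) 1 by blast
  next
    assume 1: "b = Suc l"
    then have nW: "\<not> W (Suc l)" using b(1) unfolding Rok_def by simp
    have c': "Suc l < n + l - c" "Suc (n + l - c) < n" using c by auto
    show False
    proof (rule R.long_both_aux[OF _ _ k _ c'])
      show "\<not> R.A i 0 \<and> \<not> R.A i l" if "0 < i" "i < k" for i using no[OF that] by (simp add: reflect_simps)
    qed (use A b(2) 1 nW c in \<open>simp_all add: reflect_simps\<close>)
  qed
qed

lemma both_contacts:
  assumes A: "A 0 0" "A 0 l" and k: "2 \<le> k" and xy: "(\<forall>i. 0 < i \<longrightarrow> i < k \<longrightarrow> \<not> A i l) \<or> (\<forall>i. 0 < i \<longrightarrow> i < k \<longrightarrow> \<not> A i 0)"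
    and i: "0 < i" "i < k"
  shows "\<not> A i 0 \<and> \<not> A i l"
proof -
  interpret R: sector_path V E "\<lambda>i. h (mirror i)" n l w p k by (rule reflect)
  from xy show ?thesis
  proof
    assume y: "\<forall>i. 0 < i \<longrightarrow> i < k \<longrightarrow> \<not> A i l"
    then show ?thesis using both_far_contact[OF A k _ i] i by blast
  next
    assume x: "\<forall>i. 0 < i \<longrightarrow> i < k \<longrightarrow> \<not> A i 0"
    have "\<not> A i l"
    proof
      assume "A i l"
      show False
        by (rule R.both_far_contact[OF _ _ k _ i]) (use A x \<open>A i l\<close> in \<open>simp_all add: reflect_simps\<close>)
    qed
    then show ?thesis using x i by blast
  qed
qed

lemma middle_neighbour_False:
  assumes n: "n > 6" and c: "Suc l < c" "Suc c < n" "W c"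
  shows False
proof -
  have sp: spread using c unfolding spread_def by blast
  show False
  proof (cases "(\<forall>i<k. \<not> A i l) \<or> (\<forall>i<k. \<not> A i 0)")
    case True
    show False
    proof (cases "k = 1")
      case False
      then show False using no_contact_long[OF sp True] k0 by simp
    next
      case k: True
      show False by (rule no_contact_short[OF n _ _ k c]) (use no_contact[OF sp True k0] in blast)+
    qed
  next
    case False
    then obtain i j where ij: "i < k" "A i 0" "j < k" "A j l" by blast
    note b = both_p0[OF ij]
    show False
    proof (cases "k = 1")
      case True then show False using short_both[OF b(1,2) _ c] by blast
    next
      case False
      then have k: "2 \<le> k" using k0 by simp
      show False by (rule long_both[OF b(1,2) k both_contacts[OF b(1,2) k b(3)] c])
    qed
  qed
qed

text \<open>By \<open>no_contact_long\<close> and \<open>both_p0\<close>, \<open>p 0\<close> sees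
  both ends of the sector. If it missed \<open>h (Suc l)\<close>, \<open>contact_step\<close> at
  \<open>h l\<close> would show that \<open>w\<close> does not see \<open>h (Suc l)\<close>.\<close>

lemma hub_contacts:
  assumes W: "W (Suc l)" "W (n - 1)" and k: "2 \<le> k"
  shows "A 0 (Suc l)" "0 < i \<Longrightarrow> i < k \<Longrightarrow> \<not> A i 0"
proof -
  have sp: spread using W unfolding spread_def by blast
  have "\<not> ((\<forall>i<k. \<not> A i l) \<or> (\<forall>i<k. \<not> A i 0))" using no_contact_long[OF sp _ k] by blast
  then obtain i j where ij: "i < k" "A i 0" "j < k" "A j l" by blast
  note b = both_p0[OF ij]
  note no = both_contacts[OF b(1,2) k b(3)]
  show "0 < i \<Longrightarrow> i < k \<Longrightarrow> \<not> A i 0" for i using no by blast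
  show "A 0 (Suc l)"
  proof (rule ccontr)
    assume n: "\<not> A 0 (Suc l)"
    obtain b' where b': "Rok b'" "A (k - 1) b'" using A_far by blast
    then have "l < b'" by (simp add: Rok_def)
    then have "\<not> W (Suc l)" using contact_step[OF b(1) k b(2) Wl order_refl _ _ _ b'] no n by auto
    then show False using W by blast
  qed
qed

section \<open>Hubs\<close>

text \<open>Exchanges the two long sectors of a hub; the path has to be reversed at the same time.\<close>

definition shift :: "nat \<Rightarrow> nat" where "shift i = (if i + Suc l < n then i + Suc l else i + Suc l - n)"

text \<open>As \<open>w\<close> sees \<open>h (Suc l)\<close> and \<open>h (n - 1)\<close>, the
  positions outside the extended neighborhood of one long sector are exactly the inner positions of
  the other. Hence the conditions on the first and on the last vertex of P change places under
  reversal.\<close>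

lemma swap_sectors:
  assumes W: "W (Suc l)" "W (n - 1)" and mid: "\<And>r. Suc l < r \<Longrightarrow> Suc r < n \<Longrightarrow> \<not> W r"
  shows "sector_path V E (\<lambda>i. h (shift i)) n (n - l - 2) w (\<lambda>i. p (k - 1 - i)) k"
proof -
  obtain b where b: "Rok b" "A (k - 1) b" using A_far by blast
  then have "l < b" "b < n" "b \<noteq> Suc l" "Suc b \<noteq> n" using W unfolding Rok_def by auto
  then have b': "Suc l < b" "Suc b < n" by auto
  then have l4: "l + 4 \<le> n" by simp
  obtain a where a: "0 < a" "a < l" "A 0 a" using A_sector by blast
  have s: "shift i < n" if "i < n" for i using that ln by (auto simp: shift_def)
  have sE: "E (h (shift i)) (h (shift j)) \<longleftrightarrow> i = Suc j \<or> j = Suc i \<or> (i = 0 \<and> Suc j = n) \<or> (j = 0 \<and> Suc i = n)" if ij: "i < n" "j < n" for i j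
  proof -
    define m where "m = n - Suc l"
    have m: "Suc l + m = n" "0 < m" using ln unfolding m_def by auto
    have *: "(x = Suc y \<or> y = Suc x \<or> (x = 0 \<and> Suc y = n) \<or> (y = 0 \<and> Suc x = n)) \<longleftrightarrow>
      (y = (if Suc x = n then 0 else Suc x) \<or> x = (if Suc y = n then 0 else Suc y))" if "x < n" "y < n" for x y
      using that by (cases "Suc x = n"; cases "Suc y = n") auto
    have sm: "shift x = (if x < m then x + Suc l else x - m)" if "x < n" for x
      using that m(1) unfolding shift_def by (cases "x < m") auto
    show ?thesis unfolding hE[OF s[OF ij(1)] s[OF ij(2)]] *[OF s[OF ij(1)] s[OF ij(2)]] *[OF ij]
      unfolding sm[OF ij(1)] sm[OF ij(2)]
      by (rule shift_cyclic[of "Suc l" m i j, unfolded m(1)]) (use m n4 ij in auto)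
  qed
  have sq: "h (shift i) = h (shift j) \<longleftrightarrow> i = j" if ij: "i < n" "j < n" for i j
  proof -
    have "shift i = shift j \<longleftrightarrow> i = j" using ij by (cases "i + Suc l < n"; cases "j + Suc l < n") (simp_all add: shift_def, linarith+)
    then show ?thesis unfolding heq[OF s[OF ij(1)] s[OF ij(2)]] .
  qed
  have kk: "k - 1 - i < k" for i using k0 by simp
  have s0: "shift 0 = Suc l" "shift (n - l - 2) = n - 1" "shift (Suc (n - l - 2)) = 0" "shift (n - 1) = l"
    using l4 by (auto simp: shift_def)
  show ?thesis
  proof
    show "cyc (\<lambda>i. h (shift i)) n" unfolding cyc_def
    proof (intro conjI)
      show "inj_on (\<lambda>i. h (shift i)) {..<n}" using sq by (auto simp: inj_on_def)
      show "(\<lambda>i. h (shift i)) ` {..<n} \<subseteq> V" using s hV by auto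
      show "\<forall>i<n. \<forall>j<n. E (h (shift i)) (h (shift j)) \<longleftrightarrow> i = Suc j \<or> j = Suc i \<or> (i = 0 \<and> Suc j = n) \<or> (j = 0 \<and> Suc i = n)"
        using sE by blast
    qed (rule n4)
    show "2 \<le> n - l - 2" "n - l - 2 + 3 \<le> n" using l4 l2 by auto
    show "w \<in> V" by (rule wV)
    show "h (shift i) \<noteq> w" if "i < n" for i using wh[OF s[OF that]] .
    show "E w (h (shift 0))" "E w (h (shift (n - l - 2)))" using W s0 by (simp_all add: W_def)
    show "\<not> E w (h (shift i))" if "0 < i" "i < n - l - 2" for i
      using mid[of "i + Suc l"] that unfolding shift_def by (auto simp: W_def)
    show "0 < k" by (rule k0)
    show "p (k - 1 - i) \<in> V" for i by (rule pV[OF kk])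
    show "p (k - 1 - i) \<noteq> w" for i by (rule pw[OF kk])
    show "\<not> E w (p (k - 1 - i))" for i by (rule wp[OF kk])
    show "p (k - 1 - i) \<noteq> h (shift j)" if "i < k" "j < n" for i j using ph[OF kk s[OF that(2)]] .
    show "p (k - 1 - i) = p (k - 1 - j) \<longleftrightarrow> i = j" if "i < k" "j < k" for i j
    proof -
      have "k - 1 - i = k - 1 - j \<longleftrightarrow> i = j" using that by linarith
      then show ?thesis unfolding peq[OF kk kk] .
    qed
    show "E (p (k - 1 - i)) (p (k - 1 - j)) \<longleftrightarrow> i = Suc j \<or> j = Suc i" if "i < k" "j < k" for i j
    proof -
      have "k - 1 - i = Suc (k - 1 - j) \<longleftrightarrow> j = Suc i" "k - 1 - j = Suc (k - 1 - i) \<longleftrightarrow> i = Suc j" using that by linarith+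
      then show ?thesis unfolding pE[OF kk kk] by blast
    qed
    have "shift (b - Suc l) = b" "0 < b - Suc l" "b - Suc l < n - l - 2" using b' by (auto simp: shift_def)
    then show "\<exists>a>0. a < n - l - 2 \<and> E (p (k - 1 - 0)) (h (shift a))" using b(2)
      by (intro exI[of _ "b - Suc l"]) (simp add: A_def)
    show "\<not> E (p (k - 1 - i)) (h (shift a))" if "0 < i" "i < k" "0 < a" "a < n - l - 2" for i a
    proof -
      have "Suc (k - 1 - i) < k" "shift a = a + Suc l" "Suc l < a + Suc l" "Suc (a + Suc l) < n" using that by (auto simp: shift_def)
      then show ?thesis using not_A_far[OF _ Rok_mid, of "k - 1 - i" "a + Suc l"] by (simp add: A_def)
    qed
    \<comment> \<open>\<open>a + n - Suc l\<close> is the new number of the old position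
      \<open>a\<close>.\<close>
    have "shift (a + n - Suc l) = a" "n - l - 2 < a + n - Suc l" "a + n - Suc l < n" "a + n - Suc l \<noteq> Suc (n - l - 2)" "Suc (a + n - Suc l) \<noteq> n"
      using a(1,2) l4 by (auto simp: shift_def)
    then show "\<exists>b>n - l - 2. b < n \<and> (b = Suc (n - l - 2) \<or> Suc b = n \<longrightarrow> \<not> E w (h (shift b))) \<and> E (p (k - 1 - (k - 1))) (h (shift b))"
      using a(3) by (intro exI[of _ "a + n - Suc l"]) (simp add: A_def)
    show "\<not> E (p (k - 1 - i)) (h (shift b))" if c: "Suc i < k" "n - l - 2 < b" "b < n" "b = Suc (n - l - 2) \<or> Suc b = n \<Longrightarrow> \<not> E w (h (shift b))" for i b
    proof -
      have "b \<noteq> Suc (n - l - 2)" using c(4) s0(3) W0 by (auto simp: W_def)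
      moreover have "b \<noteq> n - 1" using c(4) s0(4) Wl ln by (auto simp: W_def)
      ultimately have "shift b = b + Suc l - n" "0 < b + Suc l - n" "b + Suc l - n < l" using c(2,3) l4 by (auto simp: shift_def)
      then show ?thesis using not_A_sector[of "k - 1 - i" "b + Suc l - n"] c(1) by (simp add: A_def)
    qed
  qed
qed

text \<open>Applied to the exchanged sectors, \<open>hub_contacts\<close> says that
  \<open>p (k - 1)\<close> sees \<open>h 0\<close>; applied to the original ones, it says the
  opposite.\<close>

lemma hub_long_False:
  assumes W: "W (Suc l)" "W (n - 1)" and mid: "\<And>r. Suc l < r \<Longrightarrow> Suc r < n \<Longrightarrow> \<not> W r" and k: "2 \<le> k"
  shows False
proof -
  interpret S: sector_path V E "\<lambda>i. h (shift i)" n "n - l - 2" w "\<lambda>i. p (k - 1 - i)" k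
    by (rule swap_sectors[OF W mid])
  have "shift (Suc (n - l - 2)) = 0" "shift (n - 1) = l" using S.l2 ln by (auto simp: shift_def)
  then have "S.W (Suc (n - l - 2))" "S.W (n - 1)" using W0 Wl by (simp_all add: S.W_def W_def)
  from S.hub_contacts(1)[OF this k] have "E (p (k - 1 - 0)) (h (shift (Suc (n - l - 2))))" unfolding S.A_def .
  then have "A (k - 1) 0" using \<open>shift (Suc (n - l - 2)) = 0\<close> by (simp add: A_def)
  then show False using hub_contacts(2)[OF W k, of "k - 1"] k by simp
qed

text \<open>The stretch from \<open>h (Suc u)\<close> to \<open>h t\<close> belongs to a hole with
  \<open>p 0\<close> and contains two neighbours of \<open>w\<close>, \<open>h l\<close> and
  \<open>h (Suc l)\<close>; \<open>stem_contacts\<close> with the stem ending in \<open>h u\<close>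
  permits one.\<close>

lemma hub_short_left:
  assumes W: "W (Suc l)" and u: "Suc u < l" and t: "Suc l \<le> t" "Suc t < n"
    and A: "\<And>j. j < n \<Longrightarrow> A 0 j \<longleftrightarrow> j = u \<or> j = Suc u \<or> j = t \<or> j = Suc t"
  shows False
proof -
  have v: "0 < Suc u" "Suc u < l" using u by auto
  have s: "l < t" using t by simp
  have nn: "u < n" "Suc u < n" "t < n" using u t by auto
  have A': "A 0 (Suc u)" "A 0 t" "A 0 u \<or> Suc u = Suc u" using A nn by auto
  have no: "\<not> A 0 x" if "Suc u < x" "x < t" for x using A[of x] that nn by auto
  have u0: "\<not> A 0 x" if "x < u" for x using A[of x] that nn s u by auto
  have Wt: "\<exists>x>Suc u. x \<le> t \<and> W x" using u s Wl by (intro exI[of _ l]) simp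
  obtain c where c: "\<forall>x. Suc u < x \<longrightarrow> x \<le> t \<longrightarrow> W x \<longrightarrow> x = c"
    by (rule stem_contacts[OF v s t(2) lessI A'(1,2) no u0 A'(3) Wt]) (assumption | rule that)+
  have "l = c" "Suc l = c" using c[rule_format, of l] c[rule_format, of "Suc l"] u t Wl W by simp_all
  then show False by simp
qed

text \<open>Since \<open>l\<close> is at least 2, an edge of the sector cannot contain both of its
  ends; if it contains \<open>h l\<close>, the mirror image is used.\<close>

lemma hub_short_False:
  assumes W: "W (Suc l)" "W (n - 1)" and u: "Suc u \<le> l" and t: "Suc l \<le> t" "Suc t < n"
    and A: "\<And>j. j < n \<Longrightarrow> A 0 j \<longleftrightarrow> j = u \<or> j = Suc u \<or> j = t \<or> j = Suc t"
  shows False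
proof (cases "Suc u = l")
  case False
  then show False using hub_short_left[OF W(1) _ t A] u by simp
next
  case True
  interpret R: sector_path V E "\<lambda>i. h (mirror i)" n l w p k by (rule reflect)
  show False
  proof (rule R.hub_short_left[of 0 "n + l - Suc t"])
    show "R.A 0 j \<longleftrightarrow> j = 0 \<or> j = Suc 0 \<or> j = n + l - Suc t \<or> j = Suc (n + l - Suc t)" if j: "j < n" for j
    proof -
      have "mirror j = u \<longleftrightarrow> j = Suc 0" "mirror j = Suc u \<longleftrightarrow> j = 0" "mirror j = t \<longleftrightarrow> j = Suc (n + l - Suc t)" "mirror j = Suc t \<longleftrightarrow> j = n + l - Suc t"
        using j t True l2 by (auto simp: mirror_def)
      then show ?thesis using A[of "mirror j"] j by (auto simp: reflect_simps)
    qed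
  qed (use W t True l2 in \<open>auto simp: reflect_simps\<close>)
qed

text \<open>H and \<open>w\<close> form a pyramid with apex \<open>h 0\<close> and triangle
  \<open>w\<close>, \<open>h l\<close>, \<open>h (Suc l)\<close>.\<close>

lemma single_end_contact_False:
  assumes W: "W (Suc l)" "\<not> W (n - 1)" and mid: "\<And>r. Suc l < r \<Longrightarrow> Suc r < n \<Longrightarrow> \<not> W r"
  shows False
proof -
  have wt: "W t \<longleftrightarrow> t = l" if "0 < t" "t \<le> l" for t using WQ[of t] Wl that by (cases "t = l") auto
  have wt': "W t \<longleftrightarrow> t = Suc l" if "l < t" "t < n" for t
    using W mid[of t] that by (cases "t = Suc l"; cases "t = n - 1") auto
  have n0: "0 < n" "l < n" "Suc l < n" using ln by auto
  have q: "\<exists>t. 0 < t \<and> t \<le> l \<and> x = h t" if x: "x \<in> set (walk h 1 l)" for x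
  proof -
    obtain t where "x = h t" "min 1 l \<le> t" "t \<le> max 1 l" using x by (rule walk_cases)
    then show ?thesis using l2 by (intro exI[of _ t]) (auto simp: min_def max_def)
  qed
  have r: "\<exists>t. l < t \<and> t < n \<and> x = h t" if x: "x \<in> set (walk h (n - 1) (Suc l))" for x
  proof -
    obtain t where t: "x = h t" "min (n - 1) (Suc l) \<le> t" "t \<le> max (n - 1) (Suc l)" using x by (rule walk_cases)
    have "min (n - 1) (Suc l) = Suc l" "max (n - 1) (Suc l) = n - 1" using ln by auto
    then show ?thesis using t ln by (intro exI[of _ t]) auto
  qed
  show False
  proof (rule no_pyramid[OF ipath_single[OF wV] ipath_h[of 1 l] ipath_h[of "n - 1" "Suc l"], of "h 0"])
    show "link_last [w] (walk h 1 l)" unfolding link_last_def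
    proof (intro ballI)
      fix a x assume a: "a \<in> set [w]" "x \<in> set (walk h 1 l)"
      then obtain t where t: "0 < t" "t \<le> l" "x = h t" using q by blast
      then have "t < n" using n0 by simp
      then show "a \<noteq> x \<and> (E a x \<longleftrightarrow> a = last [w] \<and> x = last (walk h 1 l))"
        using a(1) t wt[OF t(1,2)] heq[of t l] whp(1)[of t] n0 by (simp add: EW)
    qed
    show "link_last [w] (walk h (n - 1) (Suc l))" unfolding link_last_def
    proof (intro ballI)
      fix a x assume a: "a \<in> set [w]" "x \<in> set (walk h (n - 1) (Suc l))"
      then obtain t where t: "l < t" "t < n" "x = h t" using r by blast
      then show "a \<noteq> x \<and> (E a x \<longleftrightarrow> a = last [w] \<and> x = last (walk h (n - 1) (Suc l)))"
        using a(1) t wt'[OF t(1,2)] heq[of t "Suc l"] whp(1)[of t] n0 by (simp add: EW)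
    qed
    show "link_last (walk h 1 l) (walk h (n - 1) (Suc l))" unfolding link_last_def
    proof (intro ballI)
      fix a x assume a: "a \<in> set (walk h 1 l)" "x \<in> set (walk h (n - 1) (Suc l))"
      obtain s where s: "0 < s" "s \<le> l" "a = h s" using q[OF a(1)] by blast
      obtain t where t: "l < t" "t < n" "x = h t" using r[OF a(2)] by blast
      have sn: "s < n" using s(2) n0 by simp
      have "s \<noteq> t" "(s = Suc t \<or> t = Suc s \<or> (s = 0 \<and> Suc t = n) \<or> (t = 0 \<and> Suc s = n)) \<longleftrightarrow> s = l \<and> t = Suc l"
        using s t by linarith+
      then show "a \<noteq> x \<and> (E a x \<longleftrightarrow> a = last (walk h 1 l) \<and> x = last (walk h (n - 1) (Suc l)))"
        using s(3) t(3) hE[OF sn t(2)] heq[OF sn t(2)] heq[OF sn n0(2)] heq[OF t(2) n0(3)] by simp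
    qed
    show "at_hd (h 0) [w]" using w0 hV n0 wh by (auto simp: at_hd_def E_commute)
    show "at_hd (h 0) (walk h 1 l)" unfolding at_hd_def
    proof (intro conjI ballI)
      fix x assume "x \<in> set (walk h 1 l)"
      then obtain t where t: "0 < t" "t \<le> l" "x = h t" using q by blast
      then show "h 0 \<noteq> x" "E (h 0) x \<longleftrightarrow> x = hd (walk h 1 l)" using hE[of 0 t] heq[of 0 t] heq[of t 1] ln by auto
    qed (use hV n0 in blast)
    show "at_hd (h 0) (walk h (n - 1) (Suc l))" unfolding at_hd_def
    proof (intro conjI ballI)
      fix x assume "x \<in> set (walk h (n - 1) (Suc l))"
      then obtain t where t: "l < t" "t < n" "x = h t" using r by blast
      then show "h 0 \<noteq> x" "E (h 0) x \<longleftrightarrow> x = hd (walk h (n - 1) (Suc l))" using hE[of 0 t] heq[of 0 t] heq[of t "n - 1"] ln l2 by auto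
    qed (use hV n0 in blast)
  qed (use l2 ln in auto)
qed

text \<open>Exactly one of the two contacts would give the pyramid above or its mirror image. With
  neither, \<open>w\<close> would have just the nonadjacent neighbours \<open>h 0\<close> and
  \<open>h l\<close>.\<close>

lemma contacts_of_w:
  assumes mid: "\<And>r. Suc l < r \<Longrightarrow> Suc r < n \<Longrightarrow> \<not> W r"
  shows "W (Suc l)" "W (n - 1)"
proof -
  interpret R: sector_path V E "\<lambda>i. h (mirror i)" n l w p k by (rule reflect)
  have mid': "\<not> R.W r" if "Suc l < r" "Suc r < n" for r
    using mid[of "n + l - r"] that by (auto simp: reflect_simps)
  have 1: "W (Suc l) \<Longrightarrow> W (n - 1)" using single_end_contact_False mid by blast
  have 2: "W (n - 1) \<Longrightarrow> W (Suc l)" using R.single_end_contact_False mid' by (auto simp: reflect_simps)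
  have "W (Suc l) \<or> W (n - 1)"
  proof (rule ccontr)
    assume n: "\<not> (W (Suc l) \<or> W (n - 1))"
    have "\<exists>e\<in>set (map h [0..<n]). E w e \<and> e \<noteq> h 0 \<and> e \<noteq> h l"
    proof (rule hole_two_nbrs[OF cyc_hole[OF cy]])
      show "w \<notin> set (map h [0..<n])"
      proof
        assume "w \<in> set (map h [0..<n])"
        then obtain x where "w = h x" "x < n" by auto
        then show False using whp(1)[of x] by simp
      qed
      show "h 0 \<noteq> h l" "\<not> E (h 0) (h l)" using heq[of 0 l] hE[of 0 l] l2 ln by auto
    qed (use w0 wl ln in auto)
    then obtain e where e: "e \<in> set (map h [0..<n])" "E w e" "e \<noteq> h 0" "e \<noteq> h l" by blast
    obtain t where t: "e = h t" "t < n" using e(1) by auto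
    have "W t" using e(2) t by (simp add: EW)
    have "t \<noteq> 0" "t \<noteq> l" using e(3,4) t(1) by metis+
    moreover have "t \<noteq> Suc l" "t \<noteq> n - 1" using n \<open>W t\<close> by auto
    ultimately have "\<not> t < l" "\<not> (Suc l < t \<and> Suc t < n)" "t \<noteq> l" "t \<noteq> Suc l" "t \<noteq> n - 1" using WQ[of t] mid[of t] \<open>W t\<close> by auto
    then show False using t(2) by linarith
  qed
  then show "W (Suc l)" "W (n - 1)" using 1 2 by auto
qed

lemma edge_of_hole:
  assumes "0 < a" "Suc a < n" "E (h a) v" "v \<in> h ` {..<n}"
  obtains u where "u = a \<or> Suc u = a" "{h a, v} = {h u, h (Suc u)}"
proof -
  obtain b where b: "v = h b" "b < n" using assms(4) by auto
  then have "a = Suc b \<or> b = Suc a" using hE[of a b] assms(1-3) by auto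
  then show thesis using that[of a] that[of b] b(1) by auto
qed

text \<open>\<open>p 0\<close> sees an inner vertex of each long sector. These two vertices are
  nonadjacent, so they lie on different ones of the two given edges, and each fixes the position of
  its edge on H.\<close>

lemma two_edges_False:
  assumes W: "W (Suc l)" "W (n - 1)" and k: "k = 1"
    and N: "h ` {..<n} \<inter> {v. E (p 0) v} = {x1, y1, x2, y2}" and e: "E x1 y1" "E x2 y2"
  shows False
proof -
  obtain a where a: "0 < a" "a < l" "A 0 a" using A_sector by blast
  obtain b where b: "Rok b" "A 0 b" using A_far k by auto
  then have b': "Suc l < b" "Suc b < n" using W unfolding Rok_def by (metis Suc_lessI diff_Suc_1)+
  have an: "a < n" "Suc a < n" and bn: "b < n" "0 < b" using a(2) ln b' by auto
  have aN: "h a \<in> {x1, y1, x2, y2}" and bN: "h b \<in> {x1, y1, x2, y2}"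
    using a(3) b(2) an bn unfolding N[symmetric] by (auto simp: EA)
  have nE: "\<not> E (h a) (h b)" and ne: "h a \<noteq> h b" using hE[of a b] heq[of a b] a b' an bn by auto
  have sub: "x1 \<in> h ` {..<n}" "y1 \<in> h ` {..<n}" "x2 \<in> h ` {..<n}" "y2 \<in> h ` {..<n}" using N by auto
  have e': "E y1 x1" "E y2 x2" using e E_sym by blast+
  have "\<exists>v v'. {x1, y1, x2, y2} = {h a, v} \<union> {h b, v'} \<and> E (h a) v \<and> E (h b) v' \<and> v \<in> h ` {..<n} \<and> v' \<in> h ` {..<n}" (is ?X)
  proof -
    have K: ?X if "{x1, y1, x2, y2} = {h a, v} \<union> {h b, v'}" "E (h a) v" "E (h b) v'" "v \<in> h ` {..<n}" "v' \<in> h ` {..<n}" for v v'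
      using that by blast
    consider "h a = x1" | "h a = y1" | "h a = x2" | "h a = y2" using aN by blast
    then show ?X
    proof cases
    assume 1: "h a = x1"
    then have "h b \<noteq> x1" "h b \<noteq> y1" using ne nE e(1) by auto
    then have "h b = x2 \<or> h b = y2" using bN by simp
    then show ?X
    proof
      assume 2: "h b = x2"
      show ?X by (rule K[of y1 y2]) (use 1 2 e(1) e(2) sub in auto)
    next
      assume 2: "h b = y2"
      show ?X by (rule K[of y1 x2]) (use 1 2 e(1) e'(2) sub in auto)
    qed
    next
    assume 1: "h a = y1"
    then have "h b \<noteq> y1" "h b \<noteq> x1" using ne nE e'(1) by auto
    then have "h b = x2 \<or> h b = y2" using bN by simp
    then show ?X
    proof
      assume 2: "h b = x2"
      show ?X by (rule K[of x1 y2]) (use 1 2 e'(1) e(2) sub in auto)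
    next
      assume 2: "h b = y2"
      show ?X by (rule K[of x1 x2]) (use 1 2 e'(1) e'(2) sub in auto)
    qed
    next
    assume 1: "h a = x2"
    then have "h b \<noteq> x2" "h b \<noteq> y2" using ne nE e(2) by auto
    then have "h b = x1 \<or> h b = y1" using bN by simp
    then show ?X
    proof
      assume 2: "h b = x1"
      show ?X by (rule K[of y2 y1]) (use 1 2 e(2) e(1) sub in auto)
    next
      assume 2: "h b = y1"
      show ?X by (rule K[of y2 x1]) (use 1 2 e(2) e'(1) sub in auto)
    qed
    next
    assume 1: "h a = y2"
    then have "h b \<noteq> y2" "h b \<noteq> x2" using ne nE e'(2) by auto
    then have "h b = x1 \<or> h b = y1" using bN by simp
    then show ?X
    proof
      assume 2: "h b = x1"
      show ?X by (rule K[of x2 y1]) (use 1 2 e'(2) e(1) sub in auto)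
    next
      assume 2: "h b = y1"
      show ?X by (rule K[of x2 x1]) (use 1 2 e'(2) e'(1) sub in auto)
    qed
    qed
  qed
  then obtain v v' where v: "{x1, y1, x2, y2} = {h a, v} \<union> {h b, v'}" "E (h a) v" "E (h b) v'" "v \<in> h ` {..<n}" "v' \<in> h ` {..<n}"
    by blast
  obtain u where u: "u = a \<or> Suc u = a" "{h a, v} = {h u, h (Suc u)}" using edge_of_hole[OF a(1) an(2) v(2,4)] by blast
  obtain t where t: "t = b \<or> Suc t = b" "{h b, v'} = {h t, h (Suc t)}" using edge_of_hole[OF bn(2) b'(2) v(3,5)] by blast
  have ut: "Suc u \<le> l" "Suc l \<le> t" "Suc t < n" using u(1) t(1) a(2) b' by auto
  show False
  proof (rule hub_short_False[OF W ut])
    fix j assume j: "j < n"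
    have "A 0 j \<longleftrightarrow> h j \<in> {h u, h (Suc u)} \<union> {h t, h (Suc t)}"
      using N v(1) u(2) t(2) j by (auto simp: A_def)
    also have "\<dots> \<longleftrightarrow> j = u \<or> j = Suc u \<or> j = t \<or> j = Suc t"
      using heq[OF j, of u] heq[OF j, of "Suc u"] heq[OF j, of t] heq[OF j, of "Suc t"] ut by auto
    finally show "A 0 j \<longleftrightarrow> j = u \<or> j = Suc u \<or> j = t \<or> j = Suc t" .
  qed
qed

text \<open>The locale does not speak of hubs. The information that \<open>p 0\<close> is one enters
  through an implication whose premises describe the case of a hub \<open>w\<close> and a single
  vertex P.\<close>

lemma config_False:
  assumes n: "n > 6" and hub: "W (Suc l) \<Longrightarrow> W (n - 1) \<Longrightarrow> (\<And>r. Suc l < r \<Longrightarrow> Suc r < n \<Longrightarrow> \<not> W r) \<Longrightarrow> l + 4 \<le> n \<Longrightarrow> k = 1 \<Longrightarrow>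
    \<exists>x1 y1 x2 y2. h ` {..<n} \<inter> {v. E (p 0) v} = {x1, y1, x2, y2} \<and> E x1 y1 \<and> E x2 y2"
  shows False
proof (cases "\<exists>c. Suc l < c \<and> Suc c < n \<and> W c")
  case True
  then show False using middle_neighbour_False[OF n] by blast
next
  case False
  then have mid: "\<not> W r" if "Suc l < r" "Suc r < n" for r using that by blast
  note W = contacts_of_w[OF mid]
  show False
  proof (cases "k = 1")
    case False
    then have "2 \<le> k" using k0 by simp
    then show False using hub_long_False[OF W mid] by blast
  next
    case True
    obtain b where b: "Rok b" using A_far by blast
    then have "l < b" "b < n" "b \<noteq> Suc l" "Suc b \<noteq> n" using W unfolding Rok_def by auto
    then have "l + 4 \<le> n" by linarith
    then show False using hub[OF W mid _ True] two_edges_False[OF W True] by blast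
  qed
qed

end

section \<open>Reduction to a shortest path\<close>

lemma (in graph_C) rotate_cyc:
  assumes H: "hole V E H" and s: "s < length H"
  shows "cyc (\<lambda>i. H ! ((s + i) mod length H)) (length H)"
proof -
  have "hole V E (take s H @ drop s H)" using H by simp
  then have "hole V E (drop s H @ take s H)" by (rule hole_swap)
  then have "cyc (nth (rotate s H)) (length H)" using hole_cyc[of "rotate s H"] s by (simp add: rotate_drop_take)
  then show ?thesis by (auto simp: cyc_def inj_on_def nth_rotate)
qed

text \<open>\<open>f\<close> marks the neighbours of \<open>w\<close>, with positions read modulo
  \<open>n\<close>. The nearest marked positions before and after \<open>a\<close> are the ends of
  the sector. The condition \<open>spread\<close> expresses that \<open>w\<close> is not
  minor.\<close>

lemma sector_around:
  fixes f :: "nat \<Rightarrow> bool"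
  assumes a: "a < n" "\<not> f a" and per: "\<And>i. f (i mod n) = f i"
    and spread: "\<And>i. i < n \<Longrightarrow> \<exists>j<n. f j \<and> j \<noteq> i \<and> j \<noteq> Suc i mod n \<and> j \<noteq> Suc (Suc i) mod n"
    and n: "4 \<le> n"
  obtains s l q where "s < n" "0 < q" "q < l" "l + 3 \<le> n" "(s + q) mod n = a" "f s" "f (s + l)"
    "\<And>i. 0 < i \<Longrightarrow> i < l \<Longrightarrow> \<not> f (s + i)"
proof -
  have n0: "0 < n" using n by simp
  have pn: "f (x + n) = f x" for x using per[of "x + n"] per[of x] unfolding mod_add_self2 by blast
  obtain j where j: "j < n" "f j" using spread[of 0] n0 by blast
  have "f (a + (j + n - a))" using j a per[of "j + n"] by simp
  then have ex: "\<exists>d. f (a + d)" by blast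
  define d where "d = (LEAST d. f (a + d))"
  have d1: "f (a + d)" unfolding d_def by (rule LeastI_ex[OF ex])
  have d2: "\<not> f (a + i)" if "i < d" for i using not_less_Least[of i "\<lambda>d. f (a + d)"] that unfolding d_def by blast
  note d = d1 d2
  have d0: "0 < d" using d a by (cases d) auto
  have dn: "d < n"
  proof (rule ccontr)
    assume "\<not> d < n"
    then have e: "d - n < d" "a + d = (a + (d - n)) + n" using n0 by linarith+
    have "f (a + (d - n))" using d1 pn[of "a + (d - n)"] unfolding e(2) by blast
    then show False using d2[OF e(1)] by blast
  qed
  define g where "g = (LEAST g. f (a + n - g))"
  have fd: "f (a + n - (n - d))" using d(1) dn by simp
  have g1: "f (a + n - g)" unfolding g_def by (rule LeastI[of "\<lambda>g. f (a + n - g)", OF fd])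
  have g2: "\<not> f (a + n - i)" if "i < g" for i using not_less_Least[of i "\<lambda>g. f (a + n - g)"] that unfolding g_def by blast
  note g = g1 g2
  have gn: "g \<le> n - d" unfolding g_def by (rule Least_le[of "\<lambda>g. f (a + n - g)", OF fd])
  have g0: "0 < g"
  proof (rule gr0I)
    assume "g = 0"
    then show False using g1 a(2) pn[of a] by simp
  qed
  define s where "s = (a + n - g) mod n"
  have fs: "f (s + i) = f (a + n - g + i)" for i
  proof -
    have "(s + i) mod n = (a + n - g + i) mod n" unfolding s_def by (rule mod_add_left_eq)
    then show ?thesis using per[of "s + i"] per[of "a + n - g + i"] by simp
  qed
  have s: "s < n" using n0 by (simp add: s_def)
  have no: "\<not> f (s + i)" if "0 < i" "i < g + d" for i
  proof (cases "i \<le> g")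
    case True
    then have e: "a + n - g + i = a + n - (g - i)" "g - i < g" using gn that by linarith+
    show ?thesis unfolding fs e(1) by (rule g2[OF e(2)])
  next
    case False
    then have e: "a + n - g + i = a + (i - g) + n" "i - g < d" using gn that by linarith+
    show ?thesis unfolding fs e(1) pn by (rule d2[OF e(2)])
  qed
  have fl: "f (s + (g + d))"
  proof -
    have e: "a + n - g + (g + d) = a + d + n" using gn by linarith
    show ?thesis unfolding fs e pn by (rule d1)
  qed
  have "g + d + 3 \<le> n"
  proof (rule ccontr)
    assume c: "\<not> g + d + 3 \<le> n"
    \<comment> \<open>If the sector is too long, all marked positions are among the three
      consecutive ones that end with \<open>s\<close>.\<close>
    define i where "i = (s + (n - 2)) mod n"
    have i: "i < n" using n0 by (simp add: i_def)
    have e1: "Suc i mod n = (s + (n - 1)) mod n"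
    proof -
      have "Suc i mod n = Suc (s + (n - 2)) mod n" unfolding i_def by (rule mod_Suc_eq)
      also have "Suc (s + (n - 2)) = s + (n - 1)" using n by linarith
      finally show ?thesis .
    qed
    have e2: "Suc (Suc i) mod n = s"
    proof -
      have "Suc (Suc i) mod n = Suc (Suc i mod n) mod n" by (rule mod_Suc_eq[symmetric])
      also have "\<dots> = Suc (s + (n - 1)) mod n" unfolding e1 by (rule mod_Suc_eq)
      also have "Suc (s + (n - 1)) = s + n" using n by linarith
      finally show ?thesis using s by simp
    qed
    obtain j where j: "j < n" "f j" "j \<noteq> i" "j \<noteq> Suc i mod n" "j \<noteq> Suc (Suc i) mod n" using spread[OF i] by blast
    define r where "r = (if s \<le> j then j - s else j + n - s)"
    have r: "r < n" "(s + r) mod n = j"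
    proof -
      show "r < n" using j(1) s unfolding r_def by (cases "s \<le> j") auto
      have "s + r = j \<or> s + r = j + n" using s unfolding r_def by (cases "s \<le> j") auto
      then show "(s + r) mod n = j" using j(1) by auto
    qed
    have "r \<noteq> 0" using r(2) j(5) e2 s by (cases "r = 0") simp_all
    moreover have "r \<noteq> n - 1" using r(2) j(4) unfolding e1 by blast
    moreover have "r \<noteq> n - 2" using r(2) j(3) unfolding i_def by blast
    ultimately have "0 < r" "r < g + d" using r(1) c by linarith+
    then have "\<not> f (s + r)" by (rule no)
    then show False using j(2) per[of "s + r"] r(2) by simp
  qed
  moreover have "(s + g) mod n = a"
  proof -
    have "(s + g) mod n = (a + n - g + g) mod n" unfolding s_def by (rule mod_add_left_eq)
    also have "a + n - g + g = a + n" using gn by linarith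
    finally show ?thesis using a(1) by simp
  qed
  moreover have "f s" using fs[of 0] g(1) by simp
  ultimately show thesis by (intro that[of s g "g + d"] s g0 fl no) (use d0 in auto)
qed

text \<open>P may run through H, so lying on a part of H counts as a contact in \<open>cQ\<close>
  and \<open>cR\<close>. In a shortest piece this cannot happen: a vertex of P on H is not a
  neighbour of \<open>w\<close>, hence lies inside the sector or outside its extended neighborhood.
  It would be an end of the piece, and the next vertex of the piece would already be a contact; a
  single vertex would have to touch both parts, which are anticomplete.\<close>

lemma (in graph_C) minimal_config:
  assumes cy: "cyc h n" and l: "2 \<le> l" "l + 3 \<le> n" and wV: "w \<in> V" and wh: "\<And>i. i < n \<Longrightarrow> h i \<noteq> w"
    and w0: "E w (h 0)" and wl: "E w (h l)" and wQ: "\<And>i. 0 < i \<Longrightarrow> i < l \<Longrightarrow> \<not> E w (h i)"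
    and P: "ipath V E P" and wP: "\<And>x. x \<in> set P \<Longrightarrow> \<not> E w x" "w \<notin> set P"
    and a: "0 < a" "a < l" "E (hd P) (h a)"
    and b: "l < b" "b < n" "b = Suc l \<or> Suc b = n \<Longrightarrow> \<not> E w (h b)" "E (last P) (h b)"
  shows "\<exists>p k. sector_path V E h n l w p k"
proof -
  have heq: "h i = h j \<longleftrightarrow> i = j" and hE: "E (h i) (h j) \<longleftrightarrow> i = Suc j \<or> j = Suc i \<or> (i = 0 \<and> Suc j = n) \<or> (j = 0 \<and> Suc i = n)"
    if "i < n" "j < n" for i j
    using cy that by (auto simp: cyc_def inj_on_def)
  define far where "far t \<longleftrightarrow> l < t \<and> t < n \<and> (t = Suc l \<or> Suc t = n \<longrightarrow> \<not> E w (h t))" for t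
  define cQ where "cQ x \<longleftrightarrow> (\<exists>t. 0 < t \<and> t < l \<and> (x = h t \<or> E x (h t)))" for x
  define cR where "cR x \<longleftrightarrow> (\<exists>t. far t \<and> (x = h t \<or> E x (h t)))" for x
  define K where "K = length P"
  define Q where "Q i j \<longleftrightarrow> i < K \<and> j < K \<and> cQ (P ! i) \<and> cR (P ! j)" for i j
  have Pn: "P \<noteq> []" using P by auto
  have "cQ (hd P)" using a unfolding cQ_def by blast
  moreover have "cR (last P)" using b unfolding cR_def far_def by blast
  ultimately have "Q 0 (K - 1)" using Pn unfolding Q_def K_def by (simp add: hd_conv_nth last_conv_nth)
  then obtain i j where Q: "Q i j" "\<And>i' j'. i' - j' + (j' - i') < i - j + (j - i) \<Longrightarrow> \<not> Q i' j'"
    using closest_pair[of Q 0 "K - 1"] by metis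
  have ij: "i < K" "j < K" "cQ (P ! i)" "cR (P ! j)" using Q(1) by (auto simp: Q_def)
  define k where "k = Suc (i - j + (j - i))"
  \<comment> \<open>The contact outside may come first along P; the piece is then traversed
    backwards.\<close>
  define f where "f m = (if i \<le> j then i + m else i - m)" for m
  define p where "p m = P ! f m" for m
  have fK: "f m < K" if "m < k" for m using that ij(1,2) unfolding f_def k_def by (cases "i \<le> j") simp_all
  have f0: "f 0 = i" "f (k - 1) = j" unfolding f_def k_def by (cases "i \<le> j"; simp)+
  have fd: "f m - j + (j - f m) < i - j + (j - i)" if "0 < m" "m < k" for m
    using that unfolding f_def k_def by (cases "i \<le> j") simp_all
  have fd': "i - f m + (f m - i) < i - j + (j - i)" if "Suc m < k" for m
    using that unfolding f_def k_def by (cases "i \<le> j") simp_all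
  have fS: "(f x = Suc (f y) \<or> f y = Suc (f x)) \<longleftrightarrow> (x = Suc y \<or> y = Suc x)" and fI: "f x = f y \<longleftrightarrow> x = y" if "x < k" "y < k" for x y
    using that unfolding f_def k_def by (cases "i \<le> j"; simp; linarith)+
  have nQ: "\<not> cQ (p m)" if "0 < m" "m < k" for m
    using Q(2)[OF fd[OF that]] fK[OF that(2)] ij unfolding Q_def p_def by blast
  have nR: "\<not> cR (p m)" if "Suc m < k" for m
    using Q(2)[OF fd'[OF that]] fK[of m] that ij unfolding Q_def p_def by simp
  have pE: "E (p x) (p y) \<longleftrightarrow> x = Suc y \<or> y = Suc x" if "x < k" "y < k" for x y
    using P fK[OF that(1)] fK[OF that(2)] fS[OF that] unfolding ipath_def p_def K_def by blast
  have peq: "p x = p y \<longleftrightarrow> x = y" if "x < k" "y < k" for x y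
    using P fK[OF that(1)] fK[OF that(2)] fI[OF that] unfolding ipath_def p_def K_def by (simp add: nth_eq_iff_index_eq)
  have pP: "p m \<in> set P" if "m < k" for m using fK[OF that] unfolding p_def K_def by simp
  have QR: "h s \<noteq> h t" "\<not> E (h s) (h t)" "\<not> E (h t) (h s)" if "0 < s" "s < l" "far t" for s t
  proof -
    have t: "s < n" "t < n" "l < t" using that l unfolding far_def by auto
    then show "h s \<noteq> h t" "\<not> E (h s) (h t)" "\<not> E (h t) (h s)"
      using that heq[OF t(1,2)] hE[OF t(1,2)] hE[OF t(2,1)] by auto
  qed
  have c0: "cQ (p 0)" and ck: "cR (p (k - 1))" using ij f0 unfolding p_def by simp_all
  have kk: "0 < k" "k - 1 < k" unfolding k_def by simp_all
  have ph: "p m \<noteq> h t" if m: "m < k" and t: "t < n" for m t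
  proof
    assume e: "p m = h t"
    have nw: "\<not> E w (h t)" using wP(1)[OF pP[OF m]] e by simp
    have "t \<noteq> 0" "t \<noteq> l" using nw w0 wl by metis+
    then consider "0 < t" "t < l" | "far t" using t nw unfolding far_def by linarith
    then show False
    proof cases
      case 1
      then have "cQ (p m)" using e unfolding cQ_def by blast
      then have m0: "m = 0" using nQ[of m] m by blast
      show False
      proof (cases "k = 1")
        case True
        then obtain r where "far r" "h t = h r \<or> E (h t) (h r)" using ck e m0 unfolding cR_def by auto
        then show False using QR[OF 1] by blast
      next
        case False
        then have k1: "Suc 0 < k" using kk by simp
        then have "E (p 1) (h t)" using pE[of 1 0] e m0 by simp
        then have "cQ (p 1)" using 1 unfolding cQ_def by blast
        then show False using nQ[of 1] k1 by simp
      qed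
    next
      case 2
      then have "cR (p m)" using e unfolding cR_def by blast
      then have mk: "m = k - 1" using nR[of m] m by linarith
      show False
      proof (cases "k = 1")
        case True
        then obtain r where "0 < r" "r < l" "h t = h r \<or> E (h t) (h r)" using c0 e mk unfolding cQ_def by auto
        then show False using QR[OF _ _ 2, of r] by metis
      next
        case False
        then have k1: "Suc (k - 2) < k" "k - 1 = Suc (k - 2)" using kk by simp_all
        then have "E (p (k - 2)) (h t)" using pE[of "k - 2" "k - 1"] e mk by simp
        then have "cR (p (k - 2))" using 2 unfolding cR_def by blast
        then show False using nR[OF k1(1)] by simp
      qed
    qed
  qed
  have "sector_path V E h n l w p k"
  proof unfold_locales
    show "\<exists>a>0. a < l \<and> E (p 0) (h a)"
    proof -
      obtain t where t: "0 < t" "t < l" "p 0 = h t \<or> E (p 0) (h t)" using c0 unfolding cQ_def by blast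
      then show ?thesis using ph[OF kk(1), of t] l by auto
    qed
    show "\<exists>b>l. b < n \<and> (b = Suc l \<or> Suc b = n \<longrightarrow> \<not> E w (h b)) \<and> E (p (k - 1)) (h b)"
    proof -
      obtain t where t: "far t" "p (k - 1) = h t \<or> E (p (k - 1)) (h t)" using ck unfolding cR_def by blast
      then show ?thesis using ph[OF kk(2), of t] unfolding far_def by blast
    qed
    show "\<not> E (p i) (h a)" if "0 < i" "i < k" "0 < a" "a < l" for i a
      using nQ[OF that(1,2)] that(3,4) unfolding cQ_def by blast
    show "\<not> E (p i) (h b)" if "Suc i < k" "l < b" "b < n" "b = Suc l \<or> Suc b = n \<Longrightarrow> \<not> E w (h b)" for i b
      using nR[OF that(1)] that(2-4) unfolding cR_def far_def by blast
    show "p i \<in> V" if "i < k" for i using pP[OF that] ipath_subset[OF P] by blast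
    show "p i \<noteq> w" if "i < k" for i using pP[OF that] wP(2) by metis
    show "\<not> E w (p i)" if "i < k" for i by (rule wP(1)[OF pP[OF that]])
  qed (use cy l wV wh w0 wl wQ kk ph peq pE in blast)+
  then show ?thesis by blast
qed

theorem theorem2p13:
  fixes V :: "'a set" and E :: "'a \<Rightarrow> 'a \<Rightarrow> bool" and H P :: "'a list" and w :: 'a
  assumes "in_class_C V E"
    and "hole V E H" and "length H > 6"
    and "major V E H w"
    and "\<not> hub V E H w \<or> (\<forall>u. major V E H u \<longrightarrow> hub V E H u)"
    and "significant V E H w P"
  shows "\<exists>p \<in> set P. E w p"
proof (rule ccontr)
  assume "\<not> ?thesis"
  then have wP: "\<And>x. x \<in> set P \<Longrightarrow> \<not> E w x" by blast
  interpret graph_C V E by unfold_locales (rule assms(1))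
  define n where "n = length H"
  have n6: "n > 6" using assms(3) n_def by simp
  have w: "w \<in> V" "w \<notin> set H" and nmin: "\<not> minor V E H w" and Nne: "NH E H w \<noteq> {}" using assms(4) unfolding major_def by auto
  have NHw: "v \<in> NH E H w \<longleftrightarrow> v \<in> set H \<and> E w v" for v using w(2) unfolding NH_def by auto
  obtain a b where P: "ipath V E P" and a: "a \<in> NH E H (hd P)" "a \<notin> NH E H w" and b: "b \<in> NH E H (last P)" and ab: "distant E H w a b"
    using assms(6) unfolding significant_def by blast
  have Pn: "P \<noteq> []" using P by auto
  \<comment> \<open>If \<open>w\<close> were on a P with at least two vertices, P would contain a
    neighbour of \<open>w\<close>; and P cannot be \<open>w\<close> alone, because \<open>a\<close>
    is a neighbour of \<open>hd P\<close> but not of \<open>w\<close>.\<close>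
  have wnP: "w \<notin> set P"
  proof
    assume "w \<in> set P"
    then obtain x where x: "x < length P" "w = P ! x" by (metis in_set_conv_nth)
    have E: "E (P ! i) (P ! j) \<longleftrightarrow> (i = Suc j \<or> j = Suc i)" if "i < length P" "j < length P" for i j
      using P that unfolding ipath_def by blast
    consider "Suc x < length P" | "0 < x" | "length P = 1" "x = 0" using x(1) by linarith
    then show False
    proof cases
      case 1 then show False using E[of x "Suc x"] wP[of "P ! Suc x"] x by simp
    next
      case 2 then show False using E[of x "x - 1"] wP[of "P ! (x - 1)"] x by simp
    next
      case 3 then show False using a x(2) Pn by (simp add: hd_conv_nth)
    qed
  qed
  have aH: "a \<in> set H" "E (hd P) a" and bH: "b \<in> set H" "E (last P) b" using a(1) b unfolding NH_def by auto
  obtain ia where ia: "ia < n" "a = H ! ia" using aH(1) unfolding n_def by (metis in_set_conv_nth)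
  have seg2: "set (seg H i 2) = {H ! (i mod n), H ! (Suc i mod n), H ! (Suc (Suc i) mod n)}" for i
    by (simp add: seg_def n_def upt_conv_Cons numeral_2_eq_2 insert_commute)
  define f where "f i \<longleftrightarrow> E w (H ! (i mod n))" for i
  have fsp: "\<exists>j<n. f j \<and> j \<noteq> i \<and> j \<noteq> Suc i mod n \<and> j \<noteq> Suc (Suc i) mod n" if i: "i < n" for i
  proof (rule ccontr)
    assume c: "\<not> ?thesis"
    have "NH E H w \<subseteq> set (seg H i 2)"
    proof
      fix v assume "v \<in> NH E H w"
      then have v: "v \<in> set H" "E w v" using NHw by auto
      then obtain j where j: "j < n" "v = H ! j" unfolding n_def by (metis in_set_conv_nth)
      then have "f j" using v(2) unfolding f_def by simp
      then have "j = i \<or> j = Suc i mod n \<or> j = Suc (Suc i) mod n" using c j(1) by blast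
      then show "v \<in> set (seg H i 2)" unfolding seg2 using j(2) i by auto
    qed
    then show False using nmin w Nne i unfolding minor_def n_def by blast
  qed
  have fa: "\<not> f ia" using a(2) ia aH(1) unfolding f_def NHw by simp
  have per: "f (i mod n) = f i" for i unfolding f_def by simp
  have "\<exists>s l q. s < n \<and> 0 < q \<and> q < l \<and> l + 3 \<le> n \<and> (s + q) mod n = ia \<and> f s \<and> f (s + l) \<and> (\<forall>i. 0 < i \<longrightarrow> i < l \<longrightarrow> \<not> f (s + i))"
  proof (rule sector_around[of ia n f])
    show "\<exists>j<n. f j \<and> j \<noteq> i \<and> j \<noteq> Suc i mod n \<and> j \<noteq> Suc (Suc i) mod n" if "i < n" for i by (rule fsp[OF that])
    fix s l q assume A: "s < n" "0 < q" "q < l" "l + 3 \<le> n" "(s + q) mod n = ia" "f s" "f (s + l)"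
      and no: "\<And>i. 0 < i \<Longrightarrow> i < l \<Longrightarrow> \<not> f (s + i)"
    show ?thesis
      by (rule exI[of _ s], rule exI[of _ l], rule exI[of _ q], intro conjI allI impI) (rule A no | assumption)+
  next
    show "ia < n" "\<not> f ia" "4 \<le> n" using ia(1) fa n6 by simp_all
    show "f (i mod n) = f i" for i by (rule per)
  qed
  then obtain s l q where slq: "s < n \<and> 0 < q \<and> q < l \<and> l + 3 \<le> n \<and> (s + q) mod n = ia \<and> f s \<and> f (s + l) \<and> (\<forall>i. 0 < i \<longrightarrow> i < l \<longrightarrow> \<not> f (s + i))"
    by (elim exE) (rule that)
  then have s: "s < n" and q: "0 < q" "q < l" and l3: "l + 3 \<le> n" and sq: "(s + q) mod n = ia" and f: "f s" "f (s + l)"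
    by blast+
  have f3: "\<not> f (s + i)" if "0 < i" "i < l" for i using slq that by (elim conjE) simp
  define h where "h i = H ! ((s + i) mod n)" for i
  have cy: "cyc h n" unfolding h_def[abs_def] n_def by (rule rotate_cyc[OF assms(2) s[unfolded n_def]])
  have n0: "0 < n" using n6 by simp
  have hH: "h i \<in> set H" for i
  proof -
    have "(s + i) mod n < length H" using n0 unfolding n_def by (rule mod_less_divisor)
    then show ?thesis unfolding h_def by (rule nth_mem)
  qed
  have surj: "\<exists>t<n. x = h t" if x: "x \<in> set H" for x
  proof -
    obtain j where j: "j < n" "x = H ! j" using x unfolding n_def by (metis in_set_conv_nth)
    show ?thesis
    proof (cases "s \<le> j")
      case True
      then have e: "s + (j - s) = j" "j - s < n" using j(1) by linarith+
      have "h (j - s) = x" unfolding h_def e(1) mod_less[OF j(1)] by (rule j(2)[symmetric])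
      then show ?thesis using e(2) by (intro exI[of _ "j - s"] conjI) (rule e(2), rule sym)
    next
      case False
      then have e: "s + (j + n - s) = j + n" "j + n - s < n" using s by linarith+
      have "h (j + n - s) = x" unfolding h_def e(1) mod_add_self2 mod_less[OF j(1)] by (rule j(2)[symmetric])
      then show ?thesis using e(2) by (intro exI[of _ "j + n - s"] conjI) (rule e(2), rule sym)
    qed
  qed
  have Eh: "E w (h i) \<longleftrightarrow> f (s + i)" for i unfolding f_def h_def by simp
  have w0: "E w (h 0)" and wl: "E w (h l)" and wQ: "\<And>i. 0 < i \<Longrightarrow> i < l \<Longrightarrow> \<not> E w (h i)" using f f3 unfolding Eh by simp_all
  have aq: "a = h q" unfolding h_def using sq ia by simp
  have segl: "set (seg H s l) = h ` {0..<Suc l}" unfolding seg_def h_def n_def by (simp del: upt_Suc)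
  have hn: "H ! ((s + length H - 1) mod length H) = h (n - 1)" "H ! ((s + l + 1) mod length H) = h (Suc l)"
  proof -
    have "s + length H - 1 = s + (n - 1)" "s + l + 1 = s + Suc l" using n0 unfolding n_def by linarith+
    then show "H ! ((s + length H - 1) mod length H) = h (n - 1)" "H ! ((s + l + 1) mod length H) = h (Suc l)"
      unfolding h_def n_def by metis+
  qed
  have Nh: "h t \<in> NH E H w \<longleftrightarrow> E w (h t)" for t using NHw[of "h t"] hH[of t] by blast
  have h0: "h 0 = H ! s" using s unfolding h_def by simp
  have ht: "H ! ((s + t) mod length H) = h t" for t unfolding h_def n_def ..
  have sec: "sector E H w s l"
    unfolding sector_def ht h0[symmetric] Nh
    using s q l3 w0 wl wQ unfolding n_def by auto
  have aext: "a \<in> ext_nbhd E H w s l" unfolding ext_nbhd_def segl aq using q by simp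
  \<comment> \<open>Distance of \<open>a\<close> and \<open>b\<close> is used only for the sector
    that contains \<open>a\<close>.\<close>
  have bext: "b \<notin> ext_nbhd E H w s l" using ab sec aext unfolding distant_def by blast
  obtain tb where tb: "tb < n" "b = h tb" using surj[OF bH(1)] by blast
  have tbl: "l < tb"
  proof (rule ccontr)
    assume "\<not> l < tb" then show False using bext tb(2) unfolding ext_nbhd_def segl by simp
  qed
  have tbw: "\<not> E w (h tb)" if "tb = Suc l \<or> Suc tb = n"
  proof
    assume "E w (h tb)"
    then have "b \<in> NH E H w" using tb(2) bH(1) NHw by simp
    moreover have "b = h (Suc l) \<or> b = h (n - 1)" using that tb(2) by auto
    ultimately show False using bext unfolding ext_nbhd_def hn by blast
  qed
  have wh: "h i \<noteq> w" for i using hH[of i] w(2) by metis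
  have l2: "2 \<le> l" using q by simp
  have "E (hd P) (h q)" "E (last P) (h tb)" using aH(2) bH(2) aq tb(2) by simp_all
  then obtain p k where cf: "sector_path V E h n l w p k"
    using minimal_config[OF cy l2 l3 w(1) wh w0 wl wQ P wP wnP q _ tbl tb(1) tbw] by blast
  interpret c: sector_path V E h n l w p k by (rule cf)
  have setH: "set H = h ` {..<n}" using hH surj by auto
  show False
  proof (rule c.config_False[OF n6])
    assume W: "c.W (Suc l)" "c.W (n - 1)" and mid: "\<And>r. Suc l < r \<Longrightarrow> Suc r < n \<Longrightarrow> \<not> c.W r" and l4: "l + 4 \<le> n" and k: "k = 1"
    have W': "c.W t \<longleftrightarrow> t = 0 \<or> t = l \<or> t = Suc l \<or> t = n - 1" if "t < n" for t
    proof (cases "t \<le> l")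
      case True
      then show ?thesis using c.W0 c.Wl c.WQ[of t] l3 by (cases "t = 0"; cases "t = l") auto
    next
      case False
      then show ?thesis using W mid[of t] that by (cases "t = Suc l"; cases "t = n - 1") auto
    qed
    have NHw': "NH E H w = {h (n - 1), h 0, h l, h (Suc l)}"
    proof (rule set_eqI)
      fix v
      have "v \<in> NH E H w \<longleftrightarrow> (\<exists>t<n. v = h t \<and> c.W t)" unfolding NHw setH c.W_def by auto
      also have "\<dots> \<longleftrightarrow> v \<in> {h (n - 1), h 0, h l, h (Suc l)}"
      proof
        assume "\<exists>t<n. v = h t \<and> c.W t"
        then show "v \<in> {h (n - 1), h 0, h l, h (Suc l)}" using W' by auto
      next
        have "n - 1 < n" "0 < n" "l < n" "Suc l < n" using l3 by linarith+
        then show "\<exists>t<n. v = h t \<and> c.W t" if "v \<in> {h (n - 1), h 0, h l, h (Suc l)}"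
          using that W c.W0 c.Wl by blast
      qed
      finally show "v \<in> NH E H w \<longleftrightarrow> v \<in> {h (n - 1), h 0, h l, h (Suc l)}" .
    qed
    \<comment> \<open>\<open>in_order4\<close> is verified starting one position before the sector,
      at \<open>h (n - 1)\<close>; this explains the offsets 0, 1, \<open>l + 1\<close> and
      \<open>l + 2\<close>.\<close>
    have rot: "H ! (((s + n - 1) mod n + Suc x) mod n) = h x" for x
    proof -
      have "((s + n - 1) mod n + Suc x) mod n = (s + n - 1 + Suc x) mod n" by (rule mod_add_left_eq)
      also have "s + n - 1 + Suc x = s + x + n" using n0 by linarith
      finally show ?thesis unfolding h_def by simp
    qed
    have rot0: "H ! (((s + n - 1) mod n + 0) mod n) = h (n - 1)" using n0 unfolding h_def by simp
    have "in_order4 H (h (n - 1)) (h 0) (h l) (h (Suc l))"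
      unfolding in_order4_def n_def[symmetric]
      by (rule exI[of _ "(s + n - 1) mod n"], rule exI[of _ 0], rule exI[of _ "Suc 0"], rule exI[of _ "Suc l"], rule exI[of _ "Suc (Suc l)"])
        (use rot[of 0] rot[of l] rot[of "Suc l"] rot0 n0 l2 l4 in simp)
    moreover have "E (h (n - 1)) (h 0)" "E (h l) (h (Suc l))" "\<not> E (h (n - 1)) (h (Suc l))" "\<not> E (h 0) (h l)"
      using c.hE[of "n - 1" 0] c.hE[of l "Suc l"] c.hE[of "n - 1" "Suc l"] c.hE[of 0 l] l2 l4 by auto
    ultimately have "hub V E H w" unfolding hub_def using assms(4) NHw' by blast
    \<comment> \<open>Since \<open>w\<close> is a hub, the disjunction in the hypotheses makes every
      major vertex a hub.\<close>
    then have hub: "hub V E H u" if "major V E H u" for u using assms(5) that by blast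
    have p0H: "p 0 \<notin> set H" unfolding setH using c.ph[OF c.k0] by blast
    have NHp: "NH E H (p 0) = h ` {..<n} \<inter> {v. E (p 0) v}" unfolding NH_def setH using p0H setH by auto
    obtain x where x: "0 < x" "x < l" "c.A 0 x" using c.A_sector by blast
    obtain y where y: "c.Rok y" "c.A 0 y" using c.A_far k by auto
    have "l < y" "y < n" "y \<noteq> Suc l" "y \<noteq> n - 1" using y(1) W l4 unfolding c.Rok_def by auto
    then have y': "Suc l < y" "y < n - 1" by auto
    have xN: "h x \<in> NH E H (p 0)" and yN: "h y \<in> NH E H (p 0)" unfolding NHp using x y y' l3 by (auto simp: c.EA)
    \<comment> \<open>The positions \<open>x\<close> and \<open>y\<close> are at least three apart
      in both directions around H, so no subpath with three vertices contains both.\<close>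
    have "\<not> minor V E H (p 0)"
    proof
      assume "minor V E H (p 0)"
      then obtain r where r: "NH E H (p 0) \<subseteq> set (seg H r 2)" unfolding minor_def by blast
      have segr: "\<exists>t\<le>2. v = H ! ((r + t) mod n)" if v: "v \<in> set (seg H r 2)" for v
      proof -
        have "v \<in> (\<lambda>t. H ! ((r + t) mod n)) ` {0..<Suc 2}" using v unfolding seg_def n_def set_map set_upt .
        then show ?thesis
        proof (rule imageE)
          fix t assume "v = H ! ((r + t) mod n)" "t \<in> {0..<Suc 2}"
          then show ?thesis by (intro exI[of _ t]) simp
        qed
      qed
      obtain t1 where t1: "t1 \<le> 2" "h x = H ! ((r + t1) mod n)" using segr r xN by blast
      obtain t2 where t2: "t2 \<le> 2" "h y = H ! ((r + t2) mod n)" using segr r yN by blast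
      have dH: "H ! i = H ! j \<longleftrightarrow> i = j" if "i < n" "j < n" for i j
        using assms(2) that unfolding hole_def n_def by (simp add: nth_eq_iff_index_eq)
      have e1: "(s + x) mod n = (r + t1) mod n" and e2: "(s + y) mod n = (r + t2) mod n"
        using t1(2) t2(2) dH n0 unfolding h_def by simp_all
      have "(s + y + t1) mod n = (r + t2 + t1) mod n" using e2 by (metis mod_add_left_eq)
      moreover have "(s + x + t2) mod n = (r + t1 + t2) mod n" using e1 by (metis mod_add_left_eq)
      ultimately have "(s + y + t1) mod n = (s + x + t2) mod n" by (simp add: ac_simps)
      moreover have le: "s + x + t2 \<le> s + y + t1" using x(2) y' t2(1) by linarith
      ultimately have "n dvd (s + y + t1) - (s + x + t2)" using mod_eq_dvd_iff_nat[OF le] by simp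
      moreover have "0 < (s + y + t1) - (s + x + t2)" "(s + y + t1) - (s + x + t2) < n"
        using x y' t1(1) t2(1) by linarith+
      ultimately show False using nat_dvd_not_less by blast
    qed
    then have "major V E H (p 0)" unfolding major_def using p0H xN c.pV[OF c.k0] by blast
    then have "hub V E H (p 0)" by (rule hub)
    then show "\<exists>x1 y1 x2 y2. h ` {..<n} \<inter> {v. E (p 0) v} = {x1, y1, x2, y2} \<and> E x1 y1 \<and> E x2 y2"
      unfolding hub_def NHp by blast
  qed
qed

end
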